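(* Let $\mathcal{C}$ be a skeletally small abelian category and let $\mathcal{X}\subseteq\mathcal{C}$ be an $n$-cluster tilting subcategory, $n\ge 1$. Then there is an isomorphism of abelian groups $$K_0(\mathcal{C}^{\mathcal{X}}_R)\xrightarrow{\ \cong\ }K_0^{\mathsf{sp}}(\mathcal{X}),\qquad [C]^{\mathcal{X}}_R\longmapsto\sum_{i=0}^{n-1}(-1)^i[X_i]^{\mathsf{sp}},$$ where $C\in\mathcal{C}$ admits an $\mathcal{X}$-resolution $X_{n-1}\to\cdots\to X_1\to X_0\to C$ in $\mathcal{C}^{\mathcal{X}}_R$ of length $n-1$; its inverse is given by $[X]^{\mathsf{sp}}\mapsto[X]^{\mathcal{X}}_R$ for $X\in\mathcal{X}$.
   Context: A full subcategory $\mathcal{X}$ of an abelian category $\mathcal{C}$ is $n$-cluster tilting (Jasso) if it is functorially finite, generating and cogenerating (every object of $\mathcal{C}$ is a quotient of an object of $\mathcal{X}$ and a subobject of an object of $\mathcal{X}$), and $\mathcal{X}=\{C\in\mathcal{C}\mid\operatorname{Ext}^i_{\mathcal{C}}(\mathcal{X},C)=0,\ 1\le i\le n-1\}=\{C\in\mathcal{C}\mid\operatorname{Ext}^i_{\mathcal{C}}(C,\mathcal{X})=0,\ 1\le i\le n-1\}$. $\mathcal{C}^{\mathcal{X}}_R$ denotes $\mathcal{C}$ equipped with the relative (exact, hence extriangulated) structure whose conflations are the short exact sequences $0\to A\to B\to C\to 0$ whose class $\delta\in\operatorname{Ext}^1_{\mathcal{C}}(C,A)$ satisfies $x^*\delta=0$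 (i.e. the pullback along $x$ splits) for every morphism $x\colon X\to C$ with $X\in\mathcal{X}$. $K_0(\mathcal{C}^{\mathcal{X}}_R)$ is the abelian group generated by isomorphism classes of objects of $\mathcal{C}$ modulo $[A]-[B]+[C]$ for all these conflations; $[C]^{\mathcal{X}}_R$ is the class of $C$. $K_0^{\mathsf{sp}}(\mathcal{X})$ is the split Grothendieck group of the additive category $\mathcal{X}$: generators $[X]^{\mathsf{sp}}$ for isomorphism classes of $X\in\mathcal{X}$, relations $[X\oplus X']^{\mathsf{sp}}=[X]^{\mathsf{sp}}+[X']^{\mathsf{sp}}$. An $\mathcal{X}$-resolution of length $m$ of $C$ in $\mathcal{C}^{\mathcal{X}}_R$ is a complex $X_m\to\cdots\to X_0\to C$ with $X_i\in\mathcal{X}$ obtained by splicing conflations $C_{i+1}\to X_i\to C_i$ of $\mathcal{C}^{\mathcal{X}}_R$, $0\le i\le m-1$, with $C_0=C$ and $C_m=X_m$ (for $m=0$: $C=X_0$). *)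

theory Defs
  imports "HOL-Algebra.Free_Abelian_Groups"
begin

section \<open>Abelian categories\<close>

text \<open>
  Objects and arrows form sets, so a category in the sense below is small. Skeletal
  smallness serves to make the isomorphism classes of objects a set, which is automatic here;
  the object and arrow types are arbitrary. The composite
  \<open>g \<cdot> f\<close> is \<open>f\<close> followed by \<open>g\<close>.
\<close>

record ('o, 'm) category =
  Ob :: "'o set"
  Arr :: "'m set"
  Dom :: "'m \<Rightarrow> 'o"
  Cod :: "'m \<Rightarrow> 'o"
  idm :: "'o \<Rightarrow> 'm"
  Comp :: "'m \<Rightarrow> 'm \<Rightarrow> 'm"  (infixl \<open>\<cdot>\<index>\<close> 70)

definition Hom :: "('o, 'm, 'e) category_scheme \<Rightarrow> 'o \<Rightarrow> 'o \<Rightarrow> 'm set" where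
  "Hom \<C> a b = {f \<in> Arr \<C>. Dom \<C> f = a \<and> Cod \<C> f = b}"

locale category =
  fixes \<C> :: "('o, 'm, 'e) category_scheme" (structure)
  assumes Dom_in_Ob: "f \<in> Arr \<C> \<Longrightarrow> Dom \<C> f \<in> Ob \<C>"
    and Cod_in_Ob: "f \<in> Arr \<C> \<Longrightarrow> Cod \<C> f \<in> Ob \<C>"
    and idm_in_Hom: "a \<in> Ob \<C> \<Longrightarrow> idm \<C> a \<in> Hom \<C> a a"
    and comp_in_Hom: "f \<in> Hom \<C> a b \<Longrightarrow> g \<in> Hom \<C> b c \<Longrightarrow> g \<cdot> f \<in> Hom \<C> a c"
    and comp_assoc: "f \<in> Hom \<C> a b \<Longrightarrow> g \<in> Hom \<C> b c \<Longrightarrow> h \<in> Hom \<C> c d \<Longrightarrow>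
          (h \<cdot> g) \<cdot> f = h \<cdot> (g \<cdot> f)"
    and comp_idm: "f \<in> Hom \<C> a b \<Longrightarrow> f \<cdot> idm \<C> a = f"
    and idm_comp: "f \<in> Hom \<C> a b \<Longrightarrow> idm \<C> b \<cdot> f = f"

definition iso_arr :: "('o, 'm, 'e) category_scheme \<Rightarrow> 'm \<Rightarrow> bool" where
  "iso_arr \<C> f \<longleftrightarrow> f \<in> Arr \<C> \<and>
     (\<exists>g \<in> Hom \<C> (Cod \<C> f) (Dom \<C> f).
        g \<cdot>\<^bsub>\<C>\<^esub> f = idm \<C> (Dom \<C> f) \<and> f \<cdot>\<^bsub>\<C>\<^esub> g = idm \<C> (Cod \<C> f))"

definition isomorphic :: "('o, 'm, 'e) category_scheme \<Rightarrow> 'o \<Rightarrow> 'o \<Rightarrow> bool" where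
  "isomorphic \<C> a b \<longleftrightarrow> (\<exists>f \<in> Hom \<C> a b. iso_arr \<C> f)"

definition is_mono :: "('o, 'm, 'e) category_scheme \<Rightarrow> 'm \<Rightarrow> bool" where
  "is_mono \<C> f \<longleftrightarrow> f \<in> Arr \<C> \<and>
     (\<forall>a. \<forall>g \<in> Hom \<C> a (Dom \<C> f). \<forall>h \<in> Hom \<C> a (Dom \<C> f).
        f \<cdot>\<^bsub>\<C>\<^esub> g = f \<cdot>\<^bsub>\<C>\<^esub> h \<longrightarrow> g = h)"

definition is_epi :: "('o, 'm, 'e) category_scheme \<Rightarrow> 'm \<Rightarrow> bool" where
  "is_epi \<C> f \<longleftrightarrow> f \<in> Arr \<C> \<and>
     (\<forall>b. \<forall>g \<in> Hom \<C> (Cod \<C> f) b. \<forall>h \<in> Hom \<C> (Cod \<C> f) b.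
        g \<cdot>\<^bsub>\<C>\<^esub> f = h \<cdot>\<^bsub>\<C>\<^esub> f \<longrightarrow> g = h)"

definition is_zero_object :: "('o, 'm, 'e) category_scheme \<Rightarrow> 'o \<Rightarrow> bool" where
  "is_zero_object \<C> z \<longleftrightarrow> z \<in> Ob \<C> \<and>
     (\<forall>a \<in> Ob \<C>. (\<exists>!f. f \<in> Hom \<C> z a) \<and> (\<exists>!f. f \<in> Hom \<C> a z))"

definition is_pullback ::
  "('o, 'm, 'e) category_scheme \<Rightarrow> 'm \<Rightarrow> 'm \<Rightarrow> 'm \<Rightarrow> 'm \<Rightarrow> bool" where
  \<comment> \<open>the square with legs p, q out of the pullback object and cospan x, g, where
      x after p equals g after q\<close>
  "is_pullback \<C> p q x g \<longleftrightarrow>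
     x \<in> Arr \<C> \<and> g \<in> Hom \<C> (Dom \<C> g) (Cod \<C> x) \<and>
     p \<in> Hom \<C> (Dom \<C> p) (Dom \<C> x) \<and> q \<in> Hom \<C> (Dom \<C> p) (Dom \<C> g) \<and>
     x \<cdot>\<^bsub>\<C>\<^esub> p = g \<cdot>\<^bsub>\<C>\<^esub> q \<and>
     (\<forall>t. \<forall>u \<in> Hom \<C> t (Dom \<C> x). \<forall>v \<in> Hom \<C> t (Dom \<C> g).
        x \<cdot>\<^bsub>\<C>\<^esub> u = g \<cdot>\<^bsub>\<C>\<^esub> v \<longrightarrow>
        (\<exists>!w. w \<in> Hom \<C> t (Dom \<C> p) \<and> p \<cdot>\<^bsub>\<C>\<^esub> w = u \<and> q \<cdot>\<^bsub>\<C>\<^esub> w = v))"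

record ('o, 'm) preadditive_category = "('o, 'm) category" +
  zero_arr :: "'o \<Rightarrow> 'o \<Rightarrow> 'm"
  add_arr :: "'m \<Rightarrow> 'm \<Rightarrow> 'm"  (infixl \<open>\<boxplus>\<index>\<close> 65)

definition hom_group ::
  "('o, 'm, 'e) preadditive_category_scheme \<Rightarrow> 'o \<Rightarrow> 'o \<Rightarrow> 'm monoid" where
  "hom_group \<C> a b = \<lparr>carrier = Hom \<C> a b, monoid.mult = add_arr \<C>, monoid.one = zero_arr \<C> a b\<rparr>"

locale preadditive_category = category \<C>
  for \<C> :: "('o, 'm, 'e) preadditive_category_scheme" (structure) +
  assumes hom_comm_group: "a \<in> Ob \<C> \<Longrightarrow> b \<in> Ob \<C> \<Longrightarrow> comm_group (hom_group \<C> a b)"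
    and comp_add: "f \<in> Hom \<C> a b \<Longrightarrow> f' \<in> Hom \<C> a b \<Longrightarrow> g \<in> Hom \<C> b c \<Longrightarrow>
          g \<cdot> (f \<boxplus> f') = g \<cdot> f \<boxplus> g \<cdot> f'"
    and add_comp: "f \<in> Hom \<C> a b \<Longrightarrow> g \<in> Hom \<C> b c \<Longrightarrow> g' \<in> Hom \<C> b c \<Longrightarrow>
          (g \<boxplus> g') \<cdot> f = g \<cdot> f \<boxplus> g' \<cdot> f"

definition is_biproduct ::
  "('o, 'm, 'e) preadditive_category_scheme \<Rightarrow> 'o \<Rightarrow> 'o \<Rightarrow> 'o \<Rightarrow> bool" where
  \<comment> \<open>b is a direct sum of a and a'\<close>
  "is_biproduct \<C> a a' b \<longleftrightarrow> a \<in> Ob \<C> \<and> a' \<in> Ob \<C> \<and> b \<in> Ob \<C> \<and>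
     (\<exists>i \<in> Hom \<C> a b. \<exists>i' \<in> Hom \<C> a' b. \<exists>p \<in> Hom \<C> b a. \<exists>p' \<in> Hom \<C> b a'.
        p \<cdot>\<^bsub>\<C>\<^esub> i = idm \<C> a \<and> p' \<cdot>\<^bsub>\<C>\<^esub> i' = idm \<C> a' \<and>
        p \<cdot>\<^bsub>\<C>\<^esub> i' = zero_arr \<C> a' a \<and> p' \<cdot>\<^bsub>\<C>\<^esub> i = zero_arr \<C> a a' \<and>
        i \<cdot>\<^bsub>\<C>\<^esub> p \<boxplus>\<^bsub>\<C>\<^esub> i' \<cdot>\<^bsub>\<C>\<^esub> p' = idm \<C> b)"

definition is_kernel :: "('o, 'm, 'e) preadditive_category_scheme \<Rightarrow> 'm \<Rightarrow> 'm \<Rightarrow> bool" where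
  \<comment> \<open>k is a kernel of f\<close>
  "is_kernel \<C> k f \<longleftrightarrow> f \<in> Arr \<C> \<and> k \<in> Hom \<C> (Dom \<C> k) (Dom \<C> f) \<and>
     f \<cdot>\<^bsub>\<C>\<^esub> k = zero_arr \<C> (Dom \<C> k) (Cod \<C> f) \<and>
     (\<forall>t. \<forall>h \<in> Hom \<C> t (Dom \<C> f). f \<cdot>\<^bsub>\<C>\<^esub> h = zero_arr \<C> t (Cod \<C> f) \<longrightarrow>
        (\<exists>!u. u \<in> Hom \<C> t (Dom \<C> k) \<and> k \<cdot>\<^bsub>\<C>\<^esub> u = h))"

definition is_cokernel :: "('o, 'm, 'e) preadditive_category_scheme \<Rightarrow> 'm \<Rightarrow> 'm \<Rightarrow> bool" where
  \<comment> \<open>q is a cokernel of f\<close>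
  "is_cokernel \<C> q f \<longleftrightarrow> f \<in> Arr \<C> \<and> q \<in> Hom \<C> (Cod \<C> f) (Cod \<C> q) \<and>
     q \<cdot>\<^bsub>\<C>\<^esub> f = zero_arr \<C> (Dom \<C> f) (Cod \<C> q) \<and>
     (\<forall>t. \<forall>h \<in> Hom \<C> (Cod \<C> f) t. h \<cdot>\<^bsub>\<C>\<^esub> f = zero_arr \<C> (Dom \<C> f) t \<longrightarrow>
        (\<exists>!u. u \<in> Hom \<C> (Cod \<C> q) t \<and> u \<cdot>\<^bsub>\<C>\<^esub> q = h))"

locale abelian_category = preadditive_category \<C>
  for \<C> :: "('o, 'm, 'e) preadditive_category_scheme" (structure) +
  assumes has_zero_object: "\<exists>z. is_zero_object \<C> z"
    and has_biproducts: "a \<in> Ob \<C> \<Longrightarrow> a' \<in> Ob \<C> \<Longrightarrow> \<exists>b. is_biproduct \<C> a a' b"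
    and has_kernels: "f \<in> Arr \<C> \<Longrightarrow> \<exists>k. is_kernel \<C> k f"
    and has_cokernels: "f \<in> Arr \<C> \<Longrightarrow> \<exists>q. is_cokernel \<C> q f"
    and mono_is_kernel: "is_mono \<C> f \<Longrightarrow> \<exists>g. is_kernel \<C> f g"
    and epi_is_cokernel: "is_epi \<C> f \<Longrightarrow> \<exists>g. is_cokernel \<C> f g"

section \<open>Exact sequences and Ext\<close>

text \<open>The image of an arrow is the kernel of its cokernel.\<close>

definition is_image :: "('o, 'm, 'e) preadditive_category_scheme \<Rightarrow> 'm \<Rightarrow> 'm \<Rightarrow> bool" where
  "is_image \<C> m f \<longleftrightarrow> (\<exists>q. is_cokernel \<C> q f \<and> is_kernel \<C> m q)"

definition exact_pair :: "('o, 'm, 'e) preadditive_category_scheme \<Rightarrow> 'm \<Rightarrow> 'm \<Rightarrow> bool" where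
  "exact_pair \<C> f g \<longleftrightarrow> (\<exists>m. is_image \<C> m f \<and> is_kernel \<C> m g)"

definition short_exact :: "('o, 'm, 'e) preadditive_category_scheme \<Rightarrow> 'm \<Rightarrow> 'm \<Rightarrow> bool" where
  "short_exact \<C> f g \<longleftrightarrow> is_mono \<C> f \<and> exact_pair \<C> f g \<and> is_epi \<C> g"

text \<open>
  An abelian category need not have enough projectives or injectives, so Ext is Yoneda's: an
  i-extension of c by a is an exact sequence with i middle terms from a to c, given here by the
  list of its i + 1 arrows. A morphism of extensions is a list of i + 2 vertical arrows which is
  the identity on a and on c.
\<close>

definition yoneda_extension ::
  "('o, 'm, 'e) preadditive_category_scheme \<Rightarrow> nat \<Rightarrow> 'o \<Rightarrow> 'o \<Rightarrow> 'm list \<Rightarrow> bool" where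
  "yoneda_extension \<C> i c a fs \<longleftrightarrow> length fs = i + 1 \<and>
     Dom \<C> (fs ! 0) = a \<and> Cod \<C> (fs ! i) = c \<and>
     is_mono \<C> (fs ! 0) \<and> is_epi \<C> (fs ! i) \<and>
     (\<forall>j < i. exact_pair \<C> (fs ! j) (fs ! (j + 1)))"

definition yoneda_morphism ::
  "('o, 'm, 'e) preadditive_category_scheme \<Rightarrow> nat \<Rightarrow> 'o \<Rightarrow> 'o \<Rightarrow> 'm list \<Rightarrow> 'm list \<Rightarrow> bool" where
  "yoneda_morphism \<C> i c a fs fs' \<longleftrightarrow>
     yoneda_extension \<C> i c a fs \<and> yoneda_extension \<C> i c a fs' \<and>
     (\<exists>vs. length vs = i + 2 \<and> vs ! 0 = idm \<C> a \<and> vs ! (i + 1) = idm \<C> c \<and>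
        (\<forall>j \<le> i. vs ! j \<in> Hom \<C> (Dom \<C> (fs ! j)) (Dom \<C> (fs' ! j)) \<and>
                 vs ! (j + 1) \<cdot>\<^bsub>\<C>\<^esub> fs ! j = fs' ! j \<cdot>\<^bsub>\<C>\<^esub> vs ! j))"

definition Ext :: "('o, 'm, 'e) preadditive_category_scheme \<Rightarrow> nat \<Rightarrow> 'o \<Rightarrow> 'o \<Rightarrow> 'm list set set" where
  \<comment> \<open>the underlying set of the i-th Yoneda Ext group, for i at least 1\<close>
  "Ext \<C> i c a =
     {fs. yoneda_extension \<C> i c a fs} // {(fs, fs'). equivclp (yoneda_morphism \<C> i c a) fs fs'}"

text \<open>A group vanishes iff its underlying set has exactly one element, so the Baer sum
  is not needed to express vanishing.\<close>

definition Ext_vanishes :: "('o, 'm, 'e) preadditive_category_scheme \<Rightarrow> nat \<Rightarrow> 'o \<Rightarrow> 'o \<Rightarrow> bool" where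
  "Ext_vanishes \<C> i c a \<longleftrightarrow> is_singleton (Ext \<C> i c a)"

section \<open>Cluster tilting subcategories\<close>

text \<open>A full subcategory is given by its set of objects.\<close>

definition contravariantly_finite :: "('o, 'm, 'e) category_scheme \<Rightarrow> 'o set \<Rightarrow> bool" where
  "contravariantly_finite \<C> \<X> \<longleftrightarrow>
     (\<forall>c \<in> Ob \<C>. \<exists>x \<in> \<X>. \<exists>f \<in> Hom \<C> x c.
        \<forall>x' \<in> \<X>. \<forall>g \<in> Hom \<C> x' c. \<exists>h \<in> Hom \<C> x' x. f \<cdot>\<^bsub>\<C>\<^esub> h = g)"

definition covariantly_finite :: "('o, 'm, 'e) category_scheme \<Rightarrow> 'o set \<Rightarrow> bool" where
  "covariantly_finite \<C> \<X> \<longleftrightarrow>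
     (\<forall>c \<in> Ob \<C>. \<exists>x \<in> \<X>. \<exists>f \<in> Hom \<C> c x.
        \<forall>x' \<in> \<X>. \<forall>g \<in> Hom \<C> c x'. \<exists>h \<in> Hom \<C> x x'. h \<cdot>\<^bsub>\<C>\<^esub> f = g)"

definition functorially_finite :: "('o, 'm, 'e) category_scheme \<Rightarrow> 'o set \<Rightarrow> bool" where
  "functorially_finite \<C> \<X> \<longleftrightarrow> contravariantly_finite \<C> \<X> \<and> covariantly_finite \<C> \<X>"

definition generating :: "('o, 'm, 'e) category_scheme \<Rightarrow> 'o set \<Rightarrow> bool" where
  "generating \<C> \<X> \<longleftrightarrow> (\<forall>c \<in> Ob \<C>. \<exists>x \<in> \<X>. \<exists>f \<in> Hom \<C> x c. is_epi \<C> f)"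

definition cogenerating :: "('o, 'm, 'e) category_scheme \<Rightarrow> 'o set \<Rightarrow> bool" where
  "cogenerating \<C> \<X> \<longleftrightarrow> (\<forall>c \<in> Ob \<C>. \<exists>x \<in> \<X>. \<exists>f \<in> Hom \<C> c x. is_mono \<C> f)"

definition n_cluster_tilting ::
  "('o, 'm, 'e) preadditive_category_scheme \<Rightarrow> nat \<Rightarrow> 'o set \<Rightarrow> bool" where
  "n_cluster_tilting \<C> n \<X> \<longleftrightarrow> \<X> \<subseteq> Ob \<C> \<and>
     functorially_finite \<C> \<X> \<and> generating \<C> \<X> \<and> cogenerating \<C> \<X> \<and>
     \<X> = {c \<in> Ob \<C>. \<forall>x \<in> \<X>. \<forall>i. 1 \<le> i \<and> i \<le> n - 1 \<longrightarrow> Ext_vanishes \<C> i x c} \<and>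
     \<X> = {c \<in> Ob \<C>. \<forall>x \<in> \<X>. \<forall>i. 1 \<le> i \<and> i \<le> n - 1 \<longrightarrow> Ext_vanishes \<C> i c x}"

section \<open>The relative structure\<close>

text \<open>
  For a short exact sequence f, g representing an extension class and an arrow x into the codomain
  of g, the pullback of the class along x is represented by f', p: here p is the
  base change of g along x, and f' is the arrow into the pullback induced by f and zero.
\<close>

definition pullback_extension ::
  "('o, 'm, 'e) preadditive_category_scheme \<Rightarrow> 'm \<Rightarrow> 'm \<Rightarrow> 'm \<Rightarrow> 'm \<Rightarrow> 'm \<Rightarrow> bool" where
  "pullback_extension \<C> f g x f' p \<longleftrightarrow>
     (\<exists>q. is_pullback \<C> p q x g \<and> f' \<in> Hom \<C> (Dom \<C> f) (Dom \<C> p) \<and>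
          q \<cdot>\<^bsub>\<C>\<^esub> f' = f \<and> p \<cdot>\<^bsub>\<C>\<^esub> f' = zero_arr \<C> (Dom \<C> f) (Dom \<C> x))"

definition split_short_exact :: "('o, 'm, 'e) preadditive_category_scheme \<Rightarrow> 'm \<Rightarrow> 'm \<Rightarrow> bool" where
  "split_short_exact \<C> f g \<longleftrightarrow> short_exact \<C> f g \<and>
     (\<exists>s \<in> Hom \<C> (Cod \<C> g) (Dom \<C> g). g \<cdot>\<^bsub>\<C>\<^esub> s = idm \<C> (Cod \<C> g))"

definition rel_conflation ::
  "('o, 'm, 'e) preadditive_category_scheme \<Rightarrow> 'o set \<Rightarrow> 'm \<Rightarrow> 'm \<Rightarrow> bool" where
  "rel_conflation \<C> \<X> f g \<longleftrightarrow> short_exact \<C> f g \<and>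
     (\<forall>x \<in> Arr \<C>. Dom \<C> x \<in> \<X> \<and> Cod \<C> x = Cod \<C> g \<longrightarrow>
        (\<exists>f' p. pullback_extension \<C> f g x f' p \<and> split_short_exact \<C> f' p))"

text \<open>
  Resolutions of length m of c, with terms X 0, ..., X m, augmentation d 0 and differentials
  d i from X i to X (i - 1) for i at least 1. The splicing conflations are f i, g i with syzygies
  K i; the last syzygy is X m itself and g m is its identity. Values of X and d
  beyond m are irrelevant.
\<close>

definition rel_resolution ::
  "('o, 'm, 'e) preadditive_category_scheme \<Rightarrow> 'o set \<Rightarrow> nat \<Rightarrow> 'o \<Rightarrow> (nat \<Rightarrow> 'o) \<Rightarrow> (nat \<Rightarrow> 'm) \<Rightarrow> bool"
where
  "rel_resolution \<C> \<X> m c X d \<longleftrightarrow> (\<forall>i \<le> m. X i \<in> \<X>) \<and>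
     (\<exists>K f g. K 0 = c \<and> K m = X m \<and> g m = idm \<C> (X m) \<and>
        (\<forall>i < m. f i \<in> Hom \<C> (K (i + 1)) (X i) \<and> g i \<in> Hom \<C> (X i) (K i) \<and>
                 rel_conflation \<C> \<X> (f i) (g i)) \<and>
        d 0 = g 0 \<and> (\<forall>i < m. d (i + 1) = f i \<cdot>\<^bsub>\<C>\<^esub> g (i + 1)))"

section \<open>Grothendieck groups\<close>

text \<open>
  The abelian group with generators S and relators R. Its law is written multiplicatively, as
  always for groups in HOL-Algebra; the free abelian group underneath has formal integer
  combinations of S as elements.
\<close>

definition presented_ab_group :: "'a set \<Rightarrow> ('a \<Rightarrow>\<^sub>0 int) set \<Rightarrow> ('a \<Rightarrow>\<^sub>0 int) set monoid" where
  "presented_ab_group S R = free_Abelian_group S Mod generate (free_Abelian_group S) R"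

definition presented_class :: "'a set \<Rightarrow> ('a \<Rightarrow>\<^sub>0 int) set \<Rightarrow> 'a \<Rightarrow> ('a \<Rightarrow>\<^sub>0 int) set" where
  "presented_class S R s = generate (free_Abelian_group S) R #>\<^bsub>free_Abelian_group S\<^esub> frag_of s"

definition iso_rel :: "('o, 'm, 'e) category_scheme \<Rightarrow> 'o set \<Rightarrow> ('o \<times> 'o) set" where
  "iso_rel \<C> S = {(a, b). a \<in> S \<and> b \<in> S \<and> isomorphic \<C> a b}"

definition iso_class :: "('o, 'm, 'e) category_scheme \<Rightarrow> 'o set \<Rightarrow> 'o \<Rightarrow> 'o set" where
  "iso_class \<C> S a = iso_rel \<C> S `` {a}"

definition K0_rel_relators ::
  "('o, 'm, 'e) preadditive_category_scheme \<Rightarrow> 'o set \<Rightarrow> ('o set \<Rightarrow>\<^sub>0 int) set" where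
  "K0_rel_relators \<C> \<X> =
     {frag_of (iso_class \<C> (Ob \<C>) (Dom \<C> f)) - frag_of (iso_class \<C> (Ob \<C>) (Cod \<C> f))
        + frag_of (iso_class \<C> (Ob \<C>) (Cod \<C> g)) | f g. rel_conflation \<C> \<X> f g}"

definition K0_rel ::
  "('o, 'm, 'e) preadditive_category_scheme \<Rightarrow> 'o set \<Rightarrow> ('o set \<Rightarrow>\<^sub>0 int) set monoid" where
  "K0_rel \<C> \<X> = presented_ab_group (Ob \<C> // iso_rel \<C> (Ob \<C>)) (K0_rel_relators \<C> \<X>)"

definition K0_rel_class ::
  "('o, 'm, 'e) preadditive_category_scheme \<Rightarrow> 'o set \<Rightarrow> 'o \<Rightarrow> ('o set \<Rightarrow>\<^sub>0 int) set" where
  "K0_rel_class \<C> \<X> c =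
     presented_class (Ob \<C> // iso_rel \<C> (Ob \<C>)) (K0_rel_relators \<C> \<X>) (iso_class \<C> (Ob \<C>) c)"

definition K0_split_relators ::
  "('o, 'm, 'e) preadditive_category_scheme \<Rightarrow> 'o set \<Rightarrow> ('o set \<Rightarrow>\<^sub>0 int) set" where
  "K0_split_relators \<C> \<X> =
     {frag_of (iso_class \<C> \<X> b) - (frag_of (iso_class \<C> \<X> x) + frag_of (iso_class \<C> \<X> x'))
        | x x' b. x \<in> \<X> \<and> x' \<in> \<X> \<and> b \<in> \<X> \<and> is_biproduct \<C> x x' b}"

definition K0_split ::
  "('o, 'm, 'e) preadditive_category_scheme \<Rightarrow> 'o set \<Rightarrow> ('o set \<Rightarrow>\<^sub>0 int) set monoid" where
  "K0_split \<C> \<X> = presented_ab_group (\<X> // iso_rel \<C> \<X>) (K0_split_relators \<C> \<X>)"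

definition K0_split_class ::
  "('o, 'm, 'e) preadditive_category_scheme \<Rightarrow> 'o set \<Rightarrow> 'o \<Rightarrow> ('o set \<Rightarrow>\<^sub>0 int) set" where
  "K0_split_class \<C> \<X> x =
     presented_class (\<X> // iso_rel \<C> \<X>) (K0_split_relators \<C> \<X>) (iso_class \<C> \<X> x)"

lemma comm_group_presented_ab_group:
  assumes "R \<subseteq> carrier (free_Abelian_group S)"
  shows "comm_group (presented_ab_group S R)"
proof -
  interpret F: comm_group "free_Abelian_group S"
    by (rule abelian_free_Abelian_group)
  show ?thesis
    unfolding presented_ab_group_def
    by (rule F.abelian_FactGroup) (rule F.generate_is_subgroup[OF assms])
qed

lemma (in category) iso_class_in_quotient:
  "a \<in> S \<Longrightarrow> iso_class \<C> S a \<in> S // iso_rel \<C> S"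
  by (simp add: iso_class_def quotientI)

lemma (in preadditive_category) comm_group_K0_split: "comm_group (K0_split \<C> \<X>)"
  unfolding K0_split_def
proof (rule comm_group_presented_ab_group, rule subsetI)
  fix r assume "r \<in> K0_split_relators \<C> \<X>"
  then obtain x x' b where "x \<in> \<X>" "x' \<in> \<X>" "b \<in> \<X>"
    and "r = frag_of (iso_class \<C> \<X> b) - (frag_of (iso_class \<C> \<X> x) + frag_of (iso_class \<C> \<X> x'))"
    unfolding K0_split_relators_def by blast
  then show "r \<in> carrier (free_Abelian_group (\<X> // iso_rel \<C> \<X>))"
    using keys_diff keys_add iso_class_in_quotient
    by (fastforce dest!: subsetD[OF keys_diff] subsetD[OF keys_add])
qed

lemma (in preadditive_category) comm_group_K0_rel: "comm_group (K0_rel \<C> \<X>)"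
  unfolding K0_rel_def
proof (rule comm_group_presented_ab_group, rule subsetI)
  fix r assume "r \<in> K0_rel_relators \<C> \<X>"
  then obtain f g where fg: "rel_conflation \<C> \<X> f g"
    and r: "r = frag_of (iso_class \<C> (Ob \<C>) (Dom \<C> f)) - frag_of (iso_class \<C> (Ob \<C>) (Cod \<C> f))
        + frag_of (iso_class \<C> (Ob \<C>) (Cod \<C> g))"
    unfolding K0_rel_relators_def by blast
  from fg have "f \<in> Arr \<C>" "g \<in> Arr \<C>"
    by (auto simp: rel_conflation_def short_exact_def is_mono_def is_epi_def)
  with r show "r \<in> carrier (free_Abelian_group (Ob \<C> // iso_rel \<C> (Ob \<C>)))"
    using Dom_in_Ob Cod_in_Ob iso_class_in_quotient
    by (fastforce dest!: subsetD[OF keys_diff] subsetD[OF keys_add])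
qed

end

theory Submission
  imports Defs
begin

text \<open>
  In the relative structure the objects of \<open>\<X>\<close> are projective, and there are enough of them: an
  approximation by \<open>\<X>\<close> is epi because \<open>\<X>\<close> is generating. The theorem is therefore a resolution
  theorem, and the isomorphism is the Euler characteristic of a resolution. Two things have to be
  shown: resolutions of length \<open>n - 1\<close> exist, and the Euler characteristic is additive on
  conflations.

  Passing from an object to the kernel of its approximation makes one more of the
  groups \<open>Ext\<^sup>i(\<X>, -)\<close> vanish (\<open>syzygy_orthogonal\<close>), by the exactness of
  \<open>Ext\<^sup>i(x, C) \<rightarrow> Ext\<^sup>i\<^sup>+\<^sup>1(x, K) \<rightarrow> Ext\<^sup>i\<^sup>+\<^sup>1(x, X)\<close> for \<open>K \<rightarrow> X \<rightarrow> C\<close>. After \<open>n - 1\<close> steps the kernel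
  lies in \<open>\<X>\<close>. Since Ext consists of Yoneda classes, that is, of exact sequences up to zigzags of
  morphisms, exactness is a statement about such zigzags. An extension of \<open>c\<close> is cut into short
  exact sequences, and an arrow \<open>t\<close> into \<open>c\<close> is said to kill it if the extension pulled back along
  \<open>t\<close> is trivial; this is expressed by a recursion over the short exact sequences, which
  involves only lifts along epis. Being killed is
  invariant along morphisms of extensions in both directions (\<open>mor_kill\<close>, \<open>kill_mor\<close>), so an Ext set
  is a singleton iff all its extensions are killed by the identity (\<open>Ext_vanishes_iff\<close>). In these
  terms exactness is a direct construction (\<open>obstruction_Base\<close>, \<open>obstruction_Splice\<close>), and so is
  the closure of \<open>\<X>\<close> under direct sums (\<open>kill_biproduct\<close>).

  For additivity, a conflation \<open>A \<rightarrow> B \<rightarrow> C\<close> and a conflation \<open>K \<rightarrow> X \<rightarrow> C\<close> with \<open>X\<close> in \<open>\<X>\<close> give a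
  conflation \<open>K \<rightarrow> A \<oplus> X \<rightarrow> B\<close> (\<open>conf_rotate\<close>). Three such rotations turn \<open>A \<rightarrow> B \<rightarrow> C\<close> into a
  conflation between the syzygies of the three objects, up to summands in \<open>\<X>\<close>, so additivity follows
  by induction on the length (\<open>euler_additive\<close>); in length zero all three objects lie in
  \<open>\<X>\<close> and the conflation splits. Applied to \<open>0 \<rightarrow> c \<rightarrow> c'\<close> with an isomorphism \<open>c \<rightarrow> c'\<close>, additivity
  also shows that the Euler characteristic depends neither on the resolution nor on the choice of
  \<open>c\<close> in its isomorphism class. The two homomorphisms of the theorem are then inverse to each
  other on generators.
\<close>

section \<open>Calculus of arrows\<close>

context category begin

abbreviation src where "src \<equiv> Dom \<C>"
abbreviation tgt where "tgt \<equiv> Cod \<C>"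
abbreviation ide where "ide \<equiv> idm \<C>"
abbreviation arr where "arr f \<equiv> f \<in> Arr \<C>"
abbreviation epi where "epi \<equiv> is_epi \<C>"

lemma Hom_iff: "f \<in> Hom \<C> a b \<longleftrightarrow> arr f \<and> src f = a \<and> tgt f = b"
  by (auto simp: Hom_def)

lemma comp_arr [simp]:
  assumes "arr f" "arr g" "src g = tgt f"
  shows "arr (g \<cdot> f)" "src (g \<cdot> f) = src f" "tgt (g \<cdot> f) = tgt g"
  using comp_in_Hom[of f "src f" "tgt f" g "tgt g"] assms by (auto simp: Hom_iff)

lemma comp_assoc' [simp]:
  assumes "arr f" "arr g" "arr h" "src g = tgt f" "src h = tgt g"
  shows "(h \<cdot> g) \<cdot> f = h \<cdot> (g \<cdot> f)"
  using comp_assoc[of f "src f" "tgt f" g "tgt g" h "tgt h"] assms by (auto simp: Hom_iff)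

lemma idm_arr [simp]:
  assumes "a \<in> Ob \<C>"
  shows "arr (ide a)" "src (ide a) = a" "tgt (ide a) = a"
  using idm_in_Hom[OF assms] by (auto simp: Hom_iff)

lemma comp_idm' [simp]: "arr f \<Longrightarrow> src f = a \<Longrightarrow> f \<cdot> ide a = f"
  using comp_idm[of f a "tgt f"] by (auto simp: Hom_iff)

lemma idm_comp' [simp]: "arr f \<Longrightarrow> tgt f = b \<Longrightarrow> ide b \<cdot> f = f"
  using idm_comp[of f "src f" b] by (auto simp: Hom_iff)

declare Dom_in_Ob [simp] Cod_in_Ob [simp]

text \<open>
  Simplification associates composites to the right, so that an equation between composites has
  to be used in front of a further factor.
\<close>

lemma comp_cancel:
  assumes "p \<cdot> i = z" "arr i" "arr p" "src p = tgt i" "arr k" "src i = tgt k"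
  shows "p \<cdot> (i \<cdot> k) = z \<cdot> k"
  using assms comp_assoc'[of k i p] by metis

lemma epi_arr: "epi f \<Longrightarrow> f \<in> Arr \<C>" by (simp add: is_epi_def)
lemma mono_arr: "is_mono \<C> f \<Longrightarrow> f \<in> Arr \<C>" by (simp add: is_mono_def)

lemma epi_cancel:
  assumes "epi f" "arr g" "arr h" "src g = tgt f" "src h = tgt f"
    and "g \<cdot> f = h \<cdot> f"
  shows "g = h"
proof -
  have f: "arr f" using assms epi_arr by blast
  have "tgt g = tgt h" using assms f comp_arr(3) by metis
  then show ?thesis using assms unfolding is_epi_def Ball_def Hom_iff by blast
qed

lemma mono_cancel:
  assumes "is_mono \<C> f" "arr g" "arr h" "tgt g = src f" "tgt h = src f"
    and "f \<cdot> g = f \<cdot> h"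
  shows "g = h"
proof -
  have f: "arr f" using assms mono_arr by blast
  have "src g = src h" using assms f comp_arr(2) by metis
  then show ?thesis using assms unfolding is_mono_def Ball_def Hom_iff by blast
qed

lemma epi_comp:
  assumes "epi f" "epi g" "src g = tgt f"
  shows "epi (g \<cdot> f)"
proof -
  have fg: "arr f" "arr g" using assms epi_arr by auto
  show ?thesis unfolding is_epi_def
  proof (intro conjI allI ballI impI)
    show "arr (g \<cdot> f)" using fg assms by simp
    fix b s t assume s: "s \<in> Hom \<C> (tgt (g \<cdot> f)) b" and t: "t \<in> Hom \<C> (tgt (g \<cdot> f)) b"
      and eq: "s \<cdot> (g \<cdot> f) = t \<cdot> (g \<cdot> f)"
    have st: "arr s" "arr t" "src s = tgt g" "src t = tgt g"
      using s t fg assms by (auto simp: Hom_iff)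
    have "(s \<cdot> g) \<cdot> f = (t \<cdot> g) \<cdot> f" using eq st fg assms by simp
    then have "s \<cdot> g = t \<cdot> g" using epi_cancel[OF assms(1), of "s \<cdot> g" "t \<cdot> g"] st fg assms by simp
    then show "s = t" using epi_cancel[OF assms(2)] st by blast
  qed
qed

lemma idm_epi: "a \<in> Ob \<C> \<Longrightarrow> epi (ide a)"
  unfolding is_epi_def Ball_def Hom_iff by auto

lemma split_epi:
  assumes "arr g" "arr s" "tgt s = src g" "g \<cdot> s = ide (tgt g)"
  shows "epi g"
  unfolding is_epi_def Ball_def Hom_iff
proof (intro conjI allI ballI impI)
  show "arr g" by fact
  fix b u v assume u: "arr u \<and> src u = tgt g \<and> tgt u = b"
    and v: "arr v \<and> src v = tgt g \<and> tgt v = b" and eq: "u \<cdot> g = v \<cdot> g"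
  have "(u \<cdot> g) \<cdot> s = (v \<cdot> g) \<cdot> s" using eq by simp
  then show "u = v" using u v assms by simp
qed

end

context preadditive_category begin

abbreviation zero where "zero \<equiv> zero_arr \<C>"

definition neg :: "'m \<Rightarrow> 'm" where
  "neg f = inv\<^bsub>hom_group \<C> (src f) (tgt f)\<^esub> f"

lemma hom_group_simps:
  "carrier (hom_group \<C> a b) = Hom \<C> a b"
  "monoid.mult (hom_group \<C> a b) = add_arr \<C>"
  "monoid.one (hom_group \<C> a b) = zero a b"
  by (simp_all add: hom_group_def)

lemma zero_arr_arr [simp]:
  assumes "a \<in> Ob \<C>" "b \<in> Ob \<C>"
  shows "arr (zero a b)" "src (zero a b) = a" "tgt (zero a b) = b"
proof -
  interpret G: comm_group "hom_group \<C> a b" using hom_comm_group assms by blast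
  show "arr (zero a b)" "src (zero a b) = a" "tgt (zero a b) = b"
    using G.one_closed by (auto simp: hom_group_simps Hom_iff)
qed

lemma add_arr_arr [simp]:
  assumes "arr f" "arr g" "src g = src f" "tgt g = tgt f"
  shows "arr (f \<boxplus> g)" "src (f \<boxplus> g) = src f" "tgt (f \<boxplus> g) = tgt f"
proof -
  interpret G: comm_group "hom_group \<C> (src f) (tgt f)" using hom_comm_group assms by simp
  show "arr (f \<boxplus> g)" "src (f \<boxplus> g) = src f" "tgt (f \<boxplus> g) = tgt f"
    using G.m_closed[of f g] assms by (auto simp: hom_group_simps Hom_iff)
qed

lemma neg_arr [simp]:
  assumes "arr f"
  shows "arr (neg f)" "src (neg f) = src f" "tgt (neg f) = tgt f"
proof -
  interpret G: comm_group "hom_group \<C> (src f) (tgt f)" using hom_comm_group assms by simp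
  show "arr (neg f)" "src (neg f) = src f" "tgt (neg f) = tgt f"
    using G.inv_closed[of f] assms by (auto simp: hom_group_simps Hom_iff neg_def)
qed

lemma add_neg [simp]:
  assumes "arr f"
  shows "f \<boxplus> neg f = zero (src f) (tgt f)" "neg f \<boxplus> f = zero (src f) (tgt f)"
proof -
  interpret G: comm_group "hom_group \<C> (src f) (tgt f)" using hom_comm_group assms by simp
  show "f \<boxplus> neg f = zero (src f) (tgt f)" "neg f \<boxplus> f = zero (src f) (tgt f)"
    using G.r_inv[of f] G.l_inv[of f] assms by (auto simp: hom_group_simps Hom_iff neg_def)
qed

lemma add_assoc:
  assumes "arr f" "arr g" "arr h" "src g = src f" "tgt g = tgt f"
    "src h = src f" "tgt h = tgt f"
  shows "(f \<boxplus> g) \<boxplus> h = f \<boxplus> (g \<boxplus> h)"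
proof -
  interpret G: comm_group "hom_group \<C> (src f) (tgt f)" using hom_comm_group assms by simp
  show ?thesis using G.m_assoc[of f g h] assms by (auto simp: hom_group_simps Hom_iff)
qed

lemma add_commute:
  assumes "arr f" "arr g" "src g = src f" "tgt g = tgt f"
  shows "f \<boxplus> g = g \<boxplus> f"
proof -
  interpret G: comm_group "hom_group \<C> (src f) (tgt f)" using hom_comm_group assms by simp
  show ?thesis using G.m_comm[of f g] assms by (auto simp: hom_group_simps Hom_iff)
qed

lemma add_zero [simp]:
  assumes "arr f" "src f = a" "tgt f = b"
  shows "f \<boxplus> zero a b = f" "zero a b \<boxplus> f = f"
proof -
  interpret G: comm_group "hom_group \<C> a b" using hom_comm_group assms by auto
  show "f \<boxplus> zero a b = f" "zero a b \<boxplus> f = f"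
    using G.r_one[of f] G.l_one[of f] assms by (auto simp: hom_group_simps Hom_iff)
qed

lemma add_cancel:
  assumes "arr f" "arr g" "arr h" "src g = src f" "tgt g = tgt f"
    "src h = src f" "tgt h = tgt f"
  shows "f \<boxplus> h = g \<boxplus> h \<longleftrightarrow> f = g"
proof -
  interpret G: comm_group "hom_group \<C> (src f) (tgt f)" using hom_comm_group assms by simp
  show ?thesis using G.right_cancel[of h f g] assms by (auto simp: hom_group_simps Hom_iff)
qed

lemma diff_eq_zero_iff:
  assumes "arr f" "arr g" "src g = src f" "tgt g = tgt f"
  shows "f \<boxplus> neg g = zero (src f) (tgt f) \<longleftrightarrow> f = g"
  using add_cancel[of f g "neg g"] add_neg(1)[of g] assms by simp

lemma add_diff_cancel [simp]:
  assumes "arr f" "arr g" "src g = src f" "tgt g = tgt f"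
  shows "g \<boxplus> (f \<boxplus> neg g) = f"
proof -
  have "f \<boxplus> neg g = neg g \<boxplus> f" by (rule add_commute) (simp_all add: assms)
  moreover have "(g \<boxplus> neg g) \<boxplus> f = g \<boxplus> (neg g \<boxplus> f)" by (rule add_assoc) (simp_all add: assms)
  ultimately show ?thesis using assms by simp
qed

lemma comp_add' [simp]:
  assumes "arr f" "arr g" "arr h" "src g = src f" "tgt g = tgt f" "src h = tgt f"
  shows "h \<cdot> (f \<boxplus> g) = h \<cdot> f \<boxplus> h \<cdot> g"
  using comp_add[of f "src f" "tgt f" g h "tgt h"] assms by (auto simp: Hom_iff)

lemma add_comp' [simp]:
  assumes "arr f" "arr g" "arr h" "src g = src f" "tgt g = tgt f" "tgt h = src f"
  shows "(f \<boxplus> g) \<cdot> h = f \<cdot> h \<boxplus> g \<cdot> h"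
  using add_comp[of h "src h" "src f" f "tgt f" g] assms by (auto simp: Hom_iff)

lemma add_idem_zero:
  assumes "arr f" "f \<boxplus> f = f"
  shows "f = zero (src f) (tgt f)"
  using add_cancel[of f "zero (src f) (tgt f)" f] assms by simp

lemma comp_zero [simp]:
  assumes "arr f" "src f = b" "a \<in> Ob \<C>"
  shows "f \<cdot> zero a b = zero a (tgt f)"
proof -
  have b: "b \<in> Ob \<C>" using assms by auto
  have "f \<cdot> zero a b \<boxplus> f \<cdot> zero a b = f \<cdot> (zero a b \<boxplus> zero a b)"
    using assms b by (subst comp_add') auto
  also have "\<dots> = f \<cdot> zero a b" using assms b by simp
  finally show ?thesis using add_idem_zero[of "f \<cdot> zero a b"] assms b by simp
qed

lemma zero_comp [simp]:
  assumes "arr f" "tgt f = b" "c \<in> Ob \<C>"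
  shows "zero b c \<cdot> f = zero (src f) c"
proof -
  have b: "b \<in> Ob \<C>" using assms by auto
  have "zero b c \<cdot> f \<boxplus> zero b c \<cdot> f = (zero b c \<boxplus> zero b c) \<cdot> f"
    using assms b by (subst add_comp') auto
  also have "\<dots> = zero b c \<cdot> f" using assms b by simp
  finally show ?thesis using add_idem_zero[of "zero b c \<cdot> f"] assms b by simp
qed

lemma neg_unique:
  assumes "arr f" "arr g" "src g = src f" "tgt g = tgt f"
    "g \<boxplus> f = zero (src f) (tgt f)"
  shows "g = neg f"
proof -
  have "g \<boxplus> f = neg f \<boxplus> f" using assms(1,5) by simp
  moreover have "g \<boxplus> f = neg f \<boxplus> f \<longleftrightarrow> g = neg f"
    by (rule add_cancel) (simp_all add: assms(1-4))
  ultimately show ?thesis by blast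
qed

lemma comp_neg [simp]:
  assumes "arr f" "arr h" "src h = tgt f"
  shows "h \<cdot> neg f = neg (h \<cdot> f)"
proof (rule neg_unique)
  have "h \<cdot> neg f \<boxplus> h \<cdot> f = h \<cdot> (neg f \<boxplus> f)" using assms by (subst comp_add') auto
  then show "h \<cdot> neg f \<boxplus> h \<cdot> f = zero (src (h \<cdot> f)) (tgt (h \<cdot> f))"
    using assms by simp
qed (use assms in simp_all)

lemma neg_comp [simp]:
  assumes "arr f" "arr h" "tgt h = src f"
  shows "neg f \<cdot> h = neg (f \<cdot> h)"
proof (rule neg_unique)
  have "neg f \<cdot> h \<boxplus> f \<cdot> h = (neg f \<boxplus> f) \<cdot> h" using assms by (subst add_comp') auto
  then show "neg f \<cdot> h \<boxplus> f \<cdot> h = zero (src (f \<cdot> h)) (tgt (f \<cdot> h))"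
    using assms by simp
qed (use assms in simp_all)

lemma neg_zero [simp]:
  assumes "a \<in> Ob \<C>" "b \<in> Ob \<C>" shows "neg (zero a b) = zero a b"
  using neg_unique[of "zero a b" "zero a b"] assms by simp

lemma neg_neg [simp]:
  assumes "arr f" shows "neg (neg f) = f"
  using neg_unique[of "neg f" f] assms by simp

text \<open>By additivity, an arrow is mono (epi) as soon as it cancels against zero.\<close>

lemma epiI:
  assumes f: "arr f"
    and z: "\<And>s. arr s \<Longrightarrow> src s = tgt f \<Longrightarrow> s \<cdot> f = zero (src f) (tgt s)
        \<Longrightarrow> s = zero (tgt f) (tgt s)"
  shows "epi f"
  unfolding is_epi_def Ball_def Hom_iff
proof (intro conjI allI ballI impI)
  show "arr f" by fact
  fix b u v assume u: "arr u \<and> src u = tgt f \<and> tgt u = b"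
    and v: "arr v \<and> src v = tgt f \<and> tgt v = b" and eq: "u \<cdot> f = v \<cdot> f"
  have "(u \<boxplus> neg v) \<cdot> f = zero (src f) b" using u v f eq by simp
  then have "u \<boxplus> neg v = zero (tgt f) b" using z[of "u \<boxplus> neg v"] u v by simp
  then show "u = v" using diff_eq_zero_iff[of u v] u v by simp
qed

lemma monoI:
  assumes f: "arr f"
    and z: "\<And>s. arr s \<Longrightarrow> tgt s = src f \<Longrightarrow> f \<cdot> s = zero (src s) (tgt f)
        \<Longrightarrow> s = zero (src s) (src f)"
  shows "is_mono \<C> f"
  unfolding is_mono_def Ball_def Hom_iff
proof (intro conjI allI ballI impI)
  show "arr f" by fact
  fix b u v assume u: "arr u \<and> src u = b \<and> tgt u = src f"
    and v: "arr v \<and> src v = b \<and> tgt v = src f" and eq: "f \<cdot> u = f \<cdot> v"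
  have "f \<cdot> (u \<boxplus> neg v) = zero b (tgt f)" using u v f eq by simp
  then have "u \<boxplus> neg v = zero b (src f)" using z[of "u \<boxplus> neg v"] u v by simp
  then show "u = v" using diff_eq_zero_iff[of u v] u v by simp
qed

lemma epi_zero:
  assumes "epi f" "arr s" "src s = tgt f" "s \<cdot> f = zero (src f) (tgt s)"
  shows "s = zero (tgt f) (tgt s)"
  using epi_cancel[of f s "zero (tgt f) (tgt s)"] assms epi_arr[OF assms(1)] by simp

lemma mono_zero:
  assumes "is_mono \<C> f" "arr s" "tgt s = src f" "f \<cdot> s = zero (src s) (tgt f)"
  shows "s = zero (src s) (src f)"
  using mono_cancel[of f s "zero (src s) (src f)"] assms mono_arr[OF assms(1)] by simp

section \<open>Kernels, cokernels, short exact sequences and biproducts\<close>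

lemma kernel_arr:
  assumes "is_kernel \<C> k f"
  shows "arr f" "arr k" "tgt k = src f" "f \<cdot> k = zero (src k) (tgt f)"
  using assms by (auto simp: is_kernel_def Hom_iff)

lemma kernel_lift:
  assumes "is_kernel \<C> k f" "arr h" "tgt h = src f" "f \<cdot> h = zero (src h) (tgt f)"
  obtains u where "arr u" "src u = src h" "tgt u = src k" "k \<cdot> u = h"
proof -
  have "h \<in> Hom \<C> (src h) (src f)" using assms by (simp add: Hom_iff)
  then have "\<exists>u. u \<in> Hom \<C> (src h) (src k) \<and> k \<cdot> u = h"
    using assms(1,4) unfolding is_kernel_def by blast
  then show thesis using that by (auto simp: Hom_iff)
qed

lemma kernel_mono:
  assumes "is_kernel \<C> k f" shows "is_mono \<C> k"
proof (rule monoI)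
  note K = kernel_arr[OF assms]
  show "arr k" by fact
  fix s assume s: "arr s" "tgt s = src k" "k \<cdot> s = zero (src s) (tgt k)"
  have 1: "k \<cdot> s \<in> Hom \<C> (src s) (src f)" using s K by (simp add: Hom_iff)
  have "f \<cdot> (k \<cdot> s) = zero (src s) (tgt f)" using s K by simp
  then have ex: "\<exists>!u. u \<in> Hom \<C> (src s) (src k) \<and> k \<cdot> u = k \<cdot> s"
    using assms 1 unfolding is_kernel_def by blast
  have "k \<cdot> zero (src s) (src k) = k \<cdot> s" using s K by simp
  moreover have "zero (src s) (src k) \<in> Hom \<C> (src s) (src k)"
    "s \<in> Hom \<C> (src s) (src k)" using s K by (simp_all add: Hom_iff)
  ultimately show "s = zero (src s) (src k)" using ex by blast
qed

lemma kernelI: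
  assumes "is_mono \<C> k" "arr f" "tgt k = src f" "f \<cdot> k = zero (src k) (tgt f)"
    and "\<And>h. arr h \<Longrightarrow> tgt h = src f \<Longrightarrow> f \<cdot> h = zero (src h) (tgt f)
      \<Longrightarrow> \<exists>u. arr u \<and> src u = src h \<and> tgt u = src k \<and> k \<cdot> u = h"
  shows "is_kernel \<C> k f"
  unfolding is_kernel_def
proof (intro conjI allI ballI impI)
  show "k \<in> Hom \<C> (src k) (src f)" using assms mono_arr by (simp add: Hom_iff)
  fix t h assume h: "h \<in> Hom \<C> t (src f)" "f \<cdot> h = zero t (tgt f)"
  then obtain u where u: "u \<in> Hom \<C> t (src k)" "k \<cdot> u = h" using assms(5)[of h] unfolding Hom_iff by auto
  then show "\<exists>!u. u \<in> Hom \<C> t (src k) \<and> k \<cdot> u = h"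
    using mono_cancel[OF assms(1)] unfolding Hom_iff by metis
qed (use assms in auto)

lemma cokernel_arr:
  assumes "is_cokernel \<C> q f"
  shows "arr f" "arr q" "src q = tgt f" "q \<cdot> f = zero (src f) (tgt q)"
  using assms by (auto simp: is_cokernel_def Hom_iff)

lemma cokernel_desc:
  assumes "is_cokernel \<C> q f" "arr h" "src h = tgt f" "h \<cdot> f = zero (src f) (tgt h)"
  obtains u where "arr u" "src u = tgt q" "tgt u = tgt h" "u \<cdot> q = h"
proof -
  have "h \<in> Hom \<C> (tgt f) (tgt h)" using assms by (simp add: Hom_iff)
  then have "\<exists>u. u \<in> Hom \<C> (tgt q) (tgt h) \<and> u \<cdot> q = h"
    using assms(1,4) unfolding is_cokernel_def by blast
  then show thesis using that by (auto simp: Hom_iff)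
qed

lemma cokernel_epi:
  assumes "is_cokernel \<C> q f" shows "epi q"
proof (rule epiI)
  note K = cokernel_arr[OF assms]
  show "arr q" by fact
  fix s assume s: "arr s" "src s = tgt q" "s \<cdot> q = zero (src q) (tgt s)"
  have 1: "s \<cdot> q \<in> Hom \<C> (tgt f) (tgt s)" using s K by (simp add: Hom_iff)
  have "(s \<cdot> q) \<cdot> f = zero (src f) (tgt s)" using s K by simp
  then have ex: "\<exists>!u. u \<in> Hom \<C> (tgt q) (tgt s) \<and> u \<cdot> q = s \<cdot> q"
    using assms 1 unfolding is_cokernel_def by blast
  have "zero (tgt q) (tgt s) \<cdot> q = s \<cdot> q" using s K by simp
  moreover have "zero (tgt q) (tgt s) \<in> Hom \<C> (tgt q) (tgt s)"
    "s \<in> Hom \<C> (tgt q) (tgt s)" using s K by (simp_all add: Hom_iff)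
  ultimately show "s = zero (tgt q) (tgt s)" using ex by blast
qed

text \<open>
  Agrees with short exactness in terms of images (\<open>short_exact_iff\<close>), but provides lifts directly.
\<close>

definition ses :: "'m \<Rightarrow> 'm \<Rightarrow> bool" where
  "ses m e \<longleftrightarrow> is_kernel \<C> m e \<and> epi e"

lemma ses_arr:
  assumes "ses m e"
  shows "arr m" "arr e" "tgt m = src e" "e \<cdot> m = zero (src m) (tgt e)"
    "is_mono \<C> m" "epi e"
  using assms kernel_arr[of m e] kernel_mono[of m e] by (auto simp: ses_def)

lemma ses_lift:
  assumes "ses m e" "arr h" "tgt h = src e" "e \<cdot> h = zero (src h) (tgt e)"
  obtains u where "arr u" "src u = src h" "tgt u = src m" "m \<cdot> u = h"
  using assms kernel_lift[of m e h] unfolding ses_def by blast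

text \<open>
  Exposes the structure arrows, since arrows into and out of direct sums are given by their components.
\<close>

definition biprod :: "'o \<Rightarrow> 'o \<Rightarrow> 'o \<Rightarrow> 'm \<Rightarrow> 'm \<Rightarrow> 'm \<Rightarrow> 'm \<Rightarrow> bool" where
  "biprod a a' b i i' p p' \<longleftrightarrow> a \<in> Ob \<C> \<and> a' \<in> Ob \<C> \<and> b \<in> Ob \<C> \<and>
     i \<in> Hom \<C> a b \<and> i' \<in> Hom \<C> a' b \<and> p \<in> Hom \<C> b a \<and> p' \<in> Hom \<C> b a' \<and>
     p \<cdot> i = ide a \<and> p' \<cdot> i' = ide a' \<and> p \<cdot> i' = zero a' a \<and> p' \<cdot> i = zero a a' \<and>
     i \<cdot> p \<boxplus> i' \<cdot> p' = ide b"

lemma is_biproduct_iff: "is_biproduct \<C> a a' b \<longleftrightarrow> (\<exists>i i' p p'. biprod a a' b i i' p p')"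
  unfolding is_biproduct_def biprod_def by blast

lemma biprod_arr:
  assumes "biprod a a' b i i' p p'"
  shows "a \<in> Ob \<C>" "a' \<in> Ob \<C>" "b \<in> Ob \<C>"
    "arr i" "src i = a" "tgt i = b" "arr i'" "src i' = a'" "tgt i' = b"
    "arr p" "src p = b" "tgt p = a" "arr p'" "src p' = b" "tgt p' = a'"
    "p \<cdot> i = ide a" "p' \<cdot> i' = ide a'" "p \<cdot> i' = zero a' a" "p' \<cdot> i = zero a a'"
    "i \<cdot> p \<boxplus> i' \<cdot> p' = ide b"
  using assms unfolding biprod_def Hom_iff by auto

lemma biprod_reduce:
  assumes "biprod a a' b i i' p p'"
  shows "arr h \<Longrightarrow> tgt h = a \<Longrightarrow> p \<cdot> (i \<cdot> h) = h"
    "arr h \<Longrightarrow> tgt h = a' \<Longrightarrow> p' \<cdot> (i' \<cdot> h) = h"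
    "arr h \<Longrightarrow> tgt h = a' \<Longrightarrow> p \<cdot> (i' \<cdot> h) = zero (src h) a"
    "arr h \<Longrightarrow> tgt h = a \<Longrightarrow> p' \<cdot> (i \<cdot> h) = zero (src h) a'"
    "arr h \<Longrightarrow> tgt h = b \<Longrightarrow> i \<cdot> (p \<cdot> h) \<boxplus> i' \<cdot> (p' \<cdot> h) = h"
proof -
  note B = biprod_arr[OF assms]
  show "arr h \<Longrightarrow> tgt h = a \<Longrightarrow> p \<cdot> (i \<cdot> h) = h"
    using comp_cancel[OF B(16)] B by simp
  show "arr h \<Longrightarrow> tgt h = a' \<Longrightarrow> p' \<cdot> (i' \<cdot> h) = h"
    using comp_cancel[OF B(17)] B by simp
  show "arr h \<Longrightarrow> tgt h = a' \<Longrightarrow> p \<cdot> (i' \<cdot> h) = zero (src h) a"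
    using comp_cancel[OF B(18)] B by simp
  show "arr h \<Longrightarrow> tgt h = a \<Longrightarrow> p' \<cdot> (i \<cdot> h) = zero (src h) a'"
    using comp_cancel[OF B(19)] B by simp
  assume h: "arr h" "tgt h = b"
  have "i \<cdot> (p \<cdot> h) \<boxplus> i' \<cdot> (p' \<cdot> h) = (i \<cdot> p \<boxplus> i' \<cdot> p') \<cdot> h"
    using h B(4-15) by simp
  then show "i \<cdot> (p \<cdot> h) \<boxplus> i' \<cdot> (p' \<cdot> h) = h" using h B(20) by simp
qed

end

section \<open>Exactness in abelian categories\<close>
context abelian_category begin

text \<open>
  A mono is the kernel of some arrow, and that arrow factors through the cokernel of the mono.
\<close>

lemma mono_kernel_of_cokernel:
  assumes "is_mono \<C> j" "is_cokernel \<C> c j"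
  shows "is_kernel \<C> j c"
proof -
  obtain g where g: "is_kernel \<C> j g" using mono_is_kernel assms by blast
  note G = kernel_arr[OF g] and C = cokernel_arr[OF assms(2)]
  obtain w where w: "arr w" "src w = tgt c" "tgt w = tgt g" "w \<cdot> c = g"
    using cokernel_desc[OF assms(2), of g] G by auto
  show ?thesis
  proof (rule kernelI)
    fix h assume h: "arr h" "tgt h = src c" "c \<cdot> h = zero (src h) (tgt c)"
    have "g \<cdot> h = w \<cdot> (c \<cdot> h)" using w h C by (metis comp_assoc')
    then have "g \<cdot> h = zero (src h) (tgt g)" using w h C by simp
    then show "\<exists>u. arr u \<and> src u = src h \<and> tgt u = src j \<and> j \<cdot> u = h"
      using kernel_lift[OF g, of h] h G C by (metis (no_types))
  qed (use assms C in auto)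
qed

text \<open>
  Dually, an epi is the cokernel of some arrow, and that arrow factors through the kernel of the
  epi.
\<close>

lemma ses_desc:
  assumes "ses k e" "arr h" "src h = src e" "h \<cdot> k = zero (src k) (tgt h)"
  obtains u where "arr u" "src u = tgt e" "tgt u = tgt h" "u \<cdot> e = h"
proof -
  note K = ses_arr[OF assms(1)]
  obtain g where g: "is_cokernel \<C> e g" using epi_is_cokernel K by blast
  note G = cokernel_arr[OF g]
  obtain w where w: "arr w" "src w = src g" "tgt w = src k" "k \<cdot> w = g"
    using ses_lift[OF assms(1), of g] G by auto
  have "h \<cdot> g = (h \<cdot> k) \<cdot> w" unfolding w(4)[symmetric] using w(1-3) assms(2,3) K(1-3) by simp
  then have "h \<cdot> g = zero (src g) (tgt h)" unfolding assms(4) using w assms(2,3) K by simp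
  then show thesis using cokernel_desc[OF g, of h] that assms G K by metis
qed

lemma ses_of_epi:
  assumes "epi q" obtains k where "ses k q"
  using has_kernels[OF epi_arr[OF assms]] assms unfolding ses_def by blast

lemma ses_of_mono:
  assumes "is_mono \<C> m" obtains e where "ses m e"
proof -
  obtain e where e: "is_cokernel \<C> e m" using has_cokernels mono_arr[OF assms] by blast
  then show thesis using that mono_kernel_of_cokernel[OF assms e] cokernel_epi[OF e]
    unfolding ses_def by blast
qed

lemma biprod_exists:
  assumes "a \<in> Ob \<C>" "a' \<in> Ob \<C>"
  obtains b i i' p p' where "biprod a a' b i i' p p'"
  using has_biproducts[OF assms] is_biproduct_iff by blast

text \<open>
  Epis are stable under base change: \<open>(q, - u)\<close> is an epi on the direct sum, hence the cokernel of its
  kernel; an arrow which vanishes on \<open>q'\<close> induces one on this cokernel that vanishes on \<open>q\<close>, so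
  it is zero. The lemma is used to lift \<open>u\<close>
  through \<open>q\<close> after composing with an epi, which takes the place of choosing preimages of elements.
\<close>

lemma epi_pullback:
  assumes q: "epi q" and u: "arr u" "tgt u = tgt q"
  obtains q' u' where "epi q'" "tgt q' = src u"
    "arr u'" "src u' = src q'" "tgt u' = src q" "q \<cdot> u' = u \<cdot> q'"
proof -
  have q': "arr q" using q epi_arr by blast
  obtain b i i' p p' where b: "biprod (src q) (src u) b i i' p p'"
    by (rule biprod_exists[of "src q" "src u"]) (use q' u in auto)
  note B = biprod_arr[OF b] and R = biprod_reduce[OF b]
  define d where "d = q \<cdot> p \<boxplus> neg (u \<cdot> p')"
  have d: "arr d" "src d = b" "tgt d = tgt q"
    unfolding d_def using B(1-15) q' u by simp_all
  have di: "d \<cdot> i = q" unfolding d_def using B q' u by simp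
  have "epi d"
  proof (rule epiI)
    fix s assume s: "arr s" "src s = tgt d" "s \<cdot> d = zero (src d) (tgt s)"
    have "s \<cdot> q = zero (src q) (tgt s)"
      unfolding di[symmetric] using comp_cancel[OF s(3), of i] s(1,2) d B(1-6) by simp
    then show "s = zero (tgt d) (tgt s)" using epi_zero[OF q, of s] s d by simp
  qed (rule d)
  then obtain k where k: "ses k d" using ses_of_epi by blast
  note K = ses_arr[OF k]
  have e: "epi (p' \<cdot> k)"
  proof (rule epiI)
    show "arr (p' \<cdot> k)" using B K d by simp
    fix s assume s: "arr s" "src s = tgt (p' \<cdot> k)" 
      "s \<cdot> (p' \<cdot> k) = zero (src (p' \<cdot> k)) (tgt s)"
    have s': "src s = src u" using s B(1-15) K d by simp
    have "(s \<cdot> p') \<cdot> k = zero (src k) (tgt (s \<cdot> p'))"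
      using s s' B(1-15) K d by simp
    then obtain w where w: "arr w" "src w = tgt d" "tgt w = tgt s" "w \<cdot> d = s \<cdot> p'"
      using ses_desc[OF k, of "s \<cdot> p'"] s s' B(1-15) d by auto
    have "w \<cdot> q = zero (src q) (tgt w)"
      unfolding di[symmetric] using comp_cancel[OF w(4), of i] w(1-3) d B s s' by simp
    then have "w = zero (tgt q) (tgt w)" using epi_zero[OF q, of w] w d by simp
    then have "w \<cdot> d = zero b (tgt s)" using w d q' by (metis zero_comp Cod_in_Ob)
    then have "s \<cdot> p' = zero b (tgt s)" using w by simp
    then have "(s \<cdot> p') \<cdot> i' = zero (src u) (tgt s)" using B(1-9) s by simp
    then show "s = zero (tgt (p' \<cdot> k)) (tgt s)" using B s s' K(1-3) d by simp
  qed
  have "d \<cdot> k = q \<cdot> (p \<cdot> k) \<boxplus> neg (u \<cdot> (p' \<cdot> k))"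
    unfolding d_def using B(1-15) q' u K(1-3) d by simp
  then have "q \<cdot> (p \<cdot> k) \<boxplus> neg (u \<cdot> (p' \<cdot> k)) = zero (src k) (tgt q)"
    using K d by simp
  then have "q \<cdot> (p \<cdot> k) = u \<cdot> (p' \<cdot> k)"
    using diff_eq_zero_iff[of "q \<cdot> (p \<cdot> k)" "u \<cdot> (p' \<cdot> k)"] B(1-15) q' u K(1-3) d by simp
  then show thesis using that[of "p' \<cdot> k" "p \<cdot> k"] e B(1-15) K(1-3) d by simp
qed

lemma mono_epi_section:
  assumes "is_mono \<C> f" "epi f"
  obtains t where "arr t" "src t = tgt f" "tgt t = src f" "f \<cdot> t = ide (tgt f)"
proof -
  obtain z where z: "is_kernel \<C> f z" using mono_is_kernel assms by blast
  note Z = kernel_arr[OF z]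
  have "z = zero (src z) (tgt z)" using epi_zero[OF assms(2), of z] Z by simp
  then have "z \<cdot> ide (tgt f) = zero (tgt f) (tgt z)" using Z by simp
  then show thesis using kernel_lift[OF z, of "ide (tgt f)"] that Z by auto
qed

text \<open>
  The first arrow of an exact pair is an epi followed by the kernel of the second one. In the direct
  implication, let \<open>s\<close> vanish on the factor of \<open>f\<close> through its image. Then \<open>f\<close> factors through the kernel of \<open>s\<close>,
  a subobject of the image, which is therefore the whole image; so \<open>s\<close> is zero and the factor is epi.
\<close>

lemma exact_pair_iff:
  "exact_pair \<C> f g \<longleftrightarrow>
    (\<exists>m f'. is_kernel \<C> m g \<and> epi f' \<and> tgt f' = src m \<and> f = m \<cdot> f')"
proof
  assume "exact_pair \<C> f g"
  then obtain m q where m: "is_kernel \<C> m g" and mq: "is_kernel \<C> m q" and q: "is_cokernel \<C> q f"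
    unfolding exact_pair_def is_image_def by blast
  note M = kernel_arr[OF mq] kernel_mono[OF mq] and Q = cokernel_arr[OF q]
  obtain f' where f': "arr f'" "src f' = src f" "tgt f' = src m" "m \<cdot> f' = f"
    using kernel_lift[OF mq, of f] Q by auto
  have "epi f'"
  proof (rule epiI)
    fix s assume s: "arr s" "src s = tgt f'" "s \<cdot> f' = zero (src f') (tgt s)"
    \<comment> \<open>The kernel of \<open>s\<close> is a subobject of the image through which \<open>f\<close> factors.\<close>
    obtain \<kappa> where \<kappa>: "is_kernel \<C> \<kappa> s" using has_kernels s by blast
    note K = kernel_arr[OF \<kappa>] kernel_mono[OF \<kappa>]
    obtain f'' where f'': "arr f''" "src f'' = src f'" "tgt f'' = src \<kappa>" "\<kappa> \<cdot> f'' = f'"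
      using kernel_lift[OF \<kappa>, of f'] s f' by auto
    have mk: "arr (m \<cdot> \<kappa>)" "src (m \<cdot> \<kappa>) = src \<kappa>" "tgt (m \<cdot> \<kappa>) = tgt f"
      using M K s f' Q by simp_all
    have mono: "is_mono \<C> (m \<cdot> \<kappa>)"
    proof (rule monoI)
      fix t assume t: "arr t" "tgt t = src (m \<cdot> \<kappa>)"
        "(m \<cdot> \<kappa>) \<cdot> t = zero (src t) (tgt (m \<cdot> \<kappa>))"
      have "m \<cdot> (\<kappa> \<cdot> t) = zero (src t) (tgt m)"
        using t mk M K s f' by simp
      then have "\<kappa> \<cdot> t = zero (src t) (src m)"
        using mono_zero[OF M(5), of "\<kappa> \<cdot> t"] t mk M K s f' by simp
      then show "t = zero (src t) (src (m \<cdot> \<kappa>))"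
        using mono_zero[OF K(5), of t] t mk K s f' by simp
    qed (rule mk)
    obtain c where c: "ses (m \<cdot> \<kappa>) c" using ses_of_mono[OF mono] by blast
    note C = ses_arr[OF c]
    have "f = (m \<cdot> \<kappa>) \<cdot> f''" using f'' f' s M K by simp
    then have "c \<cdot> f = zero (src f) (tgt c)"
      using C mk f'' f' Q by (metis comp_assoc' zero_comp Cod_in_Ob)
    then obtain w where w: "arr w" "src w = tgt q" "tgt w = tgt c" "w \<cdot> q = c"
      using cokernel_desc[OF q, of c] C mk by auto
    have "c \<cdot> m = w \<cdot> (q \<cdot> m)" using w Q M by (metis comp_assoc')
    then have "c \<cdot> m = zero (src m) (tgt c)" using w Q M by simp
    then obtain t where t: "arr t" "src t = src m" "tgt t = src \<kappa>" "(m \<cdot> \<kappa>) \<cdot> t = m"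
      using ses_lift[OF c, of m] C mk M Q by auto
    have "m \<cdot> (\<kappa> \<cdot> t) = m \<cdot> ide (src m)" using t M K s f' by simp
    then have "\<kappa> \<cdot> t = ide (src m)"
      using mono_cancel[OF M(5), of "\<kappa> \<cdot> t" "ide (src m)"] t M K s f' by simp
    then have "s \<cdot> (\<kappa> \<cdot> t) = s" using s f' by simp
    moreover have "s \<cdot> (\<kappa> \<cdot> t) = zero (tgt f') (tgt s)"
      using comp_cancel[OF K(4), of t] s(1,2) K(1-3) t(1-3) f'(3) by simp
    ultimately show "s = zero (tgt f') (tgt s)" by simp
  qed (rule f')
  then show "\<exists>m f'. is_kernel \<C> m g \<and> epi f' \<and> tgt f' = src m \<and> f = m \<cdot> f'"
    using m f' by metis
next
  assume "\<exists>m f'. is_kernel \<C> m g \<and> epi f' \<and> tgt f' = src m \<and> f = m \<cdot> f'"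
  then obtain m f' where m: "is_kernel \<C> m g" and f': "epi f'" "tgt f' = src m" "f = m \<cdot> f'"
    by blast
  note M = kernel_arr[OF m] kernel_mono[OF m] and F = epi_arr[OF f'(1)]
  have f: "arr f" "src f = src f'" "tgt f = tgt m" using f' M F by simp_all
  obtain q where q: "is_cokernel \<C> q f" using has_cokernels f by blast
  note Q = cokernel_arr[OF q]
  obtain c where c: "ses m c" using ses_of_mono[OF M(5)] by blast
  note C = ses_arr[OF c]
  have "c \<cdot> f = zero (src f) (tgt c)"
    unfolding f'(3) using comp_cancel[OF C(4), of f'] f'(2) F C M by simp
  then obtain w where w: "arr w" "src w = tgt q" "tgt w = tgt c" "w \<cdot> q = c"
    using cokernel_desc[OF q, of c] C f by auto
  have "is_kernel \<C> m q"
  proof (rule kernelI)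
    have "(q \<cdot> m) \<cdot> f' = zero (src f') (tgt (q \<cdot> m))" using Q M f F f' by simp
    then show "q \<cdot> m = zero (src m) (tgt q)"
      using epi_zero[OF f'(1), of "q \<cdot> m"] Q M f f' by simp
    fix h assume h: "arr h" "tgt h = src q" "q \<cdot> h = zero (src h) (tgt q)"
    have "c \<cdot> h = w \<cdot> (q \<cdot> h)" using w Q h by (metis comp_assoc')
    then have "c \<cdot> h = zero (src h) (tgt c)" using w h Q by simp
    then show "\<exists>u. arr u \<and> src u = src h \<and> tgt u = src m \<and> m \<cdot> u = h"
      using ses_lift[OF c, of h] h Q C f by (metis (no_types))
  qed (use M Q f in auto)
  then show "exact_pair \<C> f g" unfolding exact_pair_def is_image_def using q m by blast
qed

text \<open>
  If the first arrow is mono, then its factor onto the kernel is mono and epi, hence has a section.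
\<close>

lemma short_exact_iff: "short_exact \<C> f g \<longleftrightarrow> ses f g"
proof
  assume "short_exact \<C> f g"
  then have mono: "is_mono \<C> f" and epi: "epi g" and ex: "exact_pair \<C> f g"
    unfolding short_exact_def by auto
  obtain m f' where m: "is_kernel \<C> m g" and f': "epi f'" "tgt f' = src m" "f = m \<cdot> f'"
    using ex exact_pair_iff by blast
  note M = kernel_arr[OF m] and F = epi_arr[OF f'(1)]
  have f: "arr f" "src f = src f'" "tgt f = tgt m" using f' M F by simp_all
  have "is_mono \<C> f'"
  proof (rule monoI[OF F])
    fix s assume s: "arr s" "tgt s = src f'" "f' \<cdot> s = zero (src s) (tgt f')"
    have "f \<cdot> s = m \<cdot> (f' \<cdot> s)" using s f' M F by simp
    then have "f \<cdot> s = zero (src s) (tgt f)" using s f' M f by simp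
    then show "s = zero (src s) (src f')" using mono_zero[OF mono, of s] s f by simp
  qed
  then obtain t where t: "arr t" "src t = tgt f'" "tgt t = src f'" "f' \<cdot> t = ide (tgt f')"
    using mono_epi_section f' by metis
  have "is_kernel \<C> f g"
  proof (rule kernelI[OF mono])
    show "g \<cdot> f = zero (src f) (tgt g)"
      unfolding f'(3) using comp_cancel[OF M(4), of f'] M F f' by simp
    fix h assume h: "arr h" "tgt h = src g" "g \<cdot> h = zero (src h) (tgt g)"
    obtain u where u: "arr u" "src u = src h" "tgt u = src m" "m \<cdot> u = h"
      using kernel_lift[OF m h] by blast
    have "f \<cdot> (t \<cdot> u) = h"
      unfolding f'(3) using comp_cancel[OF t(4), of u] f'(2) t(1-3) u M(1-3) F by simp
    moreover have "arr (t \<cdot> u)" "src (t \<cdot> u) = src h" "tgt (t \<cdot> u) = src f"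
      using t u f f' by simp_all
    ultimately show "\<exists>u. arr u \<and> src u = src h \<and> tgt u = src f \<and> f \<cdot> u = h" by blast
  qed (use M f in auto)
  then show "ses f g" using epi by (simp add: ses_def)
next
  assume s: "ses f g"
  note S = ses_arr[OF s]
  have "exact_pair \<C> f g" unfolding exact_pair_iff
    using s idm_epi[of "src f"] S by (intro exI[of _ f] exI[of _ "ide (src f)"]) (auto simp: ses_def)
  then show "short_exact \<C> f g" using S by (simp add: short_exact_def)
qed

text \<open>
  The middle term of the pushout is the cokernel of \<open>(r, - m)\<close> into the direct sum. That \<open>f\<close> is the
  kernel of \<open>g\<close> is seen by lifting to the direct sum along an epi.
\<close>

lemma pushout_ses:
  assumes me: "ses m e" and r: "arr r" "src r = src m"
  obtains f g v where "ses f g" "src f = tgt r" "tgt g = tgt e"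
    "arr v" "src v = tgt m" "tgt v = tgt f" "v \<cdot> m = f \<cdot> r" "g \<cdot> v = e"
proof -
  note S = ses_arr[OF me]
  obtain b i i' p p' where b: "biprod (tgt r) (tgt m) b i i' p p'"
    by (rule biprod_exists[of "tgt r" "tgt m"]) (use S r in auto)
  note B = biprod_arr[OF b] and R = biprod_reduce[OF b]
  define j where "j = i \<cdot> r \<boxplus> neg (i' \<cdot> m)"
  have j: "arr j" "src j = src m" "tgt j = b"
    unfolding j_def using B(1-15) S r by simp_all
  have p'j: "p' \<cdot> j = neg m" and pj: "p \<cdot> j = r" unfolding j_def using B R S(1-3) r by simp_all
  have "is_mono \<C> j"
  proof (rule monoI)
    fix s assume s: "arr s" "tgt s = src j" "j \<cdot> s = zero (src s) (tgt j)"
    have "(p' \<cdot> j) \<cdot> s = p' \<cdot> (j \<cdot> s)" using s j B(13-15) by simp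
    then have "neg (m \<cdot> s) = zero (src s) (tgt m)"
      unfolding p'j using s j B(1-15) S by simp
    then have "neg (neg (m \<cdot> s)) = zero (src s) (tgt m)" using s S by simp
    then have "m \<cdot> s = zero (src s) (tgt m)" using s S j by simp
    then show "s = zero (src s) (src j)" using mono_zero[OF S(5), of s] s j by simp
  qed (rule j)
  then obtain c where c: "ses j c" using ses_of_mono by blast
  note C = ses_arr[OF c]
  define f where "f = c \<cdot> i"
  define v where "v = c \<cdot> i'"
  have f: "arr f" "src f = tgt r" "tgt f = tgt c" unfolding f_def using C B(1-15) j by simp_all
  have v: "arr v" "src v = tgt m" "tgt v = tgt c" unfolding v_def using C B(1-15) j by simp_all
  have "c \<cdot> j = f \<cdot> r \<boxplus> neg (v \<cdot> m)" unfolding j_def f_def v_def using C(1-3) B(1-15) S(1-3) j r by simp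
  then have "f \<cdot> r \<boxplus> neg (v \<cdot> m) = zero (src m) (tgt c)" using C j by simp
  then have vm: "f \<cdot> r = v \<cdot> m" using diff_eq_zero_iff[of "f \<cdot> r" "v \<cdot> m"] f v r S by simp
  have "(e \<cdot> p') \<cdot> j = e \<cdot> (p' \<cdot> j)" using S B(1-15) j by simp
  then have "(e \<cdot> p') \<cdot> j = zero (src j) (tgt (e \<cdot> p'))"
    unfolding p'j using S B(1-15) j by simp
  then obtain g where g: "arr g" "src g = tgt c" "tgt g = tgt e" "g \<cdot> c = e \<cdot> p'"
    using ses_desc[OF c, of "e \<cdot> p'"] S B(1-15) j C by auto
  have gv: "g \<cdot> v = e" unfolding v_def using comp_cancel[OF g(4), of i'] g(1,2) C(1-3) S B j by simp
  have gf: "g \<cdot> f = zero (tgt r) (tgt e)"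
    unfolding f_def using comp_cancel[OF g(4), of i] g(1,2) C(1-3) S B j by simp
  have gepi: "epi g"
  proof (rule epiI)
    fix s assume s: "arr s" "src s = tgt g" "s \<cdot> g = zero (src g) (tgt s)"
    have "s \<cdot> e = zero (src e) (tgt s)"
      unfolding gv[symmetric] using comp_cancel[OF s(3), of v] s(1,2) g v S by simp
    then show "s = zero (tgt g) (tgt s)" using epi_zero[OF S(6), of s] s g by simp
  qed (rule g)
  have fmono: "is_mono \<C> f"
  proof (rule monoI)
    fix t assume t: "arr t" "tgt t = src f" "f \<cdot> t = zero (src t) (tgt f)"
    have "c \<cdot> (i \<cdot> t) = zero (src (i \<cdot> t)) (tgt c)"
      using t f C B(1-9) j unfolding f_def by simp
    then obtain z where z: "arr z" "src z = src t" "tgt z = src m" "j \<cdot> z = i \<cdot> t"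
      using ses_lift[OF c, of "i \<cdot> t"] t f B(1-9) C j by auto
    have "(p' \<cdot> j) \<cdot> z = p' \<cdot> (i \<cdot> t)" using z j B(13-15) by simp
    then have "neg (m \<cdot> z) = zero (src t) (tgt m)"
      unfolding p'j using R(4) t f z S by simp
    then have "neg (neg (m \<cdot> z)) = zero (src t) (tgt m)" using t S by simp
    then have "m \<cdot> z = zero (src z) (tgt m)" using z t S by simp
    then have "z = zero (src t) (src m)" using mono_zero[OF S(5), of z] z by simp
    then have "i \<cdot> t = zero (src t) b" using z j t S by (metis comp_zero Dom_in_Ob)
    then have "p \<cdot> (i \<cdot> t) = zero (src t) (tgt r)" using B(10-12) t by simp
    then show "t = zero (src t) (src f)" using R(1) t f by simp
  qed (rule f)
  have "is_kernel \<C> f g"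
  proof (rule kernelI[OF fmono])
    fix h assume h: "arr h" "tgt h = src g" "g \<cdot> h = zero (src h) (tgt g)"
    \<comment> \<open>Lift \<open>h\<close> to the biproduct after a cover \<open>\<epsilon>\<close> of its domain; the lift ends in the image of
      \<open>f\<close>, and the factor through \<open>f\<close> descends along the cover.\<close>
    obtain \<epsilon> h' where h': "epi \<epsilon>" "tgt \<epsilon> = src h"
      "arr h'" "src h' = src \<epsilon>" "tgt h' = src c" "c \<cdot> h' = h \<cdot> \<epsilon>"
      using epi_pullback[OF C(6), of h] h g by auto
    note E = epi_arr[OF h'(1)]
    have cb: "src c = b" using C j by simp
    have "e \<cdot> (p' \<cdot> h') = g \<cdot> (c \<cdot> h')"
      using comp_cancel[OF g(4), of h'] g(1,2) C(1-3) S(1-3) B(1-15) h'(3-5) cb by simp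
    also have "\<dots> = zero (src (p' \<cdot> h')) (tgt e)"
      unfolding h'(6) using comp_cancel[OF h(3), of \<epsilon>] h(1,2) h'(2-5) E g(1-3) B(1-15) cb S by simp
    finally obtain z where z: "arr z" "src z = src h'" "tgt z = src m" "m \<cdot> z = p' \<cdot> h'"
      using ses_lift[OF me, of "p' \<cdot> h'"] h' B(1-15) cb S by auto
    define a where "a = p \<cdot> h' \<boxplus> r \<cdot> z"
    have a: "arr a" "src a = src \<epsilon>" "tgt a = tgt r"
      unfolding a_def using z h' B(1-15) cb r by simp_all
    have "h \<cdot> \<epsilon> = c \<cdot> (i \<cdot> (p \<cdot> h') \<boxplus> i' \<cdot> (p' \<cdot> h'))" using R(5)[of h'] h' cb by simp
    also have "\<dots> = f \<cdot> (p \<cdot> h') \<boxplus> v \<cdot> (m \<cdot> z)" unfolding z(4) f_def v_def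
      using C(1-3) B(1-15) h' cb by simp
    also have "v \<cdot> (m \<cdot> z) = (v \<cdot> m) \<cdot> z" using v z S by simp
    also have "\<dots> = f \<cdot> (r \<cdot> z)" unfolding vm[symmetric] using f r z by simp
    also have "f \<cdot> (p \<cdot> h') \<boxplus> f \<cdot> (r \<cdot> z) = f \<cdot> a" unfolding a_def
      using f z h' B(1-15) cb r by simp
    finally have ha: "h \<cdot> \<epsilon> = f \<cdot> a" .
    obtain \<kappa> where \<kappa>: "ses \<kappa> \<epsilon>" using ses_of_epi h' by blast
    note K = ses_arr[OF \<kappa>]
    have "f \<cdot> (a \<cdot> \<kappa>) = (h \<cdot> \<epsilon>) \<cdot> \<kappa>" unfolding ha using f a K by simp
    also have "\<dots> = zero (src \<kappa>) (tgt f)" using h K h' g f by simp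
    finally have "a \<cdot> \<kappa> = zero (src \<kappa>) (tgt a)"
      using mono_zero[OF fmono, of "a \<cdot> \<kappa>"] a f K by simp
    then obtain u where u: "arr u" "src u = tgt \<epsilon>" "tgt u = tgt a" "u \<cdot> \<epsilon> = a"
      using ses_desc[OF \<kappa>, of a] a by auto
    have fu: "(f \<cdot> u) \<cdot> \<epsilon> = h \<cdot> \<epsilon>" unfolding ha using u f a E by simp
    have "f \<cdot> u = h"
      by (rule epi_cancel[OF h'(1) _ _ _ _ fu]) (use u(1-3) f a h(1) h'(2) in simp_all)
    then show "\<exists>u. arr u \<and> src u = src h \<and> tgt u = src f \<and> f \<cdot> u = h"
      using u f a h' by auto
  qed (use f g gf in auto)
  then have "ses f g" using gepi by (simp add: ses_def)
  then show thesis using that[of f g v] f g v vm gv by simp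
qed

end

section \<open>Spliced extensions and the arrows that kill them\<close>
text \<open>
  An extension cut into short exact sequences. \<open>Base r m e\<close> represents the pushout of the short
  exact sequence \<open>m, e\<close> along \<open>r\<close>, and \<open>Splice E m e\<close> the Yoneda product of an extension \<open>E\<close> of the
  domain of \<open>m\<close> with \<open>m, e\<close>. Carrying the arrow \<open>r\<close> along means that extensions can be
  pushed out without changing any of the short exact sequences.
\<close>
datatype 'm yext = Base 'm 'm 'm | Splice "'m yext" 'm 'm

primrec depth :: "'m yext \<Rightarrow> nat" where
  "depth (Base r m e) = 1"
| "depth (Splice E m e) = Suc (depth E)"

primrec last_mono :: "'m yext \<Rightarrow> 'm" where
  "last_mono (Base r m e) = m"
| "last_mono (Splice E m e) = m"

primrec last_epi :: "'m yext \<Rightarrow> 'm" where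
  "last_epi (Base r m e) = e"
| "last_epi (Splice E m e) = e"

context abelian_category begin

primrec valid :: "'m yext \<Rightarrow> 'o \<Rightarrow> 'o \<Rightarrow> bool" where
  "valid (Base r m e) = (\<lambda>c a. ses m e \<and> tgt e = c \<and> r \<in> Hom \<C> (src m) a)"
| "valid (Splice E m e) = (\<lambda>c a. ses m e \<and> tgt e = c \<and> valid E (src m) a)"

text \<open>
  The arrows \<open>u\<close> and \<open>v\<close> are the sides of a commutative square from \<open>f\<close> to \<open>f'\<close>.
\<close>

definition square :: "'m \<Rightarrow> 'm \<Rightarrow> 'm \<Rightarrow> 'm \<Rightarrow> bool" where
  "square f u v f' \<longleftrightarrow> arr f \<and> arr u \<and> arr v \<and> arr f' \<and>
     src u = src f \<and> tgt u = src f' \<and> src v = tgt f \<and> tgt v = tgt f' \<and>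
     f' \<cdot> u = v \<cdot> f"

text \<open>
  A lift \<open>y\<close> of \<open>t\<close> through \<open>e\<close> which exists after composing with the epi \<open>q\<close>, together with the arrow
  \<open>w\<close> which it induces on the kernels of \<open>q\<close> and \<open>e\<close>.
\<close>

definition cover :: "'m \<Rightarrow> 'm \<Rightarrow> 'm \<Rightarrow> 'm \<Rightarrow> 'm \<Rightarrow> 'm \<Rightarrow> 'm \<Rightarrow> bool" where
  "cover m e t k q y w \<longleftrightarrow> ses k q \<and> square k w y m \<and> square q y t e"

definition extends_along :: "'m \<Rightarrow> 'm \<Rightarrow> bool" where
  "extends_along k x \<longleftrightarrow> (\<exists>a \<in> Hom \<C> (tgt k) (tgt x). x = a \<cdot> k)"

text \<open>
  Triviality of the extension pulled back along \<open>t\<close>. A cover of \<open>t\<close> is a morphism of short exact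
  sequences from \<open>k, q\<close> to \<open>m, e\<close> over \<open>t\<close>, so the pullback of \<open>Splice E m e\<close> along \<open>t\<close> is the Yoneda product
  of the pullback of \<open>E\<close> along \<open>w\<close> with \<open>k, q\<close>. It is trivial iff the first factor is trivial for a
  suitable cover. In degree one the pullback is the pushout of \<open>k, q\<close> along \<open>r \<cdot> w\<close>, which splits iff
  \<open>r \<cdot> w\<close> extends along \<open>k\<close>.
\<close>

primrec kill :: "'m yext \<Rightarrow> 'm \<Rightarrow> bool" where
  "kill (Base r m e) = (\<lambda>t. \<exists>k q y w. cover m e t k q y w \<and> extends_along k (r \<cdot> w))"
| "kill (Splice E m e) = (\<lambda>t. \<exists>k q y w. cover m e t k q y w \<and> kill E w)"

text \<open>
  What \<open>kill\<close> requires of the kernels of a cover. Isolating this condition lets both constructors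
  share the arguments about covers.
\<close>

primrec resid :: "'m yext \<Rightarrow> 'm \<Rightarrow> 'm \<Rightarrow> bool" where
  "resid (Base r m e) = (\<lambda>k w. extends_along k (r \<cdot> w))"
| "resid (Splice E m e) = (\<lambda>k w. kill E w)"

lemma kill_iff:
  "kill E t \<longleftrightarrow> (\<exists>k q y w. cover (last_mono E) (last_epi E) t k q y w \<and> resid E k w)"
  by (cases E) auto

lemma valid_ses: "valid E c a \<Longrightarrow> ses (last_mono E) (last_epi E) \<and> tgt (last_epi E) = c"
  by (cases E) auto

lemma squareD:
  assumes "square f u v f'"
  shows "arr f" "arr u" "arr v" "arr f'" "src u = src f" "tgt u = src f'"
    "src v = tgt f" "tgt v = tgt f'" "f' \<cdot> u = v \<cdot> f"
  using assms by (auto simp: square_def)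

lemma square_comp:
  assumes a: "square f u v f'" and b: "square f' u' v' f''"
  shows "square f (u' \<cdot> u) (v' \<cdot> v) f''"
proof -
  note A = squareD[OF a] and B = squareD[OF b]
  have "f'' \<cdot> (u' \<cdot> u) = (v' \<cdot> f') \<cdot> u" using comp_cancel[OF B(9), of u] A B(1-8) by simp
  also have "\<dots> = v' \<cdot> (v \<cdot> f)" unfolding A(9)[symmetric] using A(1-8) B(1-8) by simp
  also have "\<dots> = (v' \<cdot> v) \<cdot> f" using A(1-8) B(1-8) by simp
  finally show ?thesis unfolding square_def using A(1-8) B(1-8) by simp
qed

lemma square_add:
  assumes a: "square f u v f'" and b: "square f u' v' f'"
  shows "square f (u \<boxplus> u') (v \<boxplus> v') f'"
  using squareD[OF a] squareD[OF b] unfolding square_def by simp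

lemma square_kernels:
  assumes me: "ses m e" and kq: "is_kernel \<C> k q" and s: "square q y t e"
  obtains w where "square k w y m"
proof -
  note S = squareD[OF s] and M = ses_arr[OF me] and K = kernel_arr[OF kq]
  have "e \<cdot> (y \<cdot> k) = (t \<cdot> q) \<cdot> k" using comp_cancel[OF S(9), of k] S(1-8) K by simp
  then have "e \<cdot> (y \<cdot> k) = zero (src (y \<cdot> k)) (tgt e)" using S(1-8) K by simp
  then obtain w where "arr w" "src w = src (y \<cdot> k)" "tgt w = src m" "m \<cdot> w = y \<cdot> k"
    by (rule ses_lift[OF me, rotated 2]) (use S K in simp_all)
  then show thesis using that[of w] S(1-8) K M(1-3) by (simp add: square_def)
qed

lemma coverI:
  assumes "ses m e" "ses k q" "square q y t e"
  obtains w where "cover m e t k q y w"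
  using square_kernels[OF assms(1) _ assms(3)] assms unfolding cover_def ses_def by metis

lemma square_idm:
  assumes "arr q" "arr h" "tgt h = src q"
  shows "square (q \<cdot> h) h (ide (tgt q)) q"
  using assms by (simp add: square_def)

lemma cover_comp:
  assumes "cover m e t k q y w" "ses k1 q1" "square k1 h1 h k" "square q1 h u q"
  shows "cover m e (t \<cdot> u) k1 q1 (y \<cdot> h) (w \<cdot> h1)"
  using assms square_comp unfolding cover_def by blast

lemma cover_refine:
  assumes c: "cover m e t k q y w" and h: "epi h" "tgt h = src q"
  obtains k1 h1 where "square k1 h1 h k" "cover m e t k1 (q \<cdot> h) (y \<cdot> h) (w \<cdot> h1)"
proof -
  have kq: "ses k q" and s: "square k w y m" "square q y t e" using c by (auto simp: cover_def)
  note K = ses_arr[OF kq] and H = epi_arr[OF h(1)]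
  have "epi (q \<cdot> h)" using epi_comp K h by simp
  then obtain k1 where k1: "ses k1 (q \<cdot> h)" using ses_of_epi by blast
  have sq: "square (q \<cdot> h) h (ide (tgt q)) q" using square_idm K H h by simp
  obtain h1 where h1: "square k1 h1 h k" using square_kernels[OF kq _ sq] k1 by (auto simp: ses_def)
  have "t \<cdot> ide (tgt q) = t" using squareD[OF s(2)] by simp
  then show thesis using that[OF h1] cover_comp[OF c k1 h1 sq] by simp
qed

lemma common_refinement:
  assumes "ses k q" "ses k' q'" "tgt q = tgt q'"
  obtains h h' where "epi h'" "tgt h' = src q'" "arr h" "tgt h = src q" 
    "src h = src h'" "q \<cdot> h = q' \<cdot> h'"
proof (rule epi_pullback[of q q'])
qed (use assms ses_arr in \<open>auto intro: that\<close>)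

lemma cover_common:
  assumes c: "cover m e t k q y w" and c': "cover m' e' t' k' q' y' w'" and eq: "src t = src t'"
  obtains k1 h1 h h1' h' where "square k1 h1 h k" "square k1 h1' h' k'" "epi h'" "q \<cdot> h = q' \<cdot> h'"
    "cover m e t k1 (q' \<cdot> h') (y \<cdot> h) (w \<cdot> h1)" "cover m' e' t' k1 (q' \<cdot> h') (y' \<cdot> h') (w' \<cdot> h1')"
proof -
  have kq: "ses k q" "square q y t e" using c by (auto simp: cover_def)
  have kq': "ses k' q'" "square q' y' t' e'" using c' by (auto simp: cover_def)
  note S = squareD[OF kq(2)] and S' = squareD[OF kq'(2)]
  obtain h h' where h: "epi h'" "tgt h' = src q'" "arr h" "tgt h = src q" 
    "src h = src h'" "q \<cdot> h = q' \<cdot> h'"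
    using common_refinement[OF kq(1) kq'(1)] S S' eq by metis
  obtain k1 h1' where k1: "square k1 h1' h' k'" "cover m' e' t' k1 (q' \<cdot> h') (y' \<cdot> h') (w' \<cdot> h1')"
    using cover_refine[OF c' h(1,2)] by blast
  have k1s: "ses k1 (q' \<cdot> h')" using k1 by (simp add: cover_def)
  have sq: "square (q' \<cdot> h') h (ide (tgt q)) q"
    using square_idm[of q h] h S by simp
  obtain h1 where h1: "square k1 h1 h k" using square_kernels[OF kq(1) _ sq] k1s by (auto simp: ses_def)
  have "t \<cdot> ide (tgt q) = t" using S by simp
  then have "cover m e t k1 (q' \<cdot> h') (y \<cdot> h) (w \<cdot> h1)"
    using cover_comp[OF c k1s h1 sq] by simp
  then show thesis using that h1 k1 h by blast
qed

lemma extends_along_comp: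
  assumes "extends_along k x" "square k1 h1 h k" "arr x" "src x = src k"
  shows "extends_along k1 (x \<cdot> h1)"
proof -
  obtain a where a: "arr a" "src a = tgt k" "tgt a = tgt x" "x = a \<cdot> k"
    using assms(1) by (auto simp: extends_along_def Hom_iff)
  note S = squareD[OF assms(2)]
  have "x \<cdot> h1 = a \<cdot> (h \<cdot> k1)" unfolding S(9)[symmetric] unfolding a(4) using a(1,2) S(1-8) by simp
  then have "x \<cdot> h1 = (a \<cdot> h) \<cdot> k1" using a S by simp
  moreover have "a \<cdot> h \<in> Hom \<C> (tgt k1) (tgt (x \<cdot> h1))" using a(1-3) S(1-8) assms(3,4) by (simp add: Hom_iff)
  ultimately show ?thesis unfolding extends_along_def by blast
qed

lemma extends_along_add:
  assumes "extends_along k x" "extends_along k x'" "arr x" "arr x'" "arr k" "src x = src k"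
    "src x' = src k" "tgt x' = tgt x"
  shows "extends_along k (x \<boxplus> x')"
proof -
  obtain a where a: "arr a" "src a = tgt k" "tgt a = tgt x" "x = a \<cdot> k"
    using assms(1) by (auto simp: extends_along_def Hom_iff)
  obtain a' where a': "arr a'" "src a' = tgt k" "tgt a' = tgt x'" "x' = a' \<cdot> k"
    using assms(2) by (auto simp: extends_along_def Hom_iff)
  have "x \<boxplus> x' = (a \<boxplus> a') \<cdot> k" using a a' assms by simp
  moreover have "a \<boxplus> a' \<in> Hom \<C> (tgt k) (tgt (x \<boxplus> x'))" using a(1-3) a'(1-3) assms(3-) by (simp add: Hom_iff)
  ultimately show ?thesis unfolding extends_along_def by blast
qed

text \<open>
  A cover of \<open>t\<close> pulls back to a cover of \<open>t \<cdot> u\<close>.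
\<close>

lemma kill_comp_step:
  assumes R: "\<And>k w k1 h1 h. resid E k w \<Longrightarrow> arr w \<Longrightarrow> src w = src k \<Longrightarrow>
      tgt w = src (last_mono E) \<Longrightarrow> square k1 h1 h k \<Longrightarrow> resid E k1 (w \<cdot> h1)"
    and k: "kill E t" and u: "arr u" "tgt u = src t"
  shows "kill E (t \<cdot> u)"
proof -
  obtain k q y w where c: "cover (last_mono E) (last_epi E) t k q y w" and r: "resid E k w"
    using k kill_iff by blast
  have kq: "ses k q" "square k w y (last_mono E)" "square q y t (last_epi E)" using c by (auto simp: cover_def)
  note S = squareD[OF kq(3)] and K = ses_arr[OF kq(1)] and W = squareD[OF kq(2)]
  obtain q1 h where q1: "epi q1" "tgt q1 = src u"
    "arr h" "src h = src q1" "tgt h = src q" "q \<cdot> h = u \<cdot> q1"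
    using epi_pullback[OF K(6) u(1)] S u by metis
  obtain k1 where k1: "ses k1 q1" using ses_of_epi q1 by blast
  have sq: "square q1 h u q" using q1 K u S epi_arr by (simp add: square_def)
  obtain h1 where h1: "square k1 h1 h k" using square_kernels[OF kq(1) _ sq] k1 by (auto simp: ses_def)
  show ?thesis unfolding kill_iff using cover_comp[OF c k1 h1 sq] R[OF r _ _ _ h1] W by blast
qed

lemma kill_comp:
  assumes "valid E c a" "kill E t" "arr u" "tgt u = src t"
  shows "kill E (t \<cdot> u)"
  using assms
proof (induction E arbitrary: c t u)
  case (Base r m e)
  show ?case
  proof (rule kill_comp_step[OF _ Base.prems(2-4)])
    fix k w k1 h1 h assume r: "resid (Base r m e) k w" and w: "arr w" "src w = src k"
      "tgt w = src (last_mono (Base r m e))" and s: "square k1 h1 h k"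
    have "extends_along k1 ((r \<cdot> w) \<cdot> h1)"
      using extends_along_comp[OF _ s, of "r \<cdot> w"] r w Base.prems(1) by (simp add: Hom_iff)
    then show "resid (Base r m e) k1 (w \<cdot> h1)" using w Base.prems(1) squareD[OF s] by (simp add: Hom_iff)
  qed
next
  case (Splice E m e)
  show ?case
  proof (rule kill_comp_step[OF _ Splice.prems(2-4)])
    fix k w k1 h1 h assume r: "resid (Splice E m e) k w" and w: "arr w" "src w = src k"
      "tgt w = src (last_mono (Splice E m e))" and s: "square k1 h1 h k"
    show "resid (Splice E m e) k1 (w \<cdot> h1)" using Splice.IH[of "src m" w h1] r w Splice.prems(1) squareD[OF s] by simp
  qed
qed

lemma resid_comp:
  assumes "valid E c a" "resid E k w" "arr w" "src w = src k"
    "tgt w = src (last_mono E)" "square k1 h1 h k"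
  shows "resid E k1 (w \<cdot> h1)"
proof (cases E)
  case (Base r m e)
  have "extends_along k1 ((r \<cdot> w) \<cdot> h1)"
    using extends_along_comp[OF _ assms(6), of "r \<cdot> w"] assms Base by (simp add: Hom_iff)
  then show ?thesis using assms Base squareD[OF assms(6)] by (simp add: Hom_iff)
next
  case (Splice E' m e)
  then show ?thesis using kill_comp[of E' "src m" a w h1] assms squareD[OF assms(6)] by simp
qed

text \<open>
  An arrow which lifts through \<open>e\<close> is covered by the identity, with zero on the kernels.
\<close>

lemma identity_cover:
  assumes me: "ses m e" and s: "arr s" "tgt s = src e"
  obtains k where "cover m e (e \<cdot> s) k (ide (src s)) s (zero (src k) (src m))"
proof -
  note M = ses_arr[OF me]
  obtain k where k: "ses k (ide (src s))" using ses_of_epi idm_epi s by (metis Dom_in_Ob)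
  note K = ses_arr[OF k]
  have "k = zero (src k) (src s)" using K s by simp
  then have "s \<cdot> k = zero (src k) (src e)" using s K by (metis comp_zero Dom_in_Ob)
  then show thesis by (intro that[of k], unfold cover_def square_def) (use k K s M in simp)
qed

lemma kill_lift:
  assumes "valid E c a" "arr s" "tgt s = src (last_epi E)"
  shows "kill E (last_epi E \<cdot> s)"
  using assms
proof (induction E arbitrary: c s)
  case (Base r m e)
  then have me: "ses m e" and r: "arr r" "src r = src m" and s: "arr s" "tgt s = src e"
    by (auto simp: Hom_iff)
  obtain k where c: "cover m e (e \<cdot> s) k (ide (src s)) s (zero (src k) (src m))"
    by (rule identity_cover[OF me s])
  then have k: "arr k" "tgt k = src s" using s by (auto simp: cover_def square_def)
  have "extends_along k (r \<cdot> zero (src k) (src m))"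
    unfolding extends_along_def using k s r ses_arr(1)[OF me]
    by (intro bexI[of _ "zero (src s) (tgt r)"]) (simp_all add: Hom_iff)
  then show ?case using c by auto
next
  case (Splice E m e)
  then have me: "ses m e" and v: "valid E (src m) a" and s: "arr s" "tgt s = src e"
    by auto
  obtain k where c: "cover m e (e \<cdot> s) k (ide (src s)) s (zero (src k) (src m))"
    by (rule identity_cover[OF me s])
  then have k: "arr k" by (simp add: cover_def square_def)
  have l: "ses (last_mono E) (last_epi E)" "tgt (last_epi E) = src m" using valid_ses[OF v] by auto
  note L = ses_arr[OF l(1)]
  have "kill E (last_epi E \<cdot> zero (src k) (src (last_epi E)))"
    by (rule Splice.IH[OF v]) (use L k in simp_all)
  then have "kill E (zero (src k) (src m))" using L k l by simp
  then show ?case using c by auto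
qed

text \<open>
  The lift in a cover is unique up to arrows \<open>d\<close> into the domain of the last mono, and such an arrow
  changes the arrow between the kernels by a restriction of \<open>d\<close>. The change is harmless: after composing with an epi,
  \<open>d\<close> lifts through the last epi of the preceding extension, and lifted arrows kill; in degree
  one the restriction of \<open>r \<cdot> d\<close> extends by construction.
\<close>

lemma resid_boundary:
  assumes v: "valid E c a" and d: "arr d" "tgt d = src (last_mono E)"
  obtains h where "epi h" "tgt h = src d"
    "\<And>k. arr k \<Longrightarrow> tgt k = src h \<Longrightarrow> resid E k (d \<cdot> (h \<cdot> k))"
proof (cases E)
  case (Base r m e)
  show thesis
  proof (rule that[of "ide (src d)"])
    fix k assume k: "arr k" "tgt k = src (ide (src d))"
    then show "resid E k (d \<cdot> (ide (src d) \<cdot> k))"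
      using d v Base by (auto simp: extends_along_def Hom_iff intro!: bexI[of _ "r \<cdot> d"])
  qed (use d idm_epi in auto)
next
  case (Splice E' m e)
  then have v': "valid E' (src m) a" using v by simp
  have l: "ses (last_mono E') (last_epi E')" "tgt (last_epi E') = src m" using valid_ses[OF v'] by auto
  note L = ses_arr[OF l(1)]
  obtain h s where h: "epi h" "tgt h = src d"
    "arr s" "src s = src h" "tgt s = src (last_epi E')" "last_epi E' \<cdot> s = d \<cdot> h"
    using epi_pullback[OF L(6) d(1)] d l Splice by (metis last_mono.simps(2))
  note H = epi_arr[OF h(1)]
  show thesis
  proof (rule that[OF h(1,2)])
    fix k assume k: "arr k" "tgt k = src h"
    have "d \<cdot> (h \<cdot> k) = last_epi E' \<cdot> (s \<cdot> k)"
      using comp_cancel[OF h(6), of k] h(2-5) H k L d by simp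
    then show "resid E k (d \<cdot> (h \<cdot> k))" using kill_lift[OF v', of "s \<cdot> k"] h k Splice by simp
  qed
qed

text \<open>
  Two covers can be refined to have the same epi, and then their lifts can be added.
\<close>

lemma kill_add_step:
  assumes R: "\<And>k w w'. resid E k w \<Longrightarrow> resid E k w' \<Longrightarrow> arr w \<Longrightarrow> arr w' \<Longrightarrow> arr k \<Longrightarrow>
     src w = src k \<Longrightarrow> src w' = src k \<Longrightarrow> 
      tgt w = src (last_mono E) \<Longrightarrow> tgt w' = src (last_mono E) \<Longrightarrow> resid E k (w \<boxplus> w')"
    and v: "valid E c a" and k: "kill E t" "kill E t'" "src t = src t'"
  shows "kill E (t \<boxplus> t')"
proof -
  obtain k q y w where c: "cover (last_mono E) (last_epi E) t k q y w" and r: "resid E k w"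
    using k kill_iff by blast
  obtain k' q' y' w' where c': "cover (last_mono E) (last_epi E) t' k' q' y' w'" and r': "resid E k' w'"
    using k kill_iff by blast
  obtain k1 h1 h h1' h' where h: "square k1 h1 h k" "square k1 h1' h' k'"
    "cover (last_mono E) (last_epi E) t k1 (q' \<cdot> h') (y \<cdot> h) (w \<cdot> h1)" 
    "cover (last_mono E) (last_epi E) t' k1 (q' \<cdot> h') (y' \<cdot> h') (w' \<cdot> h1')"
    using cover_common[OF c c' k(3)] by metis
  have W: "square k w y (last_mono E)" "square k' w' y' (last_mono E)" using c c' by (auto simp: cover_def)
  note W1 = squareD[OF W(1)] and W2 = squareD[OF W(2)]
  have r1: "resid E k1 (w \<cdot> h1)" using resid_comp[OF v r _ _ _ h(1)] W1 by simp
  have r2: "resid E k1 (w' \<cdot> h1')" using resid_comp[OF v r' _ _ _ h(2)] W2 by simp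
  have X: "square k1 (w \<cdot> h1) (y \<cdot> h) (last_mono E)" "square k1 (w' \<cdot> h1') (y' \<cdot> h') (last_mono E)"
    "square (q' \<cdot> h') (y \<cdot> h) t (last_epi E)" "square (q' \<cdot> h') (y' \<cdot> h') t' (last_epi E)"
    "ses k1 (q' \<cdot> h')"
    using h(3,4) by (auto simp: cover_def)
  have "resid E k1 (w \<cdot> h1 \<boxplus> w' \<cdot> h1')"
    using R[OF r1 r2] squareD[OF X(1)] squareD[OF X(2)] by simp
  moreover have "cover (last_mono E) (last_epi E) (t \<boxplus> t') k1 (q' \<cdot> h') (y \<cdot> h \<boxplus> y' \<cdot> h') (w \<cdot> h1 \<boxplus> w' \<cdot> h1')"
    using square_add X unfolding cover_def by blast
  ultimately show ?thesis unfolding kill_iff by blast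
qed

lemma kill_add:
  assumes "valid E c a" "kill E t" "kill E t'" "src t = src t'"
  shows "kill E (t \<boxplus> t')"
  using assms
proof (induction E arbitrary: c t t')
  case (Base r m e)
  show ?case
  proof (rule kill_add_step[OF _ Base.prems])
    fix k w w' assume "resid (Base r m e) k w" "resid (Base r m e) k w'" "arr w" "arr w'" "arr k"
     "src w = src k" "src w' = src k" 
      "tgt w = src (last_mono (Base r m e))" "tgt w' = src (last_mono (Base r m e))"
    then show "resid (Base r m e) k (w \<boxplus> w')"
      using extends_along_add[of k "r \<cdot> w" "r \<cdot> w'"] Base.prems(1) by (simp add: Hom_iff)
  qed
next
  case (Splice E m e)
  show ?case
    by (rule kill_add_step[OF _ Splice.prems]) (use Splice.IH Splice.prems in auto)
qed

lemma resid_add: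
  assumes "valid E c a" "resid E k w" "resid E k w'" "arr w" "arr w'" "arr k"
     "src w = src k" "src w' = src k" 
      "tgt w = src (last_mono E)" "tgt w' = src (last_mono E)"
  shows "resid E k (w \<boxplus> w')"
proof (cases E)
  case (Base r m e)
  then show ?thesis using extends_along_add[of k "r \<cdot> w" "r \<cdot> w'"] assms by (simp add: Hom_iff)
next
  case (Splice E' m e)
  then show ?thesis using kill_add[of E' "src m" a w w'] assms by simp
qed

text \<open>
  The existential cover in the definition of \<open>kill\<close> may be replaced by any given cover, up to
  refinement: on a common refinement the two lifts of \<open>t\<close> differ by an arrow as in
  \<open>resid_boundary\<close>.
\<close>

lemma kill_any_cover:
  assumes v: "valid E c a" and kl: "kill E t"
    and c0: "cover (last_mono E) (last_epi E) t k0 q0 y0 w0"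
  obtains k1 h1 h where "epi h" "tgt h = src q0" "ses k1 (q0 \<cdot> h)" "square k1 h1 h k0" "resid E k1 (w0 \<cdot> h1)"
proof -
  let ?m = "last_mono E" and ?e = "last_epi E"
  have me: "ses ?m ?e" using valid_ses[OF v] by simp
  note M = ses_arr[OF me]
  obtain k q y w where c: "cover ?m ?e t k q y w" and r: "resid E k w"
    using kl kill_iff by blast
  have S: "square k w y ?m" "square k0 w0 y0 ?m" "ses k0 q0" "square q0 y0 t ?e" using c c0 by (auto simp: cover_def)
  have S5: "square q y t ?e" using c by (simp add: cover_def)
  note S1 = squareD[OF S(1)] and S2 = squareD[OF S(2)] and S5 = squareD[OF S5] and S4 = squareD[OF S(4)] and K0 = ses_arr[OF S(3)]
  obtain k2 h2 g h2' g' where h: "square k2 h2 g k" "square k2 h2' g' k0" "epi g'" "q \<cdot> g = q0 \<cdot> g'"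
    "cover ?m ?e t k2 (q0 \<cdot> g') (y \<cdot> g) (w \<cdot> h2)" 
    "cover ?m ?e t k2 (q0 \<cdot> g') (y0 \<cdot> g') (w0 \<cdot> h2')"
    using cover_common[OF c c0] by metis
  have X: "square (q0 \<cdot> g') (y \<cdot> g) t ?e" "square (q0 \<cdot> g') (y0 \<cdot> g') t ?e"
    "square k2 (w \<cdot> h2) (y \<cdot> g) ?m" "square k2 (w0 \<cdot> h2') (y0 \<cdot> g') ?m" "ses k2 (q0 \<cdot> g')"
    using h(5,6) by (auto simp: cover_def)
  note X1 = squareD[OF X(1)] and X2 = squareD[OF X(2)] and X3 = squareD[OF X(3)] and X4 = squareD[OF X(4)]
    and G = squareD[OF h(1)] and G' = squareD[OF h(2)]
  have X5: "src g' = src g" using G G' by simp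
  have arrs: "arr (y \<cdot> g)" "arr (y0 \<cdot> g')" "src (y \<cdot> g) = src g'" "src (y0 \<cdot> g') = src g'"
    "tgt (y \<cdot> g) = src ?e" "tgt (y0 \<cdot> g') = src ?e"
    using G(1-8) G'(1-8) S4(1-8) S1(1-8) S2(1-8) S5(1-8) M(3) X5 by simp_all
  \<comment> \<open>The difference of the two lifts takes values in the kernel of \<open>?e\<close>.\<close>
  define d where "d = y0 \<cdot> g' \<boxplus> neg (y \<cdot> g)"
  have d: "arr d" "src d = src g'" "tgt d = src ?e" "y \<cdot> g \<boxplus> d = y0 \<cdot> g'"
    unfolding d_def using arrs add_diff_cancel[of "y0 \<cdot> g'" "y \<cdot> g"] by simp_all
  have "?e \<cdot> d = ?e \<cdot> (y0 \<cdot> g') \<boxplus> neg (?e \<cdot> (y \<cdot> g))"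
    unfolding d_def by (subst comp_add') (use arrs M(2) in simp_all)
  also have "\<dots> = zero (src d) (tgt ?e)"
    unfolding X1(9) X2(9) using X1(1-3,7,8) d arrs X1(5) by simp
  finally obtain \<delta> where \<delta>: "arr \<delta>" "src \<delta> = src d" "tgt \<delta> = src ?m" "?m \<cdot> \<delta> = d"
    by (rule ses_lift[OF me d(1,3)])
  obtain f where f: "epi f" "tgt f = src \<delta>"
    "\<And>k. arr k \<Longrightarrow> tgt k = src f \<Longrightarrow> resid E k (\<delta> \<cdot> (f \<cdot> k))"
    using resid_boundary[OF v \<delta>(1,3)] by blast
  note F = epi_arr[OF f(1)]
  have fd: "tgt f = src (q0 \<cdot> g')" using f \<delta> d X1(5) arrs by simp
  obtain k1 f1 where k1: "square k1 f1 f k2" "cover ?m ?e t k1 ((q0 \<cdot> g') \<cdot> f) ((y0 \<cdot> g') \<cdot> f) ((w0 \<cdot> h2') \<cdot> f1)"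
    using cover_refine[OF h(6) f(1) fd] by blast
  note K1 = squareD[OF k1(1)]
  have sq: "square k1 (h2' \<cdot> f1) (g' \<cdot> f) k0" using square_comp[OF k1(1) h(2)] .
  note Q = squareD[OF sq]
  have r2: "resid E k2 (w \<cdot> h2)" by (rule resid_comp[OF v r _ _ _ h(1)]) (use S1 in simp_all)
  have r1: "resid E k1 ((w \<cdot> h2) \<cdot> f1)"
    by (rule resid_comp[OF v r2 _ _ _ k1(1)]) (use X3 in simp_all)
  have rd: "resid E k1 (\<delta> \<cdot> (f \<cdot> k1))" using f(3) K1 by simp
  have wt: "arr ((w \<cdot> h2) \<cdot> f1)" "src ((w \<cdot> h2) \<cdot> f1) = src k1" "tgt ((w \<cdot> h2) \<cdot> f1) = src ?m"
    using squareD[OF square_comp[OF k1(1) X(3)]] by simp_all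
  have dt: "arr (\<delta> \<cdot> (f \<cdot> k1))" "src (\<delta> \<cdot> (f \<cdot> k1)) = src k1" "tgt (\<delta> \<cdot> (f \<cdot> k1)) = src ?m"
    using \<delta>(1-3) f(2) F K1 by simp_all
  have r3: "resid E k1 ((w \<cdot> h2) \<cdot> f1 \<boxplus> \<delta> \<cdot> (f \<cdot> k1))"
    by (rule resid_add[OF v r1 rd]) (use wt dt K1 in simp_all)
  have "?m \<cdot> ((w \<cdot> h2) \<cdot> f1 \<boxplus> \<delta> \<cdot> (f \<cdot> k1)) = ?m \<cdot> ((w \<cdot> h2) \<cdot> f1) \<boxplus> ?m \<cdot> (\<delta> \<cdot> (f \<cdot> k1))"
    by (rule comp_add') (use wt dt M(1) in simp_all)
  also have "?m \<cdot> ((w \<cdot> h2) \<cdot> f1) = ((y \<cdot> g) \<cdot> f) \<cdot> k1"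
    using squareD(9)[OF square_comp[OF k1(1) X(3)]] .
  also have "?m \<cdot> (\<delta> \<cdot> (f \<cdot> k1)) = d \<cdot> (f \<cdot> k1)"
    by (rule comp_cancel[OF \<delta>(4)]) (use \<delta>(1-3) M(1) F K1(1-8) f(2) in simp_all)
  also have "((y \<cdot> g) \<cdot> f) \<cdot> k1 = (y \<cdot> g) \<cdot> (f \<cdot> k1)"
    by (rule comp_assoc') (use arrs F K1(1-8) f(2) \<delta>(2) d(2) in simp_all)
  also have "(y \<cdot> g) \<cdot> (f \<cdot> k1) \<boxplus> d \<cdot> (f \<cdot> k1) = (y \<cdot> g \<boxplus> d) \<cdot> (f \<cdot> k1)"
    by (rule add_comp'[symmetric]) (use arrs d(1-3) F K1(1-8) f(2) \<delta>(2) in simp_all)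
  also have "\<dots> = ((y0 \<cdot> g') \<cdot> f) \<cdot> k1" unfolding d(4)
    by (rule comp_assoc'[symmetric]) (use arrs F K1(1-8) f(2) \<delta>(2) d(2) in simp_all)
  also have "\<dots> = ?m \<cdot> ((w0 \<cdot> h2') \<cdot> f1)"
    using squareD(9)[OF square_comp[OF k1(1) X(4)]] by simp
  finally have eq: "?m \<cdot> ((w \<cdot> h2) \<cdot> f1 \<boxplus> \<delta> \<cdot> (f \<cdot> k1)) = ?m \<cdot> ((w0 \<cdot> h2') \<cdot> f1)" .
  have w0t: "arr ((w0 \<cdot> h2') \<cdot> f1)" "tgt ((w0 \<cdot> h2') \<cdot> f1) = src ?m"
    using squareD[OF square_comp[OF k1(1) X(4)]] by simp_all
  have "(w \<cdot> h2) \<cdot> f1 \<boxplus> \<delta> \<cdot> (f \<cdot> k1) = (w0 \<cdot> h2') \<cdot> f1"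
    by (rule mono_cancel[OF M(5) _ _ _ _ eq]) (use wt dt w0t in simp_all)
  also have "\<dots> = w0 \<cdot> (h2' \<cdot> f1)" by (rule comp_assoc') (use S2 G' K1 in simp_all)
  finally have fin: "resid E k1 (w0 \<cdot> (h2' \<cdot> f1))" using r3 by simp
  have epi: "epi (g' \<cdot> f)" by (rule epi_comp) (use f h(3) \<delta>(2) d(2) in simp_all)
  have "(q0 \<cdot> g') \<cdot> f = q0 \<cdot> (g' \<cdot> f)"
    by (rule comp_assoc') (use K0(2,3) G' F f(2) \<delta>(2) d(2) in simp_all)
  then have ses: "ses k1 (q0 \<cdot> (g' \<cdot> f))" using k1(2) by (simp add: cover_def)
  show thesis by (rule that[OF epi _ ses sq fin]) (use G' K0 F f \<delta>(2) d(2) in simp_all)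
qed

end

section \<open>Morphisms of extensions\<close>
context abelian_category begin

text \<open>
  Morphisms of spliced extensions which are the identity on the left end and \<open>\<phi>\<close> on the right end.
\<close>

primrec mor :: "'m yext \<Rightarrow> 'm yext \<Rightarrow> 'm \<Rightarrow> bool" where
  "mor (Base r m e) = (\<lambda>E' \<phi>. case E' of
     Base r' m' e' \<Rightarrow> \<exists>\<zeta> v. square m \<zeta> v m' \<and> square e v \<phi> e' \<and> r' \<cdot> \<zeta> = r
   | Splice _ _ _ \<Rightarrow> False)"
| "mor (Splice E m e) = (\<lambda>E' \<phi>. case E' of
     Base _ _ _ \<Rightarrow> False
   | Splice E' m' e' \<Rightarrow> \<exists>\<zeta> v. square m \<zeta> v m' \<and> square e v \<phi> e' \<and> mor E E' \<zeta>)"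

lemma mor_BaseE:
  assumes "mor (Base r m e) E' \<phi>"
  obtains r' m' e' \<zeta> v where "E' = Base r' m' e'" "square m \<zeta> v m'" "square e v \<phi> e'" "r' \<cdot> \<zeta> = r"
  using assms by (auto split: yext.splits)

lemma mor_SpliceE:
  assumes "mor (Splice E m e) E' \<phi>"
  obtains F' m' e' \<zeta> v where "E' = Splice F' m' e'" "square m \<zeta> v m'" "square e v \<phi> e'" "mor E F' \<zeta>"
  using assms by (auto split: yext.splits)

text \<open>
  Composing a cover with the morphism gives a cover for the target.
\<close>

lemma mor_kill:
  assumes "valid E c a" "valid E' c' a'" "mor E E' \<phi>" "kill E t"
  shows "kill E' (\<phi> \<cdot> t)"
  using assms
proof (induction E arbitrary: E' c c' \<phi> t)
  case (Base r m e)
  obtain r' m' e' \<zeta> v where E': "E' = Base r' m' e'" and s: "square m \<zeta> v m'" "square e v \<phi> e'" "r' \<cdot> \<zeta> = r"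
    using mor_BaseE Base.prems(3) by blast
  obtain k q y w where c: "cover m e t k q y w" "extends_along k (r \<cdot> w)" using Base.prems(4) by auto
  have w: "square k w y m" using c by (simp add: cover_def)
  have "cover m' e' (\<phi> \<cdot> t) k q (v \<cdot> y) (\<zeta> \<cdot> w)"
    using c(1) s square_comp unfolding cover_def by blast
  moreover have "r' \<cdot> (\<zeta> \<cdot> w) = r \<cdot> w"
    by (rule comp_cancel[OF s(3)]) (use squareD[OF s(1)] squareD[OF w] Base.prems(2) E' in \<open>simp_all add: Hom_iff\<close>)
  then have "extends_along k (r' \<cdot> (\<zeta> \<cdot> w))" using c(2) by simp
  ultimately show ?case using E' by auto
next
  case (Splice E m e)
  obtain F' m' e' \<zeta> v where E': "E' = Splice F' m' e'" and s: "square m \<zeta> v m'" "square e v \<phi> e'" "mor E F' \<zeta>"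
    using mor_SpliceE Splice.prems(3) by blast
  obtain k q y w where c: "cover m e t k q y w" "kill E w" using Splice.prems(4) by auto
  have "cover m' e' (\<phi> \<cdot> t) k q (v \<cdot> y) (\<zeta> \<cdot> w)"
    using c(1) s square_comp unfolding cover_def by blast
  moreover have "kill F' (\<zeta> \<cdot> w)" using Splice.IH[OF _ _ s(3) c(2)] Splice.prems E' by auto
  ultimately show ?case using E' by auto
qed

lemma kill_mor_step:
  assumes R: "\<And>k w. resid E' k (\<zeta> \<cdot> w) \<Longrightarrow> arr k \<Longrightarrow> arr w \<Longrightarrow> src w = src k \<Longrightarrow> 
      tgt w = src (last_mono E) \<Longrightarrow> resid E k w"
    and v: "valid E c a" "valid E' c' a'" and s: "square (last_mono E) \<zeta> v (last_mono E')"
      "square (last_epi E) v \<phi> (last_epi E')"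
    and k: "kill E' (\<phi> \<cdot> t)" and t: "arr t" "tgt t = c"
  shows "kill E t"
proof -
  let ?m = "last_mono E" and ?e = "last_epi E"
  have me: "ses ?m ?e" "tgt ?e = c" using valid_ses[OF v(1)] by simp_all
  note M = ses_arr[OF me(1)] and S1 = squareD[OF s(1)]
  have me': "ses (last_mono E') (last_epi E')" using valid_ses[OF v(2)] by simp
  obtain q0 y0 where q0: "epi q0" "tgt q0 = src t"
    "arr y0" "src y0 = src q0" "tgt y0 = src ?e" "?e \<cdot> y0 = t \<cdot> q0"
    using epi_pullback[OF M(6) t(1)] me t by metis
  have sq: "square q0 y0 t ?e" unfolding square_def using q0 t me M epi_arr by simp
  obtain k0 where k0: "ses k0 q0" using ses_of_epi q0 by blast
  obtain w0 where c: "cover ?m ?e t k0 q0 y0 w0" using coverI[OF me(1) k0 sq] by blast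
  have c': "cover (last_mono E') (last_epi E') (\<phi> \<cdot> t) k0 q0 (v \<cdot> y0) (\<zeta> \<cdot> w0)"
    using c s square_comp unfolding cover_def by blast
  obtain k1 h1 h where h: "epi h" "tgt h = src q0" "ses k1 (q0 \<cdot> h)" "square k1 h1 h k0" 
    "resid E' k1 ((\<zeta> \<cdot> w0) \<cdot> h1)"
    using kill_any_cover[OF v(2) k c'] by blast
  have w0: "square k0 w0 y0 ?m" using c by (simp add: cover_def)
  note W = squareD[OF w0] and H = squareD[OF h(4)]
  have "(\<zeta> \<cdot> w0) \<cdot> h1 = \<zeta> \<cdot> (w0 \<cdot> h1)" by (rule comp_assoc') (use W H S1 in simp_all)
  then have "resid E k1 (w0 \<cdot> h1)" using R[of k1 "w0 \<cdot> h1"] h(5) W H by simp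
  moreover have "square (q0 \<cdot> h) h (ide (tgt q0)) q0" by (intro square_idm epi_arr q0(1) h(1,2))
  then have "cover ?m ?e (t \<cdot> ide (tgt q0)) k1 (q0 \<cdot> h) (y0 \<cdot> h) (w0 \<cdot> h1)"
    by (rule cover_comp[OF c h(3,4)])
  then have "cover ?m ?e t k1 (q0 \<cdot> h) (y0 \<cdot> h) (w0 \<cdot> h1)" using t q0 by simp
  ultimately show ?thesis using kill_iff by blast
qed

text \<open>
  The converse needs a lift of \<open>t\<close> to the source. Pulling back the last epi along \<open>t\<close> gives some cover,
  and by \<open>kill_any_cover\<close> triviality in the target can be tested on its image.
\<close>

lemma kill_mor:
  assumes "valid E c a" "valid E' c' a" "mor E E' \<phi>" "kill E' (\<phi> \<cdot> t)" "arr t" "tgt t = c"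
  shows "kill E t"
  using assms
proof (induction E arbitrary: E' c c' \<phi> t)
  case (Base r m e)
  obtain r' m' e' \<zeta> v where E': "E' = Base r' m' e'" and s: "square m \<zeta> v m'" "square e v \<phi> e'" "r' \<cdot> \<zeta> = r"
    using mor_BaseE Base.prems(3) by blast
  show ?case
  proof (rule kill_mor_step[OF _ Base.prems(1,2) _ _ Base.prems(4-6)])
    fix k w assume r: "resid E' k (\<zeta> \<cdot> w)" and w: "arr w" "src w = src k" "tgt w = src (last_mono (Base r m e))"
    have "r' \<cdot> (\<zeta> \<cdot> w) = r \<cdot> w"
      by (rule comp_cancel[OF s(3)]) (use squareD[OF s(1)] w Base.prems(2) E' in \<open>simp_all add: Hom_iff\<close>)
    then show "resid (Base r m e) k w" using r E' by simp
  qed (use s E' in auto)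
next
  case (Splice E m e)
  obtain F' m' e' \<zeta> v where E': "E' = Splice F' m' e'" and s: "square m \<zeta> v m'" "square e v \<phi> e'" "mor E F' \<zeta>"
    using mor_SpliceE Splice.prems(3) by blast
  show ?case
  proof (rule kill_mor_step[OF _ Splice.prems(1,2) _ _ Splice.prems(4-6)])
    fix k w assume r: "resid E' k (\<zeta> \<cdot> w)" and w: "arr w" "src w = src k" "tgt w = src (last_mono (Splice E m e))"
    show "resid (Splice E m e) k w" using Splice.IH[OF _ _ s(3), of "src m" _ w] Splice.prems r w E' by auto
  qed (use s E' in auto)
qed

section \<open>Half exactness\<close>

primrec push :: "'m \<Rightarrow> 'm yext \<Rightarrow> 'm yext" where
  "push f (Base r m e) = Base (f \<cdot> r) m e"
| "push f (Splice E m e) = Splice (push f E) m e"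

lemma push_simps [simp]: "last_mono (push f E) = last_mono E" "last_epi (push f E) = last_epi E"
  "depth (push f E) = depth E"
  by (induction E) auto

lemma push_valid: "valid E c a \<Longrightarrow> arr f \<Longrightarrow> src f = a \<Longrightarrow> valid (push f E) c (tgt f)"
  by (induction E arbitrary: c) (auto simp: Hom_iff)

lemma depth_pos: "depth E \<ge> 1" by (cases E) auto

lemma depth_oneE:
  assumes "depth E = 1" obtains r m e where "E = Base r m e"
proof (cases E)
  case (Splice F m e)
  then show thesis using assms depth_pos[of F] by simp
qed (rule that)

text \<open>
  Exactness of \<open>Hom(T, C) \<rightarrow> Ext\<^sup>1(T, K) \<rightarrow> Ext\<^sup>1(T, X)\<close> for the short exact sequence \<open>\<kappa>, \<pi>\<close>. If \<open>E\<close>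
  pulled back along \<open>t\<close> becomes trivial when pushed out along \<open>\<kappa>\<close>, then it comes from some \<open>\<rho>\<close>, and
  \<open>t \<cdot> u\<close> kills \<open>E\<close> for every \<open>u\<close> for which \<open>\<rho> \<cdot> u\<close> lifts through \<open>\<pi>\<close>. The arrow \<open>\<rho>\<close> is obtained
  by composing the extension \<open>a\<close> of \<open>\<kappa> \<cdot> r \<cdot> w\<close> with \<open>\<pi>\<close>.
\<close>

lemma obstruction_Base:
  assumes kp: "ses \<kappa> \<pi>" and v: "valid (Base r m e) c (src \<kappa>)"
    and k: "kill (push \<kappa> (Base r m e)) t" and t: "arr t" "tgt t = c"
  obtains \<rho> where "arr \<rho>" "src \<rho> = src t" "tgt \<rho> = tgt \<pi>"
    "\<And>u b. arr u \<Longrightarrow> tgt u = src t \<Longrightarrow> arr b \<Longrightarrow> src b = src u \<Longrightarrow> tgt b = src \<pi> \<Longrightarrow> \<pi> \<cdot> b = \<rho> \<cdot> u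
       \<Longrightarrow> kill (Base r m e) (t \<cdot> u)"
proof -
  have me: "ses m e" and r: "arr r" "src r = src m" "tgt r = src \<kappa>" using v by (auto simp: Hom_iff)
  note M = ses_arr[OF me] and P = ses_arr[OF kp]
  obtain k q y w where c: "cover m e t k q y w" and x: "extends_along k ((\<kappa> \<cdot> r) \<cdot> w)" using k by auto
  have S: "ses k q" "square k w y m" "square q y t e" using c by (auto simp: cover_def)
  note K = ses_arr[OF S(1)] and W = squareD[OF S(2)] and Y = squareD[OF S(3)]
  obtain a where a: "arr a" "src a = src q" "tgt a = src \<pi>" "a \<cdot> k = (\<kappa> \<cdot> r) \<cdot> w"
    using x K P r W by (auto simp: extends_along_def Hom_iff)
  have "\<pi> \<cdot> (\<kappa> \<cdot> (r \<cdot> w)) = zero (src k) (tgt \<pi>)"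
    using comp_cancel[OF P(4), of "r \<cdot> w"] P(1-3) r W by simp
  then have "(\<pi> \<cdot> a) \<cdot> k = zero (src k) (tgt (\<pi> \<cdot> a))"
    using a P(1-3) K(1-3) r W(1-8) by simp
  then obtain \<rho> where \<rho>: "arr \<rho>" "src \<rho> = tgt q" "tgt \<rho> = tgt (\<pi> \<cdot> a)" "\<rho> \<cdot> q = \<pi> \<cdot> a"
    by (rule ses_desc[OF S(1), rotated 2]) (use a P K in simp_all)
  show thesis
  proof (rule that[of \<rho>])
    show "arr \<rho>" "src \<rho> = src t" "tgt \<rho> = tgt \<pi>" using \<rho> Y a P by simp_all
    fix u b assume u: "arr u" "tgt u = src t" and b: "arr b" "src b = src u" "tgt b = src \<pi>" "\<pi> \<cdot> b = \<rho> \<cdot> u"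
    obtain q1 h where q1: "epi q1" "tgt q1 = src u"
      "arr h" "src h = src q1" "tgt h = src q" "q \<cdot> h = u \<cdot> q1"
      using epi_pullback[OF K(6) u(1)] Y u by metis
    note Q = epi_arr[OF q1(1)]
    have sq: "square q1 h u q" using q1 K u Y Q by (simp add: square_def)
    obtain k1 where k1: "ses k1 q1" using ses_of_epi q1 by blast
    note K1 = ses_arr[OF k1]
    obtain h1 where h1: "square k1 h1 h k" using square_kernels[OF S(1) _ sq] k1 by (auto simp: ses_def)
    note H = squareD[OF h1]
    \<comment> \<open>Correct the extension \<open>a\<close> by \<open>b\<close>, so that it takes values in the kernel of \<open>\<pi>\<close>.\<close>
    have b1: "arr (b \<cdot> q1)" "src (b \<cdot> q1) = src q1" "tgt (b \<cdot> q1) = src \<pi>" using b q1(2) Q by simp_all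
    have ah: "arr (a \<cdot> h)" "src (a \<cdot> h) = src q1" "tgt (a \<cdot> h) = src \<pi>" using a q1(3-5) by simp_all
    have "\<pi> \<cdot> (a \<cdot> h) = \<rho> \<cdot> (q \<cdot> h)"
      using comp_cancel[OF \<rho>(4)[symmetric], of h] a(1-3) P(1-3) \<rho>(1-3) q1(3-5) K(1-3) by simp
    also have "\<dots> = (\<rho> \<cdot> u) \<cdot> q1" unfolding q1(6) using \<rho>(1-3) u Y q1(2) Q by simp
    also have "\<dots> = \<pi> \<cdot> (b \<cdot> q1)" unfolding b(4)[symmetric] using b(1-3) q1(2) Q P(2) by simp
    finally have "\<pi> \<cdot> (a \<cdot> h) = \<pi> \<cdot> (b \<cdot> q1)" .
    then have "\<pi> \<cdot> (a \<cdot> h \<boxplus> neg (b \<cdot> q1)) = zero (src (a \<cdot> h \<boxplus> neg (b \<cdot> q1))) (tgt \<pi>)"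
      by (subst comp_add') (use ah b1 P(2) in simp_all)
    then obtain a' where a': "arr a'" "src a' = src (a \<cdot> h \<boxplus> neg (b \<cdot> q1))" "tgt a' = src \<kappa>"
        "\<kappa> \<cdot> a' = a \<cdot> h \<boxplus> neg (b \<cdot> q1)"
      by (rule ses_lift[OF kp, rotated 2]) (use ah b1 in simp_all)
    have a'd: "src a' = src q1" using a'(2) ah b1 by simp
    have bk: "(b \<cdot> q1) \<cdot> k1 = zero (src k1) (src \<pi>)"
      using b q1(2) Q K1 by simp
    have "\<kappa> \<cdot> (a' \<cdot> k1) = (a \<cdot> h \<boxplus> neg (b \<cdot> q1)) \<cdot> k1"
      by (rule comp_cancel[OF a'(4)]) (use a'(1,3) a'd P(1) K1 in simp_all)
    also have "\<dots> = (a \<cdot> h) \<cdot> k1 \<boxplus> neg ((b \<cdot> q1) \<cdot> k1)"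
      by (subst add_comp') (use ah b1 K1(1-3) in simp_all)
    also have "\<dots> = (a \<cdot> h) \<cdot> k1" unfolding bk using ah K1(1-3) P(1-3) by simp
    also have "\<dots> = a \<cdot> (k \<cdot> h1)" unfolding H(9) using a(1,2) q1(3-5) K1(1-3) by simp
    also have "\<dots> = ((\<kappa> \<cdot> r) \<cdot> w) \<cdot> h1"
      by (rule comp_cancel[OF a(4)]) (use a(1,2) K(1-3) H(1-8) in simp_all)
    also have "\<dots> = \<kappa> \<cdot> (r \<cdot> (w \<cdot> h1))" using P(1) r W(1-8) H(1-8) by simp
    finally have eq: "\<kappa> \<cdot> (a' \<cdot> k1) = \<kappa> \<cdot> (r \<cdot> (w \<cdot> h1))" .
    have "a' \<cdot> k1 = r \<cdot> (w \<cdot> h1)"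
      by (rule mono_cancel[OF P(5) _ _ _ _ eq]) (use a'(1,3) a'd K1(1-3) r W(1-8) H(1-8) in simp_all)
    then have "extends_along k1 (r \<cdot> (w \<cdot> h1))" unfolding extends_along_def Hom_iff
      using a'(1,3) a'd K1(1-3) r W(1-8) H(1-8) by (intro bexI[of _ a']) (simp_all add: Hom_iff)
    then show "kill (Base r m e) (t \<cdot> u)" using cover_comp[OF c k1 h1 sq] by auto
  qed
qed

text \<open>
  Exactness of \<open>Ext\<^sup>i(T, C) \<rightarrow> Ext\<^sup>i\<^sup>+\<^sup>1(T, K) \<rightarrow> Ext\<^sup>i\<^sup>+\<^sup>1(T, X)\<close>. The preimage \<open>F\<close> is the obstruction for the
  preceding extension and the arrow \<open>w\<close>, spliced with the short exact sequence of the cover.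
\<close>

lemma obstruction_Splice:
  assumes kp: "ses \<kappa> \<pi>" and v: "valid E c (src \<kappa>)" and d: "depth E = Suc (Suc i)"
    and k: "kill (push \<kappa> E) t" and t: "arr t" "tgt t = c"
  obtains F where "valid F (src t) (tgt \<pi>)" "depth F = Suc i"
    "\<And>u. arr u \<Longrightarrow> tgt u = src t \<Longrightarrow> kill F u \<Longrightarrow> kill E (t \<cdot> u)"
  using v d k t
proof (induction E arbitrary: c t i thesis)
  case (Base r m e)
  then show ?case by simp
next
  case (Splice E m e)
  have me: "ses m e" and v': "valid E (src m) (src \<kappa>)" using Splice.prems by auto
  obtain k q y w where c: "cover m e t k q y w" and kw: "kill (push \<kappa> E) w" using Splice.prems by auto
  have S: "ses k q" "square k w y m" "square q y t e" using c by (auto simp: cover_def)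
  note K = ses_arr[OF S(1)] and W = squareD[OF S(2)] and Y = squareD[OF S(3)] and P = ses_arr[OF kp]
  show ?case
  proof (cases i)
    case 0
    have "depth E = 1" using 0 Splice.prems(3) by simp
    then obtain r0 m0 e0 where E: "E = Base r0 m0 e0" by (rule depth_oneE)
    obtain \<rho> where \<rho>: "arr \<rho>" "src \<rho> = src w" "tgt \<rho> = tgt \<pi>"
      "\<And>u b. arr u \<Longrightarrow> tgt u = src w \<Longrightarrow> arr b \<Longrightarrow> src b = src u \<Longrightarrow> tgt b = src \<pi> \<Longrightarrow> \<pi> \<cdot> b = \<rho> \<cdot> u
       \<Longrightarrow> kill E (w \<cdot> u)"
      using obstruction_Base[OF kp v'[unfolded E] kw[unfolded E] W(2,6)] E by metis
    show ?thesis
    proof (rule Splice.prems(1)[of "Base \<rho> k q"])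
      show "valid (Base \<rho> k q) (src t) (tgt \<pi>)" using S(1) \<rho> W Y by (simp add: Hom_iff)
      show "depth (Base \<rho> k q) = Suc i" using 0 by simp
      fix u assume u: "arr u" "tgt u = src t" and ku: "kill (Base \<rho> k q) u"
      obtain k' q' y' w' where c': "cover k q u k' q' y' w'" and x: "extends_along k' (\<rho> \<cdot> w')" using ku by auto
      have S': "ses k' q'" "square k' w' y' k" "square q' y' u q" using c' by (auto simp: cover_def)
      note K' = ses_arr[OF S'(1)] and W' = squareD[OF S'(2)] and Y' = squareD[OF S'(3)]
      obtain a where a: "arr a" "src a = src q'" "tgt a = tgt \<pi>" "\<rho> \<cdot> w' = a \<cdot> k'"
        using x K' \<rho>(1-3) W W' by (auto simp: extends_along_def Hom_iff)
      obtain h b where h: "epi h" "tgt h = src a" "arr b" "src b = src h" "tgt b = src \<pi>" "\<pi> \<cdot> b = a \<cdot> h"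
        using epi_pullback[OF P(6) a(1,3)] by blast
      obtain k1 h1 where k1: "square k1 h1 h k'" "cover k q u k1 (q' \<cdot> h) (y' \<cdot> h) (w' \<cdot> h1)"
        using cover_refine[OF c' h(1)] h(2) a(2) by metis
      note H1 = squareD[OF k1(1)]
      have C1: "ses k1 (q' \<cdot> h)" "square k1 (w' \<cdot> h1) (y' \<cdot> h) k" "square (q' \<cdot> h) (y' \<cdot> h) u q" 
        using k1(2) by (auto simp: cover_def)
      have "\<pi> \<cdot> (b \<cdot> k1) = (a \<cdot> h) \<cdot> k1"
        by (rule comp_cancel[OF h(6)]) (use h(3-5) P(2) H1 in simp_all)
      also have "\<dots> = a \<cdot> (k' \<cdot> h1)" unfolding H1(9) using a(1,2) H1(1-8) h(2) by simp
      also have "\<dots> = (\<rho> \<cdot> w') \<cdot> h1"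
        by (rule comp_cancel[OF a(4)[symmetric]]) (use a(1,2) K' H1(1-8) in simp_all)
      also have "\<dots> = \<rho> \<cdot> (w' \<cdot> h1)" using \<rho>(1,2) W(5) W'(1-8) H1(1-8) by simp
      finally have "kill E (w \<cdot> (w' \<cdot> h1))"
        using \<rho>(4)[of "w' \<cdot> h1" "b \<cdot> k1"] W(5) W'(1-8) H1(1-8) h(3-5) by simp
      then show "kill (Splice E m e) (t \<cdot> u)"
        using cover_comp[OF c C1] by auto
    qed
  next
    case (Suc i')
    obtain F where F: "valid F (src w) (tgt \<pi>)" "depth F = Suc i'"
      "\<And>u. arr u \<Longrightarrow> tgt u = src w \<Longrightarrow> kill F u \<Longrightarrow> kill E (w \<cdot> u)"
      by (rule Splice.IH[OF _ v' _ kw W(2,6), of i']) (use Splice.prems(3) Suc in auto)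
    show ?thesis
    proof (rule Splice.prems(1)[of "Splice F k q"])
      show "valid (Splice F k q) (src t) (tgt \<pi>)" using S(1) F W(5) Y by simp
      show "depth (Splice F k q) = Suc i" using F Suc by simp
      fix u assume u: "arr u" "tgt u = src t" and ku: "kill (Splice F k q) u"
      obtain k' q' y' w' where c': "cover k q u k' q' y' w'" and x: "kill F w'" using ku by auto
      have S': "ses k' q'" "square k' w' y' k" "square q' y' u q" using c' by (auto simp: cover_def)
      have "kill E (w \<cdot> w')" using F(3)[of w'] x squareD[OF S'(2)] W(5) by simp
      then show "kill (Splice E m e) (t \<cdot> u)" using cover_comp[OF c S'] by auto
    qed
  qed
qed

text \<open>
  A cover which works for one component is refined to one which works for both.
\<close>

lemma kill_biproduct_step:
  assumes R: "\<And>k w. resid (push p E) k w \<Longrightarrow> resid (push p' E) k w \<Longrightarrow> arr k \<Longrightarrow> arr w \<Longrightarrow>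
      src w = src k \<Longrightarrow> tgt w = src (last_mono E) \<Longrightarrow> resid E k w"
    and v: "valid E c b" and p: "arr p" "src p = b" "arr p'" "src p' = b"
    and k: "kill (push p E) t" "kill (push p' E) t"
  shows "kill E t"
proof -
  let ?m = "last_mono E" and ?e = "last_epi E"
  have v1: "valid (push p E) c (tgt p)" "valid (push p' E) c (tgt p')"
    using push_valid[OF v] p by simp_all
  obtain k q y w where c: "cover ?m ?e t k q y w" and x: "resid (push p E) k w"
    using k(1) unfolding kill_iff push_simps by blast
  obtain k1 h1 h where h: "epi h" "tgt h = src q" "ses k1 (q \<cdot> h)" "square k1 h1 h k"
     "resid (push p' E) k1 (w \<cdot> h1)"
    using kill_any_cover[OF v1(2) k(2), unfolded push_simps, OF c] by blast
  have S: "square k w y ?m" "square q y t ?e" using c by (auto simp: cover_def)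
  note W = squareD[OF S(1)] and Y = squareD[OF S(2)] and H = squareD[OF h(4)]
  have "resid (push p E) k1 (w \<cdot> h1)"
    by (rule resid_comp[OF v1(1) x _ _ _ h(4)]) (use W in simp_all)
  then have "resid E k1 (w \<cdot> h1)" by (rule R[OF _ h(5)]) (use W H in simp_all)
  moreover have "square (q \<cdot> h) h (ide (tgt q)) q" by (intro square_idm epi_arr[OF h(1)] Y(1) h(2))
  then have "cover ?m ?e (t \<cdot> ide (tgt q)) k1 (q \<cdot> h) (y \<cdot> h) (w \<cdot> h1)"
    by (rule cover_comp[OF c h(3,4)])
  then have "cover ?m ?e t k1 (q \<cdot> h) (y \<cdot> h) (w \<cdot> h1)" using Y by simp
  ultimately show ?thesis unfolding kill_iff by blast
qed

lemma kill_biproduct: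
  assumes b: "biprod a a' b i i' p p'" and "valid E c b" "kill (push p E) t" "kill (push p' E) t"
  shows "kill E t"
  using assms(2-)
proof (induction E arbitrary: c t)
  note B = biprod_arr[OF b]
  case (Base r m e)
  have r: "arr r" "src r = src m" "tgt r = b" using Base.prems by (auto simp: Hom_iff)
  show ?case
  proof (rule kill_biproduct_step[OF _ Base.prems(1) B(10,11,13,14) Base.prems(2,3)])
    fix k w assume res: "resid (push p (Base r m e)) k w" "resid (push p' (Base r m e)) k w"
      and k: "arr k" and w: "arr w" "src w = src k" "tgt w = src (last_mono (Base r m e))"
    let ?x = "r \<cdot> w"
    have xt: "arr ?x" "src ?x = src k" "tgt ?x = b" using r w by simp_all
    obtain \<alpha> where \<alpha>: "arr \<alpha>" "src \<alpha> = tgt k" "tgt \<alpha> = a" "p \<cdot> ?x = \<alpha> \<cdot> k"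
      using res(1) r B(10-12) w by (auto simp: extends_along_def Hom_iff)
    obtain \<beta> where \<beta>: "arr \<beta>" "src \<beta> = tgt k" "tgt \<beta> = a'" "p' \<cdot> ?x = \<beta> \<cdot> k"
      using res(2) r B(13-15) w by (auto simp: extends_along_def Hom_iff)
    have "?x = i \<cdot> (p \<cdot> ?x) \<boxplus> i' \<cdot> (p' \<cdot> ?x)" using biprod_reduce(5)[OF b xt(1,3)] by simp
    also have "\<dots> = (i \<cdot> \<alpha> \<boxplus> i' \<cdot> \<beta>) \<cdot> k" unfolding \<alpha>(4) \<beta>(4)
      using \<alpha>(1-3) \<beta>(1-3) B(4-9) k by simp
    finally have "?x = (i \<cdot> \<alpha> \<boxplus> i' \<cdot> \<beta>) \<cdot> k" .
    moreover have "i \<cdot> \<alpha> \<boxplus> i' \<cdot> \<beta> \<in> Hom \<C> (tgt k) (tgt ?x)"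
      unfolding Hom_iff xt(3) using \<alpha>(1-3) \<beta>(1-3) B(4-9) by simp
    ultimately have "extends_along k ?x" unfolding extends_along_def by blast
    then show "resid (Base r m e) k w" by simp
  qed
next
  note B = biprod_arr[OF b]
  case (Splice E m e)
  show ?case
    by (rule kill_biproduct_step[OF _ Splice.prems(1) B(10,11,13,14) Splice.prems(2,3)])
      (use Splice.IH Splice.prems(1) in auto)
qed

end

section \<open>Spliced extensions and lists of arrows\<close>
context abelian_category begin

text \<open>
  The exact sequence obtained by composing the epis and monos at which \<open>E\<close> is cut. It represents the class
  of \<open>E\<close> if the arrow in the base is an identity.
\<close>

primrec arrows :: "'m yext \<Rightarrow> 'm list" where
  "arrows (Base r m e) = [m, e]"
| "arrows (Splice E m e) = butlast (arrows E) @ [m \<cdot> last (arrows E), e]"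

primrec id_based :: "'m yext \<Rightarrow> bool" where
  "id_based (Base r m e) \<longleftrightarrow> r = ide (src m)"
| "id_based (Splice E m e) \<longleftrightarrow> id_based E"

lemma mor_BaseI:
  assumes "square m \<zeta> v m'" "square e v \<phi> e'" "r' \<cdot> \<zeta> = r"
  shows "mor (Base r m e) (Base r' m' e') \<phi>"
  using assms by auto

lemma valid_Base_id:
  assumes "valid (Base r m e) c a" "id_based (Base r m e)"
  shows "ses m e \<and> tgt e = c \<and> src m = a \<and> r = ide a"
proof -
  have me: "ses m e" and r: "r \<in> Hom \<C> (src m) a" "r = ide (src m)" "tgt e = c" using assms by auto
  have "src m \<in> Ob \<C>" using ses_arr[OF me] by simp
  then have "tgt r = src m" using r(2) by simp
  then show ?thesis using r me by (simp add: Hom_iff)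
qed

lemma length_arrows [simp]: "length (arrows E) = Suc (depth E)"
  by (induction E) auto

lemma last_arrows [simp]: "last (arrows E) = last_epi E"
  by (induction E) auto

lemma arrows_nth_depth: "arrows E ! depth E = last_epi E"
  using last_conv_nth[of "arrows E"] last_arrows[of E] length_arrows[of E]
  by (metis diff_Suc_1 length_0_conv old.nat.distinct(2))

lemma arrows_Splice_nth:
  "j < depth E \<Longrightarrow> arrows (Splice E m e) ! j = arrows E ! j"
  "arrows (Splice E m e) ! depth E = m \<cdot> last_epi E"
  "arrows (Splice E m e) ! Suc (depth E) = e"
  by (auto simp: nth_append nth_butlast)

lemma kernel_mono_comp:
  assumes m: "is_mono \<C> m" and g: "arr g" "tgt g = src m"
  shows "is_kernel \<C> k (m \<cdot> g) \<longleftrightarrow> is_kernel \<C> k g"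
proof
  note M = mono_arr[OF m]
  have z: "m \<cdot> (g \<cdot> h) = zero (src h) (tgt m) \<longleftrightarrow> g \<cdot> h = zero (src h) (tgt g)"
    if "arr h" "tgt h = src g" for h
    using mono_zero[OF m, of "g \<cdot> h"] that g M by auto
  {
    assume k: "is_kernel \<C> k (m \<cdot> g)"
    note K = kernel_arr[OF k]
    show "is_kernel \<C> k g"
    proof (rule kernelI[OF kernel_mono[OF k]])
      show "g \<cdot> k = zero (src k) (tgt g)" using z[of k] K g M by simp
      fix h assume h: "arr h" "tgt h = src g" "g \<cdot> h = zero (src h) (tgt g)"
      obtain u where "arr u" "src u = src h" "tgt u = src k" "k \<cdot> u = h"
        by (rule kernel_lift[OF k h(1)]) (use z[of h] h g M in simp_all)
      then show "\<exists>u. arr u \<and> src u = src h \<and> tgt u = src k \<and> k \<cdot> u = h" by blast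
    qed (use K g M in simp_all)
  next
    assume k: "is_kernel \<C> k g"
    note K = kernel_arr[OF k]
    show "is_kernel \<C> k (m \<cdot> g)"
    proof (rule kernelI[OF kernel_mono[OF k]])
      show "(m \<cdot> g) \<cdot> k = zero (src k) (tgt (m \<cdot> g))" using z[of k] K g M by simp
      fix h assume h: "arr h" "tgt h = src (m \<cdot> g)" "(m \<cdot> g) \<cdot> h = zero (src h) (tgt (m \<cdot> g))"
      obtain u where "arr u" "src u = src h" "tgt u = src k" "k \<cdot> u = h"
        by (rule kernel_lift[OF k h(1)]) (use z[of h] h g M in simp_all)
      then show "\<exists>u. arr u \<and> src u = src h \<and> tgt u = src k \<and> k \<cdot> u = h" by blast
    qed (use K g M in simp_all)
  }
qed

lemma exact_pair_mono_comp:
  assumes "is_mono \<C> m" "arr g" "tgt g = src m"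
  shows "exact_pair \<C> f (m \<cdot> g) \<longleftrightarrow> exact_pair \<C> f g"
  unfolding exact_pair_def kernel_mono_comp[OF assms] ..

lemma yoneda_extension_arrows:
  assumes "valid E c a" "id_based E"
  shows "yoneda_extension \<C> (depth E) c a (arrows E)"
  using assms
proof (induction E arbitrary: c)
  case (Base r m e)
  then have "ses m e" "src m = a" "tgt e = c" using ses_arr[of m e] by (auto simp: Hom_iff)
  then show ?case unfolding yoneda_extension_def using short_exact_iff[of m e] by (auto simp: short_exact_def)
next
  case (Splice E m e)
  have IH: "yoneda_extension \<C> (depth E) (src m) a (arrows E)" and me: "ses m e" "tgt e = c"
    using Splice by auto
  let ?d = "depth E" and ?fs = "arrows (Splice E m e)"
  note M = ses_arr[OF me(1)] and d = depth_pos[of E] and N = arrows_Splice_nth[where E=E and m=m and e=e]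
  have l: "epi (last_epi E)" "tgt (last_epi E) = src m"
    using IH arrows_nth_depth by (auto simp: yoneda_extension_def)
  have "exact_pair \<C> (?fs ! j) (?fs ! (j + 1))" if j: "j < Suc ?d" for j
  proof -
    consider "j + 1 < ?d" | "j + 1 = ?d" | "j = ?d" using j by linarith
    then show ?thesis
    proof cases
      case 1
      then show ?thesis using IH N(1)[of j] N(1)[of "j+1"] by (simp add: yoneda_extension_def del: arrows.simps)
    next
      case 2
      then have "j < ?d" by simp
      then have "exact_pair \<C> (arrows E ! j) (arrows E ! (j + 1))"
        using IH unfolding yoneda_extension_def by blast
      then have "exact_pair \<C> (arrows E ! j) (last_epi E)" unfolding 2 arrows_nth_depth .
      then have "exact_pair \<C> (arrows E ! j) (m \<cdot> last_epi E)"
        using exact_pair_mono_comp[OF M(5)] l epi_arr by simp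
      then show ?thesis using N(1)[of j] N(2) 2 by (simp del: arrows.simps)
    next
      case 3
      have "exact_pair \<C> (m \<cdot> last_epi E) e"
        unfolding exact_pair_iff using me l by (auto simp: ses_def)
      then show ?thesis using N(2,3) 3 by (simp del: arrows.simps)
    qed
  qed
  moreover have "?fs ! 0 = arrows E ! 0" using N(1)[of 0] d by simp
  ultimately show ?case unfolding yoneda_extension_def
    using IH me M N(3) d by (auto simp: yoneda_extension_def simp del: arrows.simps)
qed

lemma arrows_of_yoneda_extension:
  assumes "yoneda_extension \<C> i c a fs" "i \<ge> 1"
  shows "\<exists>E. valid E c a \<and> id_based E \<and> depth E = i \<and> arrows E = fs"
  using assms(2,1)
proof (induction i arbitrary: c fs rule: nat_induct_at_least)
  case base
  then obtain f g where fs: "fs = [f, g]"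
    by (auto simp: yoneda_extension_def length_Suc_conv)
  then have "short_exact \<C> f g" and d: "src f = a" "tgt g = c"
    using base by (auto simp: yoneda_extension_def short_exact_def)
  then have s: "ses f g" using short_exact_iff by blast
  then have "valid (Base (ide a) f g) c a" using d ses_arr[OF s] by (auto simp: Hom_iff)
  then show ?case using fs d by (intro exI[of _ "Base (ide a) f g"]) (simp del: mor.simps)
next
  case (Suc i)
  note Y = Suc.prems[unfolded yoneda_extension_def]
  let ?h = "fs ! i" and ?e = "fs ! Suc i"
  have fs: "fs = take i fs @ [?h, ?e]" 
    using Y by (metis Cons_nth_drop_Suc Suc_eq_plus1 append_take_drop_id drop_all le_refl less_Suc_eq)
  have "exact_pair \<C> ?h ?e" using Y by auto
  then obtain m g where m: "is_kernel \<C> m ?e" and g: "epi g" "tgt g = src m" "?h = m \<cdot> g"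
    using exact_pair_iff by blast
  have me: "ses m ?e" using m Y by (simp add: ses_def)
  note M = ses_arr[OF me] and G = epi_arr[OF g(1)]
  let ?fs = "take i fs @ [g]"
  have nth: "?fs ! j = fs ! j" if "j < i" for j using that Y by (simp add: nth_append)
  have nthi: "?fs ! i = g" using Y by (simp add: nth_append)
  have "exact_pair \<C> (?fs ! j) (?fs ! (j+1))" if j: "j < i" for j
  proof (cases "j + 1 = i")
    case True
    have "exact_pair \<C> (fs ! j) (fs ! (j+1))" using Y j by auto
    then have "exact_pair \<C> (fs ! j) (m \<cdot> g)" using g True by simp
    then show ?thesis using exact_pair_mono_comp[OF M(5) G g(2)] nth[OF j] nthi True by simp
  next
    case False
    then show ?thesis using Y j nth[of j] nth[of "j+1"] by auto
  qed
  then have "yoneda_extension \<C> i (src m) a ?fs"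
    unfolding yoneda_extension_def using Y nth[of 0] nthi g Suc.hyps by auto
  then obtain E where E: "valid E (src m) a" "id_based E" "depth E = i" "arrows E = ?fs"
    using Suc.IH by blast
  have "arrows (Splice E m ?e) = fs" using E(4) g(3) fs by simp
  moreover have "valid (Splice E m ?e) c a" using E me Y by simp
  ultimately show ?case using E by (intro exI[of _ "Splice E m ?e"]) simp
qed

text \<open>
  The vertical arrows of a morphism of exact sequences induce arrows on the objects at which the
  sequences are cut.
\<close>

lemma mor_of_ladder:
  assumes "valid E c a" "valid E' c' a" "id_based E" "id_based E'" "depth E' = depth E"
    and "v 0 = ide a" "v (Suc (depth E)) \<in> Hom \<C> c c'"
    and "\<And>j. j \<le> depth E \<Longrightarrow> v j \<in> Hom \<C> (src (arrows E ! j)) (src (arrows E' ! j)) \<and>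
        v (Suc j) \<cdot> arrows E ! j = arrows E' ! j \<cdot> v j"
  shows "mor E E' (v (Suc (depth E)))"
  using assms
proof (induction E arbitrary: E' c c' v)
  case (Base r m e)
  then have "depth E' = 1" by simp
  then obtain r' m' e' where E': "E' = Base r' m' e'" by (rule depth_oneE)
  have me: "ses m e" "ses m' e'" "src m = a" "src m' = a" "tgt e = c" "tgt e' = c'"
    "r = ide a" "r' = ide a"
    using valid_Base_id[OF Base.prems(1,3)] valid_Base_id[OF Base.prems(2,4)[unfolded E']] by blast+
  note M = ses_arr[OF me(1)] and M' = ses_arr[OF me(2)]
  have v: "v 1 \<in> Hom \<C> (src e) (src e')" "v 1 \<cdot> m = m' \<cdot> ide a" "v 2 \<cdot> e = e' \<cdot> v 1" "v 2 \<in> Hom \<C> c c'"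
    using Base.prems(6,7) Base.prems(8)[of 0] Base.prems(8)[of 1] E' by (auto simp: numeral_2_eq_2)
  have a: "a \<in> Ob \<C>" using M me by auto
  have "square m (ide a) (v 1) m'" "square e (v 1) (v 2) e'"
    unfolding square_def using v M M' me a by (simp_all add: Hom_iff)
  moreover have "r' \<cdot> ide a = r" using me a by simp
  ultimately show ?case using E' by (auto simp: numeral_2_eq_2)
next
  case (Splice E m e)
  obtain F m' e' where E': "E' = Splice F m' e'" using Splice.prems(5) depth_pos[of E] by (cases E') auto
  have me: "ses m e" "ses m' e'" "tgt e = c" "tgt e' = c'" and V: "valid E (src m) a" "valid F (src m') a"
    and I: "id_based E" "id_based F" and d: "depth F = depth E"
    using Splice.prems E' by auto
  note M = ses_arr[OF me(1)] and M' = ses_arr[OF me(2)]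
  let ?d = "depth E"
  let ?g = "last_epi E" and ?g' = "last_epi F"
  have l: "arr ?g" "tgt ?g = src m" "arr ?g'" "tgt ?g' = src m'"
    using valid_ses[OF V(1)] valid_ses[OF V(2)] ses_arr by auto
  note N = arrows_Splice_nth[where E=E and m=m and e=e] and N' = arrows_Splice_nth[where E=F and m=m' and e=e']
  have vd: "v ?d \<in> Hom \<C> (src ?g) (src ?g')" "v (Suc ?d) \<cdot> (m \<cdot> ?g) = (m' \<cdot> ?g') \<cdot> v ?d"
    using Splice.prems(8)[of ?d] E' N(2) N'(2) d l M M' by (simp_all del: arrows.simps)
  have vd1: "v (Suc ?d) \<in> Hom \<C> (src e) (src e')" "v (Suc (Suc ?d)) \<cdot> e = e' \<cdot> v (Suc ?d)" 
     "v (Suc (Suc ?d)) \<in> Hom \<C> c c'"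
    using Splice.prems(7) Splice.prems(8)[of "Suc ?d"] E' N(3) N'(3) d by (simp_all del: arrows.simps)
  have s: "square e (v (Suc ?d)) (v (Suc (Suc ?d))) e'"
    unfolding square_def using vd1 M M' me by (simp add: Hom_iff)
  obtain \<zeta> where \<zeta>: "square m \<zeta> (v (Suc ?d)) m'"
    using square_kernels[OF me(2) _ s] me(1) by (auto simp: ses_def)
  note Z = squareD[OF \<zeta>]
  have "m' \<cdot> (\<zeta> \<cdot> ?g) = (v (Suc ?d) \<cdot> m) \<cdot> ?g"
    by (rule comp_cancel[OF Z(9)]) (use Z(1-8) l in simp_all)
  also have "\<dots> = v (Suc ?d) \<cdot> (m \<cdot> ?g)" using Z(1-8) l by simp
  also have "\<dots> = m' \<cdot> (?g' \<cdot> v ?d)" unfolding vd(2) using vd(1) l M' by (simp add: Hom_iff)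
  finally have eq: "m' \<cdot> (\<zeta> \<cdot> ?g) = m' \<cdot> (?g' \<cdot> v ?d)" .
  have zg: "\<zeta> \<cdot> ?g = ?g' \<cdot> v ?d"
    by (rule mono_cancel[OF M'(5) _ _ _ _ eq]) (use Z(1-8) l vd(1) in \<open>simp_all add: Hom_iff\<close>)
  have "mor E F ((v(Suc ?d := \<zeta>)) (Suc ?d))"
  proof (rule Splice.IH[OF V I d, where v = "v(Suc ?d := \<zeta>)"])
    show "(v(Suc ?d := \<zeta>)) 0 = ide a" using Splice.prems by simp
    show "(v(Suc ?d := \<zeta>)) (Suc ?d) \<in> Hom \<C> (src m) (src m')" using Z by (simp add: Hom_iff)
    fix j assume j: "j \<le> ?d"
    show "(v(Suc ?d := \<zeta>)) j \<in> Hom \<C> (src (arrows E ! j)) (src (arrows F ! j)) \<and>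
        (v(Suc ?d := \<zeta>)) (Suc j) \<cdot> arrows E ! j = arrows F ! j \<cdot> (v(Suc ?d := \<zeta>)) j"
    proof (cases "j = ?d")
      case True
      then show ?thesis using vd zg arrows_nth_depth[of E] arrows_nth_depth[of F] d by simp
    next
      case False
      then have "j < ?d" using j by simp
      then show ?thesis using Splice.prems(8)[of j] E' N(1)[of j] N'(1)[of j] d by (simp del: arrows.simps)
    qed
  qed
  then show ?case using E' \<zeta> s by auto
qed

lemma ladder_of_mor:
  assumes "valid E c a" "valid E' c' a" "id_based E" "id_based E'" "mor E E' \<phi>"
  shows "depth E' = depth E \<and> (\<exists>v. v 0 = ide a \<and> v (Suc (depth E)) = \<phi> \<and>
    (\<forall>j \<le> depth E. v j \<in> Hom \<C> (src (arrows E ! j)) (src (arrows E' ! j)) \<and>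
        v (Suc j) \<cdot> arrows E ! j = arrows E' ! j \<cdot> v j))"
  using assms
proof (induction E arbitrary: E' c c' \<phi>)
  case (Base r m e)
  obtain r' m' e' \<zeta> v where E': "E' = Base r' m' e'" and s: "square m \<zeta> v m'" "square e v \<phi> e'" "r' \<cdot> \<zeta> = r"
    using mor_BaseE Base.prems(5) by blast
  note S = squareD[OF s(1)] squareD[OF s(2)]
  have a: "src m = a" "src m' = a" "r = ide a" "r' = ide a" "ses m e" "ses m' e'" 
    using valid_Base_id[OF Base.prems(1,3)] valid_Base_id[OF Base.prems(2,4)[unfolded E']] by blast+
  have z: "\<zeta> = ide a" using s(3) a S by simp
  define w where "w = (\<lambda>j::nat. if j = 0 then ide a else if j = 1 then v else \<phi>)"
  have "w j \<in> Hom \<C> (src ([m,e] ! j)) (src ([m',e'] ! j)) \<and> w (Suc j) \<cdot> [m,e] ! j = [m',e'] ! j \<cdot> w j"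
    if j: "j \<le> 1" for j
  proof -
    have "j = 0 \<or> j = 1" using j by linarith
    then show ?thesis using S a z by (auto simp: w_def Hom_iff)
  qed
  then show ?case using E' by (auto intro!: exI[of _ w] simp: w_def)
next
  case (Splice E m e)
  obtain F m' e' \<zeta> v where E': "E' = Splice F m' e'" and s: "square m \<zeta> v m'" "square e v \<phi> e'" "mor E F \<zeta>"
    using mor_SpliceE Splice.prems(5) by blast
  have V: "valid E (src m) a" "valid F (src m') a" and I: "id_based E" "id_based F"
    using Splice.prems E' by auto
  let ?d = "depth E"
  obtain v0 where d: "depth F = ?d" and v0: "v0 0 = ide a" "v0 (Suc ?d) = \<zeta>"
    "\<And>j. j \<le> ?d \<Longrightarrow> v0 j \<in> Hom \<C> (src (arrows E ! j)) (src (arrows F ! j)) \<and>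
        v0 (Suc j) \<cdot> arrows E ! j = arrows F ! j \<cdot> v0 j"
    using Splice.IH[OF V I s(3)] by blast
  let ?g = "last_epi E" and ?g' = "last_epi F"
  have l: "arr ?g" "tgt ?g = src m" "arr ?g'" "tgt ?g' = src m'"
    using valid_ses[OF V(1)] valid_ses[OF V(2)] ses_arr by auto
  note N = arrows_Splice_nth[where E=E and m=m and e=e] and N' = arrows_Splice_nth[where E=F and m=m' and e=e']
  note Z = squareD[OF s(1)] and Y = squareD[OF s(2)]
  define w where "w = v0(Suc ?d := v, Suc (Suc ?d) := \<phi>)"
  have vd: "v0 ?d \<in> Hom \<C> (src ?g) (src ?g')" "\<zeta> \<cdot> ?g = ?g' \<cdot> v0 ?d"
    using v0(3)[of ?d] v0(2) arrows_nth_depth[of E] arrows_nth_depth[of F] d by simp_all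
  have "v \<cdot> (m \<cdot> ?g) = (m' \<cdot> \<zeta>) \<cdot> ?g"
    by (rule comp_cancel[OF Z(9)[symmetric]]) (use Z(1-8) l in simp_all)
  also have "\<dots> = m' \<cdot> (\<zeta> \<cdot> ?g)" using Z(1-8) l by simp
  also have "\<dots> = (m' \<cdot> ?g') \<cdot> v0 ?d" unfolding vd(2) using vd(1) l Z(4) by (simp add: Hom_iff)
  finally have eq: "v \<cdot> (m \<cdot> ?g) = (m' \<cdot> ?g') \<cdot> v0 ?d" .
  have "w j \<in> Hom \<C> (src (arrows (Splice E m e) ! j)) (src (arrows E' ! j)) \<and>
        w (Suc j) \<cdot> arrows (Splice E m e) ! j = arrows E' ! j \<cdot> w j" if j: "j \<le> Suc ?d" for j
  proof -
    consider "j < ?d" | "j = ?d" | "j = Suc ?d" using j by linarith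
    then show ?thesis
    proof cases
      case 1
      then show ?thesis using v0(3)[of j] N(1)[of j] N'(1)[of j] d E' by (simp add: w_def del: arrows.simps)
    next
      case 2
      then show ?thesis using N(2) N'(2) d E' eq vd(1) l Z by (simp add: w_def Hom_iff del: arrows.simps comp_assoc')
    next
      case 3
      then show ?thesis using N(3) N'(3) d E' Y by (simp add: w_def Hom_iff del: arrows.simps)
    qed
  qed
  then show ?case using d E' v0(1) by (auto simp: w_def simp del: arrows.simps intro!: exI[of _ w])
qed

lemma yoneda_morphism_iff_mor:
  assumes "valid E c a" "valid E' c a" "id_based E" "id_based E'" "depth E' = depth E"
  shows "yoneda_morphism \<C> (depth E) c a (arrows E) (arrows E') \<longleftrightarrow> mor E E' (ide c)"
proof
  have c: "c \<in> Ob \<C>" using valid_ses[OF assms(1)] ses_arr by auto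
  {
    assume "yoneda_morphism \<C> (depth E) c a (arrows E) (arrows E')"
    then obtain vs where "vs ! 0 = ide a" "vs ! Suc (depth E) = ide c"
      "\<And>j. j \<le> depth E \<Longrightarrow> vs ! j \<in> Hom \<C> (src (arrows E ! j)) (src (arrows E' ! j)) \<and>
        vs ! Suc j \<cdot> arrows E ! j = arrows E' ! j \<cdot> vs ! j"
      unfolding yoneda_morphism_def by auto
    then show "mor E E' (ide c)" using mor_of_ladder[OF assms, of "(!) vs"] c idm_in_Hom by auto
  next
    assume "mor E E' (ide c)"
    then obtain v where v: "v 0 = ide a" "v (Suc (depth E)) = ide c"
      "\<And>j. j \<le> depth E \<Longrightarrow> v j \<in> Hom \<C> (src (arrows E ! j)) (src (arrows E' ! j)) \<and>
        v (Suc j) \<cdot> arrows E ! j = arrows E' ! j \<cdot> v j"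
      using ladder_of_mor[OF assms(1-4)] by blast
    let ?vs = "map v [0..<depth E + 2]"
    have nth: "?vs ! j = v j" if "j \<le> Suc (depth E)" for j
      using that by (simp del: upt_Suc)
    show "yoneda_morphism \<C> (depth E) c a (arrows E) (arrows E')"
      unfolding yoneda_morphism_def
    proof (intro conjI exI[of _ ?vs] allI impI)
      show "yoneda_extension \<C> (depth E) c a (arrows E)" "yoneda_extension \<C> (depth E) c a (arrows E')"
        using yoneda_extension_arrows assms by metis+
      show "length ?vs = depth E + 2" by simp
      show "?vs ! 0 = ide a" "?vs ! (depth E + 1) = ide c"
        using nth[of 0] nth[of "Suc (depth E)"] v by (simp_all del: upt_Suc)
      fix j assume j: "j \<le> depth E"
      show "?vs ! j \<in> Hom \<C> (src (arrows E ! j)) (src (arrows E' ! j))"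
        "?vs ! (j+1) \<cdot> arrows E ! j = arrows E' ! j \<cdot> ?vs ! j"
        using nth[of j] nth[of "Suc j"] v(3)[OF j] j by (simp_all del: upt_Suc)
    qed
  }
qed

text \<open>
  The cuts of a sequence are unique up to isomorphism only; two of them are related by the
  identity morphism of the sequence.
\<close>

lemma mor_idm_same_arrows:
  assumes "valid E c a" "valid E' c a" "id_based E" "id_based E'" "depth E' = depth E" "arrows E' = arrows E"
  shows "mor E E' (ide c)"
proof -
  have y: "yoneda_extension \<C> (depth E) c a (arrows E)" using yoneda_extension_arrows assms by blast
  have c: "c \<in> Ob \<C>" using valid_ses[OF assms(1)] ses_arr by auto
  define v where "v = (\<lambda>j. if j \<le> depth E then ide (src (arrows E ! j)) else ide c)"
  have arr: "arr (arrows E ! j)" if "j \<le> depth E" for j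
  proof (cases "j = depth E")
    case True
    then show ?thesis using y epi_arr by (auto simp: yoneda_extension_def)
  next
    case False
    then have "exact_pair \<C> (arrows E ! j) (arrows E ! (j+1))" using y that by (auto simp: yoneda_extension_def)
    then show ?thesis by (auto simp: exact_pair_def is_image_def is_cokernel_def)
  qed
  have cod: "v (Suc j) = ide (tgt (arrows E ! j))" if j: "j \<le> depth E" for j
  proof (cases "j = depth E")
    case True
    then show ?thesis using y by (auto simp: yoneda_extension_def v_def)
  next
    case False
    then have "exact_pair \<C> (arrows E ! j) (arrows E ! (j+1))" using y that by (auto simp: yoneda_extension_def)
    then have "tgt (arrows E ! j) = src (arrows E ! (j+1))"
      unfolding exact_pair_def is_image_def using kernel_arr(3) cokernel_arr(3) by metis
    then show ?thesis using j False by (simp add: v_def)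
  qed
  have "mor E E' (v (Suc (depth E)))"
  proof (rule mor_of_ladder[OF assms(1-5), where v = v])
    show "v 0 = ide a" using y by (simp add: v_def yoneda_extension_def)
    show "v (Suc (depth E)) \<in> Hom \<C> c c" using idm_in_Hom c by (simp add: v_def)
    fix j assume j: "j \<le> depth E"
    then show "v j \<in> Hom \<C> (src (arrows E ! j)) (src (arrows E' ! j)) \<and>
        v (Suc j) \<cdot> arrows E ! j = arrows E' ! j \<cdot> v j"
      unfolding cod[OF j] assms(6) using arr[OF j] by (simp add: v_def Hom_iff)
  qed
  then show ?thesis by (simp add: v_def)
qed

section \<open>Vanishing of Ext\<close>

primrec retracts :: "'m yext \<Rightarrow> bool" where
  "retracts (Base r m e) \<longleftrightarrow> (\<exists>\<rho> \<in> Hom \<C> (tgt m) (src m). \<rho> \<cdot> m = ide (src m))"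
| "retracts (Splice E m e) \<longleftrightarrow> retracts E"

lemma ses_biprod:
  assumes b: "biprod a a' b i i' p p'" shows "ses i p'"
proof -
  note B = biprod_arr[OF b]
  have mono: "is_mono \<C> i"
  proof (rule monoI[OF B(4)])
    fix s assume s: "arr s" "tgt s = src i" "i \<cdot> s = zero (src s) (tgt i)"
    have "s = p \<cdot> (i \<cdot> s)" by (rule biprod_reduce(1)[OF b, symmetric]) (use s(1,2) B(5) in simp_all)
    also have "\<dots> = zero (src s) (src i)" unfolding s(3) using s(1) B by simp
    finally show "s = zero (src s) (src i)" .
  qed
  have "is_kernel \<C> i p'"
  proof (rule kernelI[OF mono])
    fix h assume h: "arr h" "tgt h = src p'" "p' \<cdot> h = zero (src h) (tgt p')"
    have hb: "tgt h = b" using h B by simp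
    have "i \<cdot> (p \<cdot> h) \<boxplus> i' \<cdot> (p' \<cdot> h) = h" using biprod_reduce(5)[OF b h(1) hb] .
    then have "i \<cdot> (p \<cdot> h) = h" unfolding h(3) using h(1,2) B by simp
    then show "\<exists>u. arr u \<and> src u = src h \<and> tgt u = src i \<and> i \<cdot> u = h"
      using h(1,2) B by (intro exI[of _ "p \<cdot> h"]) simp
  qed (use B in simp_all)
  moreover have "epi p'" by (rule split_epi[of p' i']) (use B in simp_all)
  ultimately show ?thesis by (simp add: ses_def)
qed

lemma ses_zero_idm:
  assumes z: "is_zero_object \<C> z" and x: "x \<in> Ob \<C>"
  shows "ses (zero z x) (ide x)"
proof -
  have zO: "z \<in> Ob \<C>" using z by (simp add: is_zero_object_def)
  have uniq: "s = zero (src s) z" if "arr s" "tgt s = z" for s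
  proof -
    have "s \<in> Hom \<C> (src s) z" "zero (src s) z \<in> Hom \<C> (src s) z" using that zO by (simp_all add: Hom_iff)
    moreover have "\<exists>!f. f \<in> Hom \<C> (src s) z" using z that by (simp add: is_zero_object_def)
    ultimately show ?thesis by blast
  qed
  have m: "is_mono \<C> (zero z x)"
    by (rule monoI) (use uniq zO x in auto)
  have "is_kernel \<C> (zero z x) (ide x)"
  proof (rule kernelI[OF m])
    fix h assume h: "arr h" "tgt h = src (ide x)" "ide x \<cdot> h = zero (src h) (tgt (ide x))"
    then have "h = zero (src h) x" using x by simp
    then show "\<exists>u. arr u \<and> src u = src h \<and> tgt u = src (zero z x) \<and> zero z x \<cdot> u = h"
      using h x zO by (intro exI[of _ "zero (src h) z"]) simp
  qed (use x zO in simp_all)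
  then show ?thesis using idm_epi x by (simp add: ses_def)
qed

text \<open>
  The trivial extension is split in degree one and, above that, the trivial extension of the zero
  object spliced with \<open>0 \<rightarrow> x \<rightarrow> x\<close>. An extension whose leftmost arrow has a retraction maps to it over any
  \<open>\<phi>\<close>: use the retraction at the left end, \<open>\<phi>\<close> at the right end and zero in between.
\<close>

lemma trivial_extension:
  assumes "a \<in> Ob \<C>" "x \<in> Ob \<C>" "i \<ge> 1"
  shows "\<exists>E. valid E x a \<and> id_based E \<and> depth E = i \<and> kill E (ide x) \<and>
    (\<forall>G t \<phi>. valid G t a \<longrightarrow> id_based G \<longrightarrow> retracts G \<longrightarrow> depth G = i \<longrightarrow> \<phi> \<in> Hom \<C> t x \<longrightarrow> mor G E \<phi>)"
  using assms(3,2)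
proof (induction i arbitrary: x rule: nat_induct_at_least)
  case base
  obtain b i i' p p' where b: "biprod a x b i i' p p'" using biprod_exists assms(1) base by blast
  note B = biprod_arr[OF b]
  let ?E = "Base (ide a) i p'"
  have v: "valid ?E x a" using ses_biprod[OF b] B by (simp add: Hom_iff)
  have "kill ?E (last_epi ?E \<cdot> i')" by (rule kill_lift[OF v]) (use B in simp_all)
  then have k: "kill ?E (ide x)" using B by (simp del: kill.simps)
  have "mor G ?E \<phi>" if G: "valid G t a" "id_based G" "retracts G" "depth G = 1" and \<phi>: "\<phi> \<in> Hom \<C> t x" for G t \<phi>
  proof -
    obtain r m e where E: "G = Base r m e" using depth_oneE[OF G(4)] by blast
    have me: "ses m e" "tgt e = t" "src m = a" "r = ide a"
      using valid_Base_id[OF G(1,2)[unfolded E]] by blast+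
    note M = ses_arr[OF me(1)]
    obtain \<rho> where \<rho>: "arr \<rho>" "src \<rho> = src e" "tgt \<rho> = a" "\<rho> \<cdot> m = ide a"
      using G(3) E me M by (auto simp: Hom_iff)
    have p: "arr \<phi>" "src \<phi> = t" "tgt \<phi> = x" using \<phi> by (auto simp: Hom_iff)
    define v where "v = i \<cdot> \<rho> \<boxplus> i' \<cdot> (\<phi> \<cdot> e)"
    have v: "arr v" "src v = src e" "tgt v = b" unfolding v_def using \<rho>(1-3) B(1-15) p M me by simp_all
    have pv: "p' \<cdot> v = \<phi> \<cdot> e" 
      unfolding v_def using \<rho>(1-3) B p M(1-3) me biprod_reduce[OF b] by simp
    have vm: "v \<cdot> m = i"
      unfolding v_def using \<rho> B(1-15) p M me by simp
    have s: "square m (ide a) v i" "square e v \<phi> p'"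
      unfolding square_def using v pv vm p B M me assms(1) by simp_all
    show ?thesis unfolding E me(4) by (rule mor_BaseI[OF s]) (use assms(1) in simp)
  qed
  then show ?case using v k B(5) by (intro exI[of _ ?E]) (simp del: kill.simps)
next
  case (Suc i)
  obtain z where z: "is_zero_object \<C> z" using has_zero_object by blast
  have zO: "z \<in> Ob \<C>" using z by (simp add: is_zero_object_def)
  obtain E where E: "valid E z a" "id_based E" "depth E = i" 
    "\<And>G t \<phi>. valid G t a \<Longrightarrow> id_based G \<Longrightarrow> retracts G \<Longrightarrow> depth G = i \<Longrightarrow> \<phi> \<in> Hom \<C> t z \<Longrightarrow> mor G E \<phi>"
    using Suc.IH[OF zO] by blast
  let ?E = "Splice E (zero z x) (ide x)"
  have v: "valid ?E x a" using E ses_zero_idm[OF z Suc.prems] Suc.prems zO by simp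
  have "kill ?E (last_epi ?E \<cdot> ide x)" by (rule kill_lift[OF v]) (use Suc.prems in simp_all)
  then have k: "kill ?E (ide x)" using Suc.prems by (simp del: kill.simps)
  have "mor G ?E \<phi>" if G: "valid G t a" "id_based G" "retracts G" "depth G = Suc i" and \<phi>: "\<phi> \<in> Hom \<C> t x" for G t \<phi>
  proof -
    obtain F m e where F: "G = Splice F m e" using G(4) Suc.hyps by (cases G) auto
    have me: "ses m e" "tgt e = t" and vF: "valid F (src m) a" "id_based F" "retracts F" "depth F = i" using G F by auto
    note M = ses_arr[OF me(1)]
    have p: "arr \<phi>" "src \<phi> = t" "tgt \<phi> = x" using \<phi> by (auto simp: Hom_iff)
    have "mor F E (zero (src m) z)" by (rule E(4)[OF vF]) (use M zO in \<open>simp add: Hom_iff\<close>)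
    moreover have "\<phi> \<cdot> e \<cdot> m = zero (src m) x" using p me M by simp
    then have "square m (zero (src m) z) (\<phi> \<cdot> e) (zero z x)" "square e (\<phi> \<cdot> e) \<phi> (ide x)"
      unfolding square_def using p M me zO Suc.prems by simp_all
    ultimately show ?thesis using F by auto
  qed
  then show ?case using v k E by (intro exI[of _ ?E]) (simp del: kill.simps)
qed

text \<open>
  The covers which witness that \<open>t\<close> kills \<open>E\<close> splice to an extension \<open>G\<close> over \<open>t\<close>, except in degree
  one, where the extension of \<open>r \<cdot> w\<close> corrects the lift to a lift of \<open>t\<close> itself and \<open>G\<close> may be taken split.
\<close>

lemma kill_retract:
  assumes "valid E c a" "id_based E" "kill E t" "arr t" "tgt t = c"
  shows "\<exists>G. valid G (src t) a \<and> id_based G \<and> depth G = depth E \<and> retracts G \<and> mor G E t"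
  using assms
proof (induction E arbitrary: c t)
  case (Base r m e)
  have me: "ses m e" "src m = a" "tgt e = c" "r = ide a"
    using valid_Base_id[OF Base.prems(1,2)] by blast+
  note M = ses_arr[OF me(1)]
  obtain k q y w where c: "cover m e t k q y w" and x: "extends_along k (r \<cdot> w)" using Base.prems(3) by auto
  have S: "ses k q" "square k w y m" "square q y t e" using c by (auto simp: cover_def)
  note K = ses_arr[OF S(1)] and W = squareD[OF S(2)] and Y = squareD[OF S(3)]
  have aO: "a \<in> Ob \<C>" "c \<in> Ob \<C>" using M me by auto
  have "r \<cdot> w = w" using me W aO by simp
  then have "extends_along k w" using x by simp
  then obtain \<alpha> where \<alpha>: "\<alpha> \<in> Hom \<C> (tgt k) (tgt w)" "w = \<alpha> \<cdot> k"
    unfolding extends_along_def by blast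
  have \<alpha>: "arr \<alpha>" "src \<alpha> = tgt k" "tgt \<alpha> = a" "w = \<alpha> \<cdot> k"
    using \<alpha> unfolding Hom_iff W(6) me(2) by blast+
  define y' where "y' = y \<boxplus> neg (m \<cdot> \<alpha>)"
  have y': "arr y'" "src y' = src q" "tgt y' = src e"
    unfolding y'_def using \<alpha>(1-3) Y M me K by simp_all
  have "y \<cdot> k = (m \<cdot> \<alpha>) \<cdot> k" using W(9) unfolding \<alpha>(4) using \<alpha>(1-3) M(1) me K by simp
  moreover have "y' \<cdot> k = y \<cdot> k \<boxplus> neg ((m \<cdot> \<alpha>) \<cdot> k)" unfolding y'_def
    by (subst add_comp') (use \<alpha>(1-3) Y M me K in simp_all)
  ultimately have "y' \<cdot> k = zero (src k) (tgt y')" using \<alpha>(1-3) M me K y' Y by simp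
  then obtain s where s: "arr s" "src s = tgt q" "tgt s = tgt y'" "s \<cdot> q = y'"
    by (rule ses_desc[OF S(1) y'(1,2)])
  have em: "e \<cdot> (m \<cdot> \<alpha>) = zero (src q) (tgt e)"
    using comp_cancel[OF M(4), of \<alpha>] \<alpha>(1-3) M(1-3) me K(3) aO by simp
  have "e \<cdot> y' = e \<cdot> y \<boxplus> neg (e \<cdot> (m \<cdot> \<alpha>))" unfolding y'_def using \<alpha>(1-3) Y(1-8) M(1-3) me K(1-3) by simp
  also have "\<dots> = t \<cdot> q" unfolding em Y(9) using Y(1-8) M(1-3) me K(1-3) aO by simp
  finally have ey: "e \<cdot> y' = t \<cdot> q" .
  have "(e \<cdot> s) \<cdot> q = e \<cdot> (s \<cdot> q)" by (rule comp_assoc') (use s y' M K in simp_all)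
  then have eq: "(e \<cdot> s) \<cdot> q = t \<cdot> q" using s(4) ey by simp
  have es: "e \<cdot> s = t"
    by (rule epi_cancel[OF K(6) _ _ _ _ eq]) (use s(1-3) y' M Y in simp_all)
  obtain b i i' p p' where b: "biprod a (src t) b i i' p p'" by (rule biprod_exists[OF aO(1), of "src t"]) (use Y in auto)
  note B = biprod_arr[OF b]
  let ?G = "Base (ide a) i p'"
  have v: "valid ?G (src t) a" using ses_biprod[OF b] B by (simp add: Hom_iff)
  define v where "v = m \<cdot> p \<boxplus> s \<cdot> p'"
  have sd: "src s = src t" "tgt s = src e" using s y' Y by simp_all
  have vt: "arr v" "src v = b" "tgt v = src e" unfolding v_def using s(1) sd B(1-15) M me by simp_all
  have vi: "v \<cdot> i = m" unfolding v_def using s(1) sd B M me by simp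
  have "e \<cdot> v = e \<cdot> (m \<cdot> p) \<boxplus> e \<cdot> (s \<cdot> p')" unfolding v_def by (rule comp_add') (use s(1) sd B(1-15) M me in simp_all)
  also have "e \<cdot> (m \<cdot> p) = zero b c" using comp_cancel[OF M(4), of p] M me B(10-12) aO by simp
  also have "e \<cdot> (s \<cdot> p') = t \<cdot> p'" by (rule comp_cancel[OF es]) (use s(1) sd B(13-15) M in simp_all)
  finally have ev: "e \<cdot> v = t \<cdot> p'" using Base.prems(4,5) B(13-15) by simp
  have sq: "square i (ide a) v m" "square p' v t e"
    unfolding square_def using vt vi ev Base.prems(4,5) B(1-15) M me aO by simp_all
  have "r \<cdot> ide a = ide a" using me aO by simp
  then have "mor ?G (Base r m e) t" by (rule mor_BaseI[OF sq])
  moreover have "retracts ?G" using B by (auto simp: Hom_iff)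
  ultimately show ?case using v B(5) by (intro exI[of _ ?G]) (simp del: mor.simps)
next
  case (Splice E m e)
  obtain k q y w where c: "cover m e t k q y w" and kw: "kill E w" using Splice.prems(3) by auto
  have S: "ses k q" "square k w y m" "square q y t e" using c by (auto simp: cover_def)
  note K = ses_arr[OF S(1)] and W = squareD[OF S(2)] and Y = squareD[OF S(3)]
  obtain G where G: "valid G (src w) a" "id_based G" "depth G = depth E" "retracts G" "mor G E w"
    using Splice.IH[of "src m" w] Splice.prems kw W by auto
  have "valid (Splice G k q) (src t) a" using G S W Y by simp
  moreover have "mor (Splice G k q) (Splice E m e) t" using G S by auto
  ultimately show ?case using G by (intro exI[of _ "Splice G k q"]) simp
qed

text \<open>
  Forming the pushout that the base only represents.
\<close>

lemma normalize_base:
  assumes "valid E c a"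
  shows "\<exists>E'. valid E' c a \<and> id_based E' \<and> depth E' = depth E \<and> mor E E' (ide c)"
  using assms
proof (induction E arbitrary: c)
  case (Base r m e)
  then have me: "ses m e" "tgt e = c" and r: "arr r" "src r = src m" "tgt r = a" by (auto simp: Hom_iff)
  note M = ses_arr[OF me(1)]
  obtain f g v where P: "ses f g" "src f = tgt r" "tgt g = tgt e"
    "arr v" "src v = tgt m" "tgt v = tgt f" "v \<cdot> m = f \<cdot> r" "g \<cdot> v = e"
    using pushout_ses[OF me(1) r(1,2)] by blast
  note F = ses_arr[OF P(1)]
  have aO: "a \<in> Ob \<C>" "c \<in> Ob \<C>" using r me M by auto
  have sq: "square m r v f" "square e v (ide c) g"
    unfolding square_def using P F M r me aO by simp_all
  have "ide a \<cdot> r = r" using r aO by simp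
  then have "mor (Base r m e) (Base (ide a) f g) (ide c)" by (rule mor_BaseI[OF sq])
  moreover have "valid (Base (ide a) f g) c a" using P r me aO by (simp add: Hom_iff)
  ultimately show ?case using P r by (intro exI[of _ "Base (ide a) f g"]) (simp del: mor.simps)
next
  case (Splice E m e)
  then have me: "ses m e" "tgt e = c" and v: "valid E (src m) a" by auto
  note M = ses_arr[OF me(1)]
  obtain E' where E': "valid E' (src m) a" "id_based E'" "depth E' = depth E" "mor E E' (ide (src m))"
    using Splice.IH[OF v] by blast
  have "square m (ide (src m)) (ide (tgt m)) m" "square e (ide (tgt m)) (ide c) e"
    unfolding square_def using M me by auto
  then show ?case using E' me by (intro exI[of _ "Splice E' m e"]) auto
qed

text \<open>
  Allowing arbitrary arrows in the base makes pushed out extensions and obstructions available as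
  instances; extensions with an identity in the base determine the notion by \<open>Ext_killed_iff_id_based\<close>.
\<close>

definition Ext_killed :: "nat \<Rightarrow> 'o \<Rightarrow> 'o \<Rightarrow> bool" where
  "Ext_killed i x a \<longleftrightarrow> (\<forall>E. valid E x a \<and> depth E = i \<longrightarrow> kill E (ide x))"

lemma Ext_killed_iff_id_based:
  "Ext_killed i x a \<longleftrightarrow> (\<forall>E. valid E x a \<and> id_based E \<and> depth E = i \<longrightarrow> kill E (ide x))"
proof
  assume R: "\<forall>E. valid E x a \<and> id_based E \<and> depth E = i \<longrightarrow> kill E (ide x)"
  show "Ext_killed i x a" unfolding Ext_killed_def
  proof (intro allI impI)
    fix E assume E: "valid E x a \<and> depth E = i"
    then obtain E' where E': "valid E' x a" "id_based E'" "depth E' = depth E" "mor E E' (ide x)"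
      using normalize_base by blast
    have x: "x \<in> Ob \<C>" using E valid_ses ses_arr by (metis Cod_in_Ob)
    have "kill E' (ide x \<cdot> ide x)" using R E E' x by simp
    then show "kill E (ide x)" using kill_mor[of E x a E' x "ide x" "ide x"] E E' x by simp
  qed
qed (auto simp: Ext_killed_def)

text \<open>
  The trivial extension is killed by the identity, so if there is one class only, the same holds for
  all extensions. Conversely, an extension \<open>E\<close> killed by the identity is joined to the trivial
  one by \<open>E \<leftarrow> G \<rightarrow> T\<close>, where \<open>G\<close> comes from \<open>kill_retract\<close>.
\<close>

lemma Ext_vanishes_iff:
  assumes i: "i \<ge> 1" and x: "x \<in> Ob \<C>" and a: "a \<in> Ob \<C>"
  shows "Ext_vanishes \<C> i x a \<longleftrightarrow> Ext_killed i x a"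
proof -
  define A where "A = {fs. yoneda_extension \<C> i x a fs}"
  define R where "R = {(fs, fs'). equivclp (yoneda_morphism \<C> i x a) fs fs'}"
  have vanish: "Ext_vanishes \<C> i x a \<longleftrightarrow> is_singleton (A // R)"
    by (simp add: Ext_vanishes_def Ext_def A_def R_def)
  obtain T where T: "valid T x a" "id_based T" "depth T = i" "kill T (ide x)"
    and T': "\<And>G \<phi>. valid G x a \<Longrightarrow> id_based G \<Longrightarrow> retracts G \<Longrightarrow> depth G = i \<Longrightarrow> \<phi> \<in> Hom \<C> x x \<Longrightarrow> mor G T \<phi>"
    using trivial_extension[OF a x i] by blast
  have TA: "arrows T \<in> A" using yoneda_extension_arrows[OF T(1,2)] T(3) by (simp add: A_def)
  have refl: "(fs, fs) \<in> R" for fs by (simp add: R_def)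
  have eq_iff: "R `` {fs} = R `` {fs'} \<longleftrightarrow> (fs, fs') \<in> R" for fs fs'
  proof
    assume "R `` {fs} = R `` {fs'}"
    then have "fs' \<in> R `` {fs}" using refl[of fs'] by blast
    then show "(fs, fs') \<in> R" by blast
  next
    assume "(fs, fs') \<in> R"
    then have e: "equivclp (yoneda_morphism \<C> i x a) fs fs'" by (simp add: R_def)
    have "equivclp (yoneda_morphism \<C> i x a) fs gs \<longleftrightarrow> equivclp (yoneda_morphism \<C> i x a) fs' gs" for gs
      using equivclp_trans[OF e, of gs] equivclp_trans[OF equivclp_sym[OF e], of gs] by blast
    then show "R `` {fs} = R `` {fs'}" by (auto simp: R_def)
  qed
  have "is_singleton (A // R) \<longleftrightarrow> (\<forall>fs \<in> A. (arrows T, fs) \<in> R)"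
  proof
    assume "is_singleton (A // R)"
    then obtain S where S: "A // R = {S}" by (auto simp: is_singleton_def)
    have "R `` {fs} = S" if "fs \<in> A" for fs using quotientI[OF that, of R] S by simp
    then show "\<forall>fs \<in> A. (arrows T, fs) \<in> R" using TA eq_iff by metis
  next
    assume "\<forall>fs \<in> A. (arrows T, fs) \<in> R"
    then have "\<forall>fs \<in> A. R `` {fs} = R `` {arrows T}" using eq_iff by metis
    then have "S = R `` {arrows T}" if "S \<in> A // R" for S using that by (metis quotientE)
    then have "A // R = {R `` {arrows T}}" using quotientI[OF TA, of R] by blast
    then show "is_singleton (A // R)" by (simp add: is_singleton_def)
  qed
  also have "\<dots> \<longleftrightarrow> Ext_killed i x a" unfolding Ext_killed_iff_id_based
  proof (intro iffI allI impI ballI)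
    \<comment> \<open>Being killed by the identity is invariant along zigzags of morphisms.\<close>
    define P where "P = (\<lambda>fs. \<exists>E. valid E x a \<and> id_based E \<and> depth E = i \<and> arrows E = fs \<and> kill E (ide x))"
    have step: "P fs \<longleftrightarrow> P fs'" if m: "yoneda_morphism \<C> i x a fs fs'" for fs fs'
    proof -
      have "yoneda_extension \<C> i x a fs" "yoneda_extension \<C> i x a fs'" using m by (auto simp: yoneda_morphism_def)
      then obtain E0 E0' where E0: "valid E0 x a" "id_based E0" "depth E0 = i" "arrows E0 = fs"
        "valid E0' x a" "id_based E0'" "depth E0' = i" "arrows E0' = fs'"
        using arrows_of_yoneda_extension i by metis
      have mv: "mor E E' (ide x)" if "valid E x a" "id_based E" "depth E = i" "arrows E = fs"
         "valid E' x a" "id_based E'" "depth E' = i" "arrows E' = fs'" for E E'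
        using yoneda_morphism_iff_mor[of E x a E'] m that by simp
      show ?thesis
      proof
        assume "P fs"
        then obtain E where E: "valid E x a" "id_based E" "depth E = i" "arrows E = fs" "kill E (ide x)" 
          by (auto simp: P_def)
        have "mor E E0' (ide x)" using mv E E0 by simp
        then have "kill E0' (ide x \<cdot> ide x)" using mor_kill[OF E(1) E0(5)] E by blast
        then show "P fs'" unfolding P_def using E0 x by auto
      next
        assume "P fs'"
        then obtain E where E: "valid E x a" "id_based E" "depth E = i" "arrows E = fs'" "kill E (ide x)" 
          by (auto simp: P_def)
        have "mor E0 E (ide x)" using mv E E0 by simp
        then have "kill E0 (ide x)" using kill_mor[OF E0(1) E(1), of "ide x" "ide x"] E x by simp
        then show "P fs" unfolding P_def using E0 by auto
      qed
    qed
    fix E assume R: "\<forall>fs \<in> A. (arrows T, fs) \<in> R" and E: "valid E x a \<and> id_based E \<and> depth E = i"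
    have "arrows E \<in> A" using yoneda_extension_arrows[of E x a] E by (auto simp: A_def)
    then have "equivclp (yoneda_morphism \<C> i x a) (arrows T) (arrows E)" using R by (auto simp: R_def)
    then have "P (arrows E)"
    proof (induction rule: equivclp_induct)
      case base
      then show ?case unfolding P_def using T by blast
    next
      case (step y z)
      then show ?case using \<open>\<And>fs' fs. yoneda_morphism \<C> i x a fs fs' \<Longrightarrow> P fs \<longleftrightarrow> P fs'\<close> by blast
    qed
    then obtain E' where E': "valid E' x a" "id_based E'" "depth E' = i" "arrows E' = arrows E" "kill E' (ide x)"
      by (auto simp: P_def)
    have "mor E' E (ide x)" using mor_idm_same_arrows[of E' x a E] E E' by simp
    then show "kill E (ide x)" using mor_kill[OF E'(1), of E x a "ide x" "ide x"] E E' x by simp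
  next
    fix fs assume K: "\<forall>E. valid E x a \<and> id_based E \<and> depth E = i \<longrightarrow> kill E (ide x)" and fs: "fs \<in> A"
    obtain E where E: "valid E x a" "id_based E" "depth E = i" "arrows E = fs"
      using arrows_of_yoneda_extension[of i x a fs] fs i by (auto simp: A_def)
    obtain G where G: "valid G x a" "id_based G" "depth G = i" "retracts G" "mor G E (ide x)"
      using kill_retract[OF E(1,2), of "ide x"] K E x by auto
    have "yoneda_morphism \<C> i x a (arrows G) fs"
      using yoneda_morphism_iff_mor[of G x a E] G E by simp
    moreover have "mor G T (ide x)" using T' G x idm_in_Hom by blast
    then have "yoneda_morphism \<C> i x a (arrows G) (arrows T)"
      using yoneda_morphism_iff_mor[of G x a T] G T by simp
    ultimately have "equivclp (yoneda_morphism \<C> i x a) (arrows T) fs"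
      by (meson equivclp_sym equivclp_trans r_into_equivclp)
    then show "(arrows T, fs) \<in> R" by (simp add: R_def)
  qed
  finally show ?thesis using vanish by simp
qed

end

context abelian_category begin

section \<open>The relative structure\<close>

text \<open>
  In this description the objects of \<open>\<X>\<close> are visibly projective; the comparison with the definition by pullbacks is
  \<open>rel_conflation_iff\<close>.
\<close>

definition conf :: "'o set \<Rightarrow> 'm \<Rightarrow> 'm \<Rightarrow> bool" where
  "conf \<X> f g \<longleftrightarrow> ses f g \<and>
     (\<forall>x \<in> Arr \<C>. src x \<in> \<X> \<and> tgt x = tgt g \<longrightarrow>
        (\<exists>l \<in> Arr \<C>. src l = src x \<and> tgt l = src g \<and> g \<cdot> l = x))"

text \<open>
  The pullback is the kernel of \<open>x \<cdot> p\<^sub>1 - g \<cdot> p\<^sub>2\<close> on the direct sum, and a lift \<open>l\<close> of \<open>x\<close> provides the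
  section induced by the identity and \<open>l\<close>.
\<close>

lemma pullback_extension_split:
  assumes fg: "ses f g" and x: "arr x" "tgt x = tgt g"
    and l: "arr l" "src l = src x" "tgt l = src g" "g \<cdot> l = x"
  shows "\<exists>f' p. pullback_extension \<C> f g x f' p \<and> split_short_exact \<C> f' p"
proof -
  note F = ses_arr[OF fg]
  obtain b i i' p1 p2 where b: "biprod (src x) (src g) b i i' p1 p2"
    by (rule biprod_exists[of "src x" "src g"]) (use x F in auto)
  note B = biprod_arr[OF b] and R = biprod_reduce[OF b]
  define d where "d = x \<cdot> p1 \<boxplus> neg (g \<cdot> p2)"
  have d: "arr d" "src d = b" "tgt d = tgt g"
    unfolding d_def using B(1-15) x F by simp_all
  obtain k where k: "is_kernel \<C> k d" using has_kernels d by blast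
  note K = kernel_arr[OF k]
  define p where "p = p1 \<cdot> k"
  define q where "q = p2 \<cdot> k"
  have p: "arr p" "src p = src k" "tgt p = src x"
    and q: "arr q" "src q = src k" "tgt q = src g"
    unfolding p_def q_def using B(1-15) K d by simp_all
  have dh: "d \<cdot> h = x \<cdot> (p1 \<cdot> h) \<boxplus> neg (g \<cdot> (p2 \<cdot> h))" if "arr h" "tgt h = b" for h
    unfolding d_def using that B(1-15) x F(1-3) by simp
  have "x \<cdot> p \<boxplus> neg (g \<cdot> q) = zero (src k) (tgt g)"
    using dh[of k] K d unfolding p_def q_def by simp
  then have comm: "x \<cdot> p = g \<cdot> q" using diff_eq_zero_iff[of "x \<cdot> p" "g \<cdot> q"] p q x F by simp
  have ex: "\<exists>w. arr w \<and> src w = src u \<and> tgt w = src k \<and> p \<cdot> w = u \<and> q \<cdot> w = v"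
    if u: "arr u" "tgt u = src x" and v: "arr v" "src v = src u" "tgt v = src g"
      and eq: "x \<cdot> u = g \<cdot> v" for u v
  proof -
    define h where "h = i \<cdot> u \<boxplus> i' \<cdot> v"
    have h: "arr h" "src h = src u" "tgt h = b" unfolding h_def using B(1-15) u v by simp_all
    have ph: "p1 \<cdot> h = u" "p2 \<cdot> h = v" unfolding h_def using B(1-15) R u v by simp_all
    have "d \<cdot> h = zero (src h) (tgt d)" using dh[OF h(1,3)] ph eq u v h F d by simp
    then obtain w where w: "arr w" "src w = src h" "tgt w = src k" "k \<cdot> w = h"
      by (rule kernel_lift[OF k h(1), rotated 1]) (use h d in simp_all)
    have "p \<cdot> w = u" "q \<cdot> w = v" unfolding p_def q_def using ph w B(10-15) K d by simp_all
    then show ?thesis using w(1,3) w(2)[unfolded h(2)] by (intro exI[of _ w]) simp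
  qed
  have uniq: "w = w'" if w: "arr w" "tgt w = src k" and w': "arr w'" "tgt w' = src k"
     and dw: "src w' = src w" and eq: "p \<cdot> w = p \<cdot> w'" "q \<cdot> w = q \<cdot> w'" for w w'
  proof -
    have e1: "p1 \<cdot> (k \<cdot> w) = p1 \<cdot> (k \<cdot> w')" using eq(1) unfolding p_def using w w' K(1-3) B(10-15) d by simp
    have e2: "p2 \<cdot> (k \<cdot> w) = p2 \<cdot> (k \<cdot> w')" using eq(2) unfolding q_def using w w' K(1-3) B(10-15) d by simp
    have "k \<cdot> w = i \<cdot> (p1 \<cdot> (k \<cdot> w)) \<boxplus> i' \<cdot> (p2 \<cdot> (k \<cdot> w))" by (rule R(5)[symmetric]) (use w K d in simp_all)
    also have "\<dots> = i \<cdot> (p1 \<cdot> (k \<cdot> w')) \<boxplus> i' \<cdot> (p2 \<cdot> (k \<cdot> w'))" unfolding e1 e2 ..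
    also have "\<dots> = k \<cdot> w'" by (rule R(5)) (use w' K d in simp_all)
    finally have "k \<cdot> w = k \<cdot> w'" .
    then show ?thesis using mono_cancel[OF kernel_mono[OF k]] w w' by blast
  qed
  have pb: "is_pullback \<C> p q x g"
    unfolding is_pullback_def
  proof (intro conjI allI ballI impI)
    fix t u v assume u: "u \<in> Hom \<C> t (src x)" and v: "v \<in> Hom \<C> t (src g)" and eq: "x \<cdot> u = g \<cdot> v"
    obtain w where w: "w \<in> Hom \<C> t (src p)" "p \<cdot> w = u" "q \<cdot> w = v"
      using ex[of u v] u v eq p by (auto simp: Hom_iff)
    show "\<exists>!w. w \<in> Hom \<C> t (src p) \<and> p \<cdot> w = u \<and> q \<cdot> w = v"
    proof (rule ex1I[of _ w])
      show "w \<in> Hom \<C> t (src p) \<and> p \<cdot> w = u \<and> q \<cdot> w = v" using w by blast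
      fix w' assume "w' \<in> Hom \<C> t (src p) \<and> p \<cdot> w' = u \<and> q \<cdot> w' = v"
      then show "w' = w" using uniq[of w' w] w p by (simp add: Hom_iff)
    qed
  qed (use x F p q comm in \<open>simp_all add: Hom_iff\<close>)
  have aO: "src f \<in> Ob \<C>" "src x \<in> Ob \<C>" using F x by simp_all
  obtain f' where f': "arr f'" "src f' = src f" "tgt f' = src k"
    "p \<cdot> f' = zero (src f) (src x)" "q \<cdot> f' = f"
    using ex[of "zero (src f) (src x)" f] F x aO by auto
  obtain s where s: "arr s" "src s = src x" "tgt s = src k" "p \<cdot> s = ide (src x)"
    using ex[of "ide (src x)" l] l x aO by auto
  have pe: "epi p" by (rule split_epi[of p s]) (use s p in simp_all)
  have mono: "is_mono \<C> f'"
  proof (rule monoI[OF f'(1)])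
    fix t assume t: "arr t" "tgt t = src f'" "f' \<cdot> t = zero (src t) (tgt f')"
    have "f \<cdot> t = q \<cdot> (f' \<cdot> t)" using comp_cancel[OF f'(5), of t] f'(1-3) t(1,2) q by simp
    then have "f \<cdot> t = zero (src t) (tgt f)" unfolding t(3) using t(1,2) q f'(1-3) F by simp
    then show "t = zero (src t) (src f')" using mono_zero[OF F(5), of t] t(1,2) f'(2) by simp
  qed
  have "is_kernel \<C> f' p"
  proof (rule kernelI[OF mono p(1)])
    fix h assume h: "arr h" "tgt h = src p" "p \<cdot> h = zero (src h) (tgt p)"
    have "g \<cdot> (q \<cdot> h) = (x \<cdot> p) \<cdot> h" by (rule comp_cancel[OF comm[symmetric]]) (use h(1,2) p q F in simp_all)
    also have "\<dots> = x \<cdot> (p \<cdot> h)" using h(1,2) p x by simp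
    also have "\<dots> = zero (src (q \<cdot> h)) (tgt g)" unfolding h(3) using h(1,2) p q x by simp
    finally obtain u where u: "arr u" "src u = src (q \<cdot> h)" "tgt u = src f" "f \<cdot> u = q \<cdot> h"
      by (rule ses_lift[OF fg, rotated 2]) (use h(1,2) p q in simp_all)
    have e1: "p \<cdot> (f' \<cdot> u) = p \<cdot> h"
      unfolding h(3) using comp_cancel[OF f'(4), of u] f'(1-3) u(1-3) p q h(1,2) aO by simp
    have e2: "q \<cdot> (f' \<cdot> u) = q \<cdot> h"
      using comp_cancel[OF f'(5), of u] f'(1-3) u p q h(1,2) by simp
    have "f' \<cdot> u = h" by (rule uniq[OF _ _ _ _ _ e1 e2]) (use f'(1-3) u(1-3) p q h(1,2) in simp_all)
    then show "\<exists>u. arr u \<and> src u = src h \<and> tgt u = src f' \<and> f' \<cdot> u = h"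
      using u(1-3) f'(2) q h(1,2) p by (intro exI[of _ u]) simp
  qed (use f' p in simp_all)
  then have "ses f' p" using pe by (simp add: ses_def)
  then have "split_short_exact \<C> f' p" unfolding split_short_exact_def short_exact_iff
    using s p by (auto simp: Hom_iff)
  moreover have "pullback_extension \<C> f g x f' p"
    unfolding pullback_extension_def using pb f' p by (auto simp: Hom_iff)
  ultimately show ?thesis by blast
qed

lemma rel_conflation_iff: "rel_conflation \<C> \<X> f g \<longleftrightarrow> conf \<X> f g"
proof
  assume r: "rel_conflation \<C> \<X> f g"
  then have fg: "ses f g" by (simp add: rel_conflation_def short_exact_iff)
  show "conf \<X> f g" unfolding conf_def
  proof (intro conjI ballI impI fg)
    fix x assume x: "arr x" "src x \<in> \<X> \<and> tgt x = tgt g"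
    then obtain f' p where p: "pullback_extension \<C> f g x f' p" and s: "split_short_exact \<C> f' p"
      using r unfolding rel_conflation_def by blast
    obtain q where "is_pullback \<C> p q x g" using p by (auto simp: pullback_extension_def)
    then have q: "arr p" "tgt p = src x" "arr q" "src q = src p" "tgt q = src g" "x \<cdot> p = g \<cdot> q"
      "arr g"
      by (auto simp: is_pullback_def Hom_iff)
    obtain s where s: "arr s" "src s = src x" "tgt s = src p" "p \<cdot> s = ide (src x)"
      using s q by (auto simp: split_short_exact_def Hom_iff)
    have "g \<cdot> (q \<cdot> s) = (x \<cdot> p) \<cdot> s" by (rule comp_cancel[OF q(6)[symmetric]]) (use q(1-5,7) s in simp_all)
    also have "\<dots> = x \<cdot> (p \<cdot> s)" using q(1,2) s x by simp
    finally have "g \<cdot> (q \<cdot> s) = x" unfolding s(4) using x by simp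
    then show "\<exists>l \<in> Arr \<C>. src l = src x \<and> tgt l = src g \<and> g \<cdot> l = x"
      using q(1-5) s by (intro bexI[of _ "q \<cdot> s"]) simp_all
  qed
next
  assume c: "conf \<X> f g"
  then have fg: "ses f g" by (simp add: conf_def)
  show "rel_conflation \<C> \<X> f g" unfolding rel_conflation_def short_exact_iff
  proof (intro conjI ballI impI fg)
    fix x assume x: "arr x" "src x \<in> \<X> \<and> tgt x = tgt g"
    then obtain l where "arr l" "src l = src x" "tgt l = src g" "g \<cdot> l = x"
      using c unfolding conf_def by blast
    then show "\<exists>f' p. pullback_extension \<C> f g x f' p \<and> split_short_exact \<C> f' p"
      using pullback_extension_split[OF fg x(1)] x(2) by blast
  qed
qed

lemma conf_ses: "conf \<X> f g \<Longrightarrow> ses f g"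
  by (simp add: conf_def)

lemma conf_lift:
  assumes "conf \<X> f g" "arr x" "src x \<in> \<X>" "tgt x = tgt g"
  obtains l where "arr l" "src l = src x" "tgt l = src g" "g \<cdot> l = x"
  using assms unfolding conf_def by blast

lemma conf_zero_idm:
  assumes "is_zero_object \<C> z" "x \<in> Ob \<C>"
  shows "conf \<X> (zero z x) (ide x)"
  unfolding conf_def using ses_zero_idm[OF assms] assms(2) by auto

section \<open>Closure properties of cluster tilting subcategories\<close>

definition Ext_orthogonal :: "'o set \<Rightarrow> nat \<Rightarrow> 'o \<Rightarrow> bool" where
  "Ext_orthogonal \<X> j c \<longleftrightarrow> (\<forall>x \<in> \<X>. \<forall>i. 1 \<le> i \<and> i \<le> j \<longrightarrow> Ext_killed i x c)"

lemma Ext_orthogonalD: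
  assumes "Ext_orthogonal \<X> j c" "x \<in> \<X>" "valid E x c" "depth E \<le> j"
  shows "kill E (ide x)"
  using assms depth_pos[of E] unfolding Ext_orthogonal_def Ext_killed_def by blast

lemma cluster_tilting_iff:
  assumes "n_cluster_tilting \<C> n \<X>"
  shows "c \<in> \<X> \<longleftrightarrow> c \<in> Ob \<C> \<and> Ext_orthogonal \<X> (n - 1) c"
proof -
  have sub: "\<X> \<subseteq> Ob \<C>" 
    and eq: "\<X> = {c \<in> Ob \<C>. \<forall>x \<in> \<X>. \<forall>i. 1 \<le> i \<and> i \<le> n - 1 \<longrightarrow> Ext_vanishes \<C> i x c}"
    using assms unfolding n_cluster_tilting_def by blast+
  have "c \<in> \<X> \<longleftrightarrow> c \<in> Ob \<C> \<and> (\<forall>x \<in> \<X>. \<forall>i. 1 \<le> i \<and> i \<le> n - 1 \<longrightarrow> Ext_vanishes \<C> i x c)"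
    by (subst eq) blast
  also have "\<dots> \<longleftrightarrow> c \<in> Ob \<C> \<and> Ext_orthogonal \<X> (n - 1) c"
    unfolding Ext_orthogonal_def using Ext_vanishes_iff sub by blast
  finally show ?thesis .
qed

text \<open>
  An epi from an object of \<open>\<X>\<close> onto \<open>c\<close> factors through the approximation, which is therefore epi.
\<close>

lemma approximation:
  assumes "n_cluster_tilting \<C> n \<X>" and c: "c \<in> Ob \<C>"
  obtains f g where "conf \<X> f g" "src g \<in> \<X>" "tgt g = c"
proof -
  have cf: "contravariantly_finite \<C> \<X>" and ge: "generating \<C> \<X>"
    using assms(1) unfolding n_cluster_tilting_def functorially_finite_def by blast+
  obtain x g where g: "x \<in> \<X>" "g \<in> Hom \<C> x c" "\<And>x' h. x' \<in> \<X> \<Longrightarrow> h \<in> Hom \<C> x' c \<Longrightarrow> \<exists>l \<in> Hom \<C> x' x. g \<cdot> l = h"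
    using bspec[OF cf[unfolded contravariantly_finite_def] c] by blast
  obtain x' e where e: "x' \<in> \<X>" "e \<in> Hom \<C> x' c" "epi e"
    using bspec[OF ge[unfolded generating_def] c] by blast
  obtain l where l: "l \<in> Hom \<C> x' x" "g \<cdot> l = e" using g(3) e by blast
  have ga: "arr g" "src g = x" "tgt g = c" and la: "arr l" "src l = x'" "tgt l = x"
    using g l by (auto simp: Hom_iff)
  have "epi g"
  proof (rule epiI[OF ga(1)])
    fix s assume s: "arr s" "src s = tgt g" "s \<cdot> g = zero (src g) (tgt s)"
    have "s \<cdot> e = zero (src e) (tgt s)"
      unfolding l(2)[symmetric] using comp_cancel[OF s(3), of l] s(1,2) ga la by simp
    then show "s = zero (tgt g) (tgt s)"
      using epi_zero[OF e(3), of s] s(1,2) e(2) ga by (simp add: Hom_iff)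
  qed
  then obtain f where f: "ses f g" using ses_of_epi by blast
  have "conf \<X> f g" unfolding conf_def
  proof (intro conjI ballI impI f)
    fix h assume h: "arr h" "src h \<in> \<X> \<and> tgt h = tgt g"
    then have "h \<in> Hom \<C> (src h) c" using ga by (simp add: Hom_iff)
    then obtain l where "l \<in> Hom \<C> (src h) x" "g \<cdot> l = h" using g(3) h by blast
    then show "\<exists>l \<in> Arr \<C>. src l = src h \<and> tgt l = src g \<and> g \<cdot> l = h"
      unfolding Hom_iff ga(2) by blast
  qed
  then show thesis using that ga g by blast
qed

text \<open>
  In degree one the obstruction is an arrow from \<open>x\<close>, which lifts because \<open>\<kappa>, \<pi>\<close> is a conflation; in higher
  degrees it is an extension of \<open>x\<close> by the codomain of \<open>\<pi>\<close>, of degree one less.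
\<close>

lemma syzygy_orthogonal:
  assumes ct: "n_cluster_tilting \<C> n \<X>" and c: "conf \<X> \<kappa> \<pi>" "src \<pi> \<in> \<X>"
    and o: "Ext_orthogonal \<X> j (tgt \<pi>)" and j: "j + 1 \<le> n - 1"
  shows "Ext_orthogonal \<X> (j + 1) (src \<kappa>)"
  unfolding Ext_orthogonal_def Ext_killed_def
proof (intro ballI allI impI)
  note cs = conf_ses[OF c(1)]
  note S = ses_arr[OF cs]
  fix x i E assume x: "x \<in> \<X>" and i: "1 \<le> i \<and> i \<le> j + 1" and E: "valid E x (src \<kappa>) \<and> depth E = i"
  have xO: "x \<in> Ob \<C>" using cluster_tilting_iff[OF ct] x by blast
  have "valid (push \<kappa> E) x (src \<pi>)" using push_valid[of E x "src \<kappa>" \<kappa>] E S by simp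
  moreover have "Ext_orthogonal \<X> (n - 1) (src \<pi>)" using cluster_tilting_iff[OF ct] c by blast
  ultimately have k: "kill (push \<kappa> E) (ide x)"
    using Ext_orthogonalD[of \<X> "n - 1" "src \<pi>" x "push \<kappa> E"] x i j E by simp
  show "kill E (ide x)"
  proof (cases E)
    case (Base r m e)
    obtain \<rho> where \<rho>: "arr \<rho>" "src \<rho> = src (ide x)" "tgt \<rho> = tgt \<pi>"
      "\<And>u b. arr u \<Longrightarrow> tgt u = src (ide x) \<Longrightarrow> arr b \<Longrightarrow> src b = src u \<Longrightarrow> tgt b = src \<pi> \<Longrightarrow>
         \<pi> \<cdot> b = \<rho> \<cdot> u \<Longrightarrow> kill E (ide x \<cdot> u)"
      using obstruction_Base[OF cs, of r m e x "ide x"] E k Base xO idm_arr[OF xO] by metis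
    obtain b where b: "arr b" "src b = src \<rho>" "tgt b = src \<pi>" "\<pi> \<cdot> b = \<rho>"
      by (rule conf_lift[OF c(1) \<rho>(1)]) (use \<rho>(2,3) x xO in simp_all)
    have "kill E (ide x \<cdot> ide x)" by (rule \<rho>(4)[of _ b]) (use b \<rho>(1-3) xO in simp_all)
    then show ?thesis using xO by simp
  next
    case (Splice E' m e)
    then obtain i' where i': "depth E = Suc (Suc i')" using depth_pos[of E'] by (cases "depth E'") auto
    have vE: "valid E x (src \<kappa>)" using E by blast
    obtain F where F: "valid F (src (ide x)) (tgt \<pi>)" "depth F = Suc i'"
      "\<And>u. arr u \<Longrightarrow> tgt u = src (ide x) \<Longrightarrow> kill F u \<Longrightarrow> kill E (ide x \<cdot> u)"
      using obstruction_Splice[OF cs vE i' k] xO idm_arr[OF xO] by metis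
    have "kill F (ide x)"
      by (rule Ext_orthogonalD[OF o x]) (use F(1,2) xO i E i' in simp_all)
    then have "kill E (ide x \<cdot> ide x)" using F(3)[of "ide x"] xO by simp
    then show ?thesis using xO by simp
  qed
qed

lemma cluster_tilting_biproduct:
  assumes ct: "n_cluster_tilting \<C> n \<X>" and b: "is_biproduct \<C> a a' b" and a: "a \<in> \<X>" "a' \<in> \<X>"
  shows "b \<in> \<X>"
proof -
  obtain i i' p p' where bp: "biprod a a' b i i' p p'" using b is_biproduct_iff by blast
  note B = biprod_arr[OF bp]
  have o: "Ext_orthogonal \<X> (n - 1) a" "Ext_orthogonal \<X> (n - 1) a'" using cluster_tilting_iff[OF ct] a by blast+
  have "Ext_orthogonal \<X> (n - 1) b" unfolding Ext_orthogonal_def Ext_killed_def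
  proof (intro ballI allI impI)
    fix x i E assume x: "x \<in> \<X>" and i: "1 \<le> i \<and> i \<le> n - 1" and E: "valid E x b \<and> depth E = i"
    have "valid (push p E) x a" "valid (push p' E) x a'"
      using push_valid[of E x b p] push_valid[of E x b p'] E B by simp_all
    then have "kill (push p E) (ide x)" "kill (push p' E) (ide x)"
      using Ext_orthogonalD[OF o(1) x, of "push p E"] Ext_orthogonalD[OF o(2) x, of "push p' E"] i E
      by simp_all
    then show "kill E (ide x)" using kill_biproduct[OF bp] E by blast
  qed
  then show ?thesis using cluster_tilting_iff[OF ct] B by blast
qed

lemma cluster_tilting_zero:
  assumes ct: "n_cluster_tilting \<C> n \<X>" and z: "is_zero_object \<C> z"
  shows "z \<in> \<X>"
proof (cases "n - 1")
  case 0
  then show ?thesis using cluster_tilting_iff[OF ct] z by (simp add: Ext_orthogonal_def is_zero_object_def)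
next
  case (Suc j)
  have zO: "z \<in> Ob \<C>" using z by (simp add: is_zero_object_def)
  obtain x where x: "x \<in> \<X>" using ct zO unfolding n_cluster_tilting_def generating_def by blast
  then have o: "x \<in> Ob \<C>" "Ext_orthogonal \<X> (n - 1) x" using cluster_tilting_iff[OF ct] by blast+
  \<comment> \<open>The zero object is the syzygy of the identity conflation on \<open>x\<close>.\<close>
  have "Ext_orthogonal \<X> (j + 1) (src (zero z x))"
    by (rule syzygy_orthogonal[OF ct conf_zero_idm[OF z o(1)]])
      (use x o Suc in \<open>auto simp: Ext_orthogonal_def\<close>)
  then show ?thesis using cluster_tilting_iff[OF ct] Suc zO o by simp
qed

section \<open>Relative resolutions\<close>
lemma rel_resolution_0: "rel_resolution \<C> \<X> 0 c X d \<longleftrightarrow> X 0 = c \<and> c \<in> \<X> \<and> d 0 = ide c"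
  unfolding rel_resolution_def by auto

lemma rel_resolution_Suc:
  assumes "conf \<X> f g" "src g \<in> \<X>" "rel_resolution \<C> \<X> m (src f) X d"
  shows "\<exists>X' d'. rel_resolution \<C> \<X> (Suc m) (tgt g) X' d'"
proof -
  note S = ses_arr[OF conf_ses[OF assms(1)]]
  obtain K F G where R: "\<forall>i \<le> m. X i \<in> \<X>" "K 0 = src f" "K m = X m" "G m = ide (X m)"
    "\<forall>i < m. F i \<in> Hom \<C> (K (i + 1)) (X i) \<and> G i \<in> Hom \<C> (X i) (K i) \<and> rel_conflation \<C> \<X> (F i) (G i)"
    using assms(3) unfolding rel_resolution_def by blast
  define X' where "X' = (\<lambda>i. case i of 0 \<Rightarrow> src g | Suc i \<Rightarrow> X i)"
  define K' where "K' = (\<lambda>i. case i of 0 \<Rightarrow> tgt g | Suc i \<Rightarrow> K i)"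
  define F' where "F' = (\<lambda>i. case i of 0 \<Rightarrow> f | Suc i \<Rightarrow> F i)"
  define G' where "G' = (\<lambda>i. case i of 0 \<Rightarrow> g | Suc i \<Rightarrow> G i)"
  define d' where "d' = (\<lambda>i. case i of 0 \<Rightarrow> g | Suc i \<Rightarrow> F' i \<cdot> G' (Suc i))"
  have "X' i \<in> \<X>" if "i \<le> Suc m" for i
    using that R(1) assms(2) by (cases i) (auto simp: X'_def)
  moreover have "F' i \<in> Hom \<C> (K' (i + 1)) (X' i) \<and> G' i \<in> Hom \<C> (X' i) (K' i) \<and> rel_conflation \<C> \<X> (F' i) (G' i)"
    if i: "i < Suc m" for i
    using i R S(1-3) assms(1) rel_conflation_iff by (cases i) (auto simp: F'_def G'_def X'_def K'_def Hom_iff)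
  moreover have "K' 0 = tgt g" "K' (Suc m) = X' (Suc m)" "G' (Suc m) = ide (X' (Suc m))"
    "d' 0 = G' 0" "\<And>i. d' (i + 1) = F' i \<cdot> G' (i + 1)"
    using R by (simp_all add: X'_def K'_def F'_def G'_def d'_def)
  ultimately show ?thesis unfolding rel_resolution_def by blast
qed

lemma rel_resolution_SucD:
  assumes "rel_resolution \<C> \<X> (Suc m) c X d"
  obtains f g d' where "conf \<X> f g" "src g = X 0" "tgt g = c" "X 0 \<in> \<X>"
    "rel_resolution \<C> \<X> m (src f) (\<lambda>i. X (Suc i)) d'"
proof -
  obtain K F G where R: "\<forall>i \<le> Suc m. X i \<in> \<X>" "K 0 = c" "K (Suc m) = X (Suc m)" "G (Suc m) = ide (X (Suc m))"
    "\<forall>i < Suc m. F i \<in> Hom \<C> (K (i + 1)) (X i) \<and> G i \<in> Hom \<C> (X i) (K i) \<and> rel_conflation \<C> \<X> (F i) (G i)"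
    using assms unfolding rel_resolution_def by blast
  have R0: "F 0 \<in> Hom \<C> (K 1) (X 0)" "G 0 \<in> Hom \<C> (X 0) (K 0)" "rel_conflation \<C> \<X> (F 0) (G 0)"
    using R(5) by (metis One_nat_def add_0 zero_less_Suc)+
  define d' where "d' = (\<lambda>i. case i of 0 \<Rightarrow> G 1 | Suc i \<Rightarrow> F (Suc i) \<cdot> G (Suc (Suc i)))"
  have "rel_resolution \<C> \<X> m (K 1) (\<lambda>i. X (Suc i)) d'"
    unfolding rel_resolution_def
    by (intro conjI exI[of _ "\<lambda>i. K (Suc i)"] exI[of _ "\<lambda>i. F (Suc i)"] exI[of _ "\<lambda>i. G (Suc i)"])
      (use R in \<open>auto simp: d'_def\<close>)
  moreover have "src (F 0) = K 1" "src (G 0) = X 0" "tgt (G 0) = c" "X 0 \<in> \<X>"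
    using R0 R(1,2) by (auto simp: Hom_iff)
  ultimately show thesis using that R0(3) rel_conflation_iff by metis
qed

text \<open>
  An object orthogonal to \<open>\<X>\<close> in \<open>n - 1 - m\<close> degrees is \<open>m\<close> syzygies away from \<open>\<X>\<close>.
\<close>

lemma resolution_exists:
  assumes ct: "n_cluster_tilting \<C> n \<X>" and c: "c \<in> Ob \<C>"
    and m: "m \<le> n - 1" and o: "Ext_orthogonal \<X> (n - 1 - m) c"
  shows "\<exists>X d. rel_resolution \<C> \<X> m c X d"
  using c m o
proof (induction m arbitrary: c)
  case 0
  then have "c \<in> \<X>" using cluster_tilting_iff[OF ct] by simp
  then have "rel_resolution \<C> \<X> 0 c (\<lambda>_. c) (\<lambda>_. ide c)" by (simp add: rel_resolution_0)
  then show ?case by blast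
next
  case (Suc m)
  obtain f g where fg: "conf \<X> f g" "src g \<in> \<X>" "tgt g = c" using approximation[OF ct] Suc.prems by blast
  note S = ses_arr[OF conf_ses[OF fg(1)]]
  have "Ext_orthogonal \<X> (n - 1 - Suc m + 1) (src f)"
    by (rule syzygy_orthogonal[OF ct fg(1,2)]) (use Suc.prems fg in auto)
  moreover have "n - 1 - Suc m + 1 = n - 1 - m" using Suc.prems by simp
  ultimately obtain X d where "rel_resolution \<C> \<X> m (src f) X d"
    using Suc.IH[of "src f"] Suc.prems S by auto
  then show ?case using rel_resolution_Suc[OF fg(1,2)] fg(3) by blast
qed

end

section \<open>Groups given by generators and relators\<close>

lemma presented_hom_coset:
  assumes "R \<subseteq> carrier (free_Abelian_group S)"
  shows "(\<lambda>x. generate (free_Abelian_group S) R #>\<^bsub>free_Abelian_group S\<^esub> x)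
     \<in> hom (free_Abelian_group S) (presented_ab_group S R)"
proof -
  interpret F: comm_group "free_Abelian_group S" by (rule abelian_free_Abelian_group)
  have "generate (free_Abelian_group S) R \<lhd> free_Abelian_group S"
    using F.generate_is_subgroup[OF assms] by (simp add: F.normal_iff_subgroup)
  then show ?thesis unfolding presented_ab_group_def by (rule normal.r_coset_hom_Mod)
qed

lemma presented_class_closed:
  assumes "R \<subseteq> carrier (free_Abelian_group S)" "s \<in> S"
  shows "presented_class S R s \<in> carrier (presented_ab_group S R)"
  unfolding presented_class_def using hom_in_carrier[OF presented_hom_coset[OF assms(1)]] assms(2) by simp

lemma presented_relator:
  assumes "R \<subseteq> carrier (free_Abelian_group S)" "r \<in> R"
  shows "generate (free_Abelian_group S) R #>\<^bsub>free_Abelian_group S\<^esub> r = \<one>\<^bsub>presented_ab_group S R\<^esub>"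
proof -
  interpret F: comm_group "free_Abelian_group S" by (rule abelian_free_Abelian_group)
  have "r \<in> generate (free_Abelian_group S) R" using assms(2) by (rule generate.incl)
  then show ?thesis unfolding presented_ab_group_def
    using F.coset_join2[OF _ F.generate_is_subgroup[OF assms(1)]] assms by auto
qed

lemma presented_universal:
  assumes G: "comm_group G" and R: "R \<subseteq> carrier (free_Abelian_group S)" and f: "f ` S \<subseteq> carrier G"
    and rel: "\<And>h r. h \<in> hom (free_Abelian_group S) G \<Longrightarrow> (\<And>s. s \<in> S \<Longrightarrow> h (frag_of s) = f s) \<Longrightarrow>
       r \<in> R \<Longrightarrow> h r = \<one>\<^bsub>G\<^esub>"
  obtains \<phi> where "\<phi> \<in> hom (presented_ab_group S R) G" "\<And>s. s \<in> S \<Longrightarrow> \<phi> (presented_class S R s) = f s"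
proof -
  interpret F: comm_group "free_Abelian_group S" by (rule abelian_free_Abelian_group)
  interpret G: comm_group G by (rule G)
  obtain h where h: "h \<in> hom (free_Abelian_group S) G" "\<And>s. s \<in> S \<Longrightarrow> h (frag_of s) = f s"
    using G.free_Abelian_group_universal[OF f] by metis
  interpret h: group_hom "free_Abelian_group S" G h
    using h by (simp add: group_hom_def group_hom_axioms_def G.is_group)
  have "R \<subseteq> kernel (free_Abelian_group S) G h"
    using rel[OF h] R unfolding kernel_def by blast
  then have "generate (free_Abelian_group S) R \<subseteq> kernel (free_Abelian_group S) G h"
    by (rule F.generate_subgroup_incl[OF _ h.subgroup_kernel])
  moreover have "generate (free_Abelian_group S) R \<lhd> free_Abelian_group S"
    using F.generate_is_subgroup[OF R] by (simp add: F.normal_iff_subgroup)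
  ultimately obtain \<phi> where "\<phi> \<in> hom (free_Abelian_group S Mod generate (free_Abelian_group S) R) G"
    "\<And>x. x \<in> carrier (free_Abelian_group S) \<Longrightarrow> 
       \<phi> (generate (free_Abelian_group S) R #>\<^bsub>free_Abelian_group S\<^esub> x) = h x"
    using h.FactGroup_universal_kernel by metis
  then show thesis using that h(2) unfolding presented_ab_group_def presented_class_def by auto
qed

lemma free_hom_diff:
  assumes "h \<in> hom (free_Abelian_group S) G" "group G" "Poly_Mapping.keys x \<subseteq> S" "Poly_Mapping.keys y \<subseteq> S"
  shows "h (x - y) = h x \<otimes>\<^bsub>G\<^esub> inv\<^bsub>G\<^esub> (h y)"
proof -
  interpret F: comm_group "free_Abelian_group S" by (rule abelian_free_Abelian_group)
  interpret h: group_hom "free_Abelian_group S" G h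
    using assms by (simp add: group_hom_def group_hom_axioms_def)
  have "h (x \<otimes>\<^bsub>free_Abelian_group S\<^esub> inv\<^bsub>free_Abelian_group S\<^esub> y) = h x \<otimes>\<^bsub>G\<^esub> inv\<^bsub>G\<^esub> (h y)"
    using assms(3,4) h.hom_mult[of x "inv\<^bsub>free_Abelian_group S\<^esub> y"] h.hom_inv[of y] F.inv_closed[of y] by auto
  then show ?thesis using assms(4) by simp
qed

lemma free_hom_add:
  assumes "h \<in> hom (free_Abelian_group S) G" "Poly_Mapping.keys x \<subseteq> S" "Poly_Mapping.keys y \<subseteq> S"
  shows "h (x + y) = h x \<otimes>\<^bsub>G\<^esub> h y"
  using hom_mult[OF assms(1), of x y] assms(2,3) by simp

lemma presented_hom_unique:
  assumes R: "R \<subseteq> carrier (free_Abelian_group S)" and "group G"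
    and \<phi>: "\<phi> \<in> hom (presented_ab_group S R) G" and \<psi>: "\<psi> \<in> hom (presented_ab_group S R) G"
    and eq: "\<And>s. s \<in> S \<Longrightarrow> \<phi> (presented_class S R s) = \<psi> (presented_class S R s)"
    and x: "x \<in> carrier (presented_ab_group S R)"
  shows "\<phi> x = \<psi> x"
proof -
  let ?c = "\<lambda>x. generate (free_Abelian_group S) R #>\<^bsub>free_Abelian_group S\<^esub> x"
  interpret F: comm_group "free_Abelian_group S" by (rule abelian_free_Abelian_group)
  have h: "\<phi> \<circ> ?c \<in> hom (free_Abelian_group S) G" "\<psi> \<circ> ?c \<in> hom (free_Abelian_group S) G"
    using hom_compose[OF presented_hom_coset[OF R]] \<phi> \<psi> by blast+
  obtain y where y: "Poly_Mapping.keys y \<subseteq> S" "x = ?c y"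
    using x unfolding presented_ab_group_def carrier_FactGroup by auto
  have "(\<phi> \<circ> ?c) y = (\<psi> \<circ> ?c) y"
  proof (rule free_Abelian_group_induct[OF y(1), where P = "\<lambda>y. (\<phi> \<circ> ?c) y = (\<psi> \<circ> ?c) y"])
    interpret p: group_hom "free_Abelian_group S" G "\<phi> \<circ> ?c"
      using h(1) assms(2) by (simp add: group_hom_def group_hom_axioms_def)
    interpret q: group_hom "free_Abelian_group S" G "\<psi> \<circ> ?c"
      using h(2) assms(2) by (simp add: group_hom_def group_hom_axioms_def)
    show "(\<phi> \<circ> ?c) 0 = (\<psi> \<circ> ?c) 0" using p.hom_one q.hom_one by simp
  next
    fix u v assume uv: "Poly_Mapping.keys u \<subseteq> S" "Poly_Mapping.keys v \<subseteq> S"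
      "(\<phi> \<circ> ?c) u = (\<psi> \<circ> ?c) u" "(\<phi> \<circ> ?c) v = (\<psi> \<circ> ?c) v"
    show "(\<phi> \<circ> ?c) (u - v) = (\<psi> \<circ> ?c) (u - v)"
      unfolding free_hom_diff[OF h(1) assms(2) uv(1,2)] free_hom_diff[OF h(2) assms(2) uv(1,2)] uv(3,4) ..
  next
    fix a assume "a \<in> S"
    then show "(\<phi> \<circ> ?c) (frag_of a) = (\<psi> \<circ> ?c) (frag_of a)"
      using eq by (simp add: presented_class_def)
  qed
  then show ?thesis using y by simp
qed

section \<open>Isomorphism classes\<close>

context category begin

lemma iso_arrE:
  assumes "iso_arr \<C> f"
  obtains g where "arr f" "arr g" "src g = tgt f" "tgt g = src f"
    "g \<cdot> f = ide (src f)" "f \<cdot> g = ide (tgt f)"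
  using assms unfolding iso_arr_def Bex_def Hom_iff by blast

lemma isomorphicE:
  assumes "isomorphic \<C> a b"
  obtains f g where "arr f" "src f = a" "tgt f = b" "arr g" "src g = b" "tgt g = a"
    "g \<cdot> f = ide a" "f \<cdot> g = ide b"
proof -
  obtain f where f: "arr f" "src f = a" "tgt f = b" "iso_arr \<C> f"
    using assms unfolding isomorphic_def Bex_def Hom_iff by blast
  show thesis by (rule iso_arrE[OF f(4)]) (use that[of f] f in simp)
qed

lemma isomorphicI:
  assumes "arr f" "src f = a" "tgt f = b" "arr g" "src g = b" "tgt g = a"
    "g \<cdot> f = ide a" "f \<cdot> g = ide b"
  shows "isomorphic \<C> a b"
  using assms unfolding isomorphic_def iso_arr_def Bex_def Hom_iff by blast

lemma isomorphic_refl: "a \<in> Ob \<C> \<Longrightarrow> isomorphic \<C> a a"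
  by (rule isomorphicI[of "ide a" _ _ "ide a"]) simp_all

lemma isomorphic_sym: "isomorphic \<C> a b \<Longrightarrow> isomorphic \<C> b a"
  by (erule isomorphicE, rule isomorphicI)

lemma isomorphic_trans:
  assumes "isomorphic \<C> a b" "isomorphic \<C> b c" shows "isomorphic \<C> a c"
proof -
  obtain f g where f: "arr f" "src f = a" "tgt f = b" "arr g" "src g = b" "tgt g = a"
    "g \<cdot> f = ide a" "f \<cdot> g = ide b" using assms(1) by (rule isomorphicE)
  obtain f' g' where f': "arr f'" "src f' = b" "tgt f' = c" "arr g'" "src g' = c" "tgt g' = b"
    "g' \<cdot> f' = ide b" "f' \<cdot> g' = ide c" using assms(2) by (rule isomorphicE)
  have "g \<cdot> (g' \<cdot> (f' \<cdot> f)) = ide a"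
    using comp_cancel[OF f'(7), of f] f(1-7) f'(1-6) by simp
  moreover have "f' \<cdot> (f \<cdot> (g \<cdot> g')) = ide c"
    using comp_cancel[OF f(8), of g'] f(1-6) f'(1-6,8) by simp
  ultimately show ?thesis
    by (intro isomorphicI[of "f' \<cdot> f" _ _ "g \<cdot> g'"]) (use f(1-6) f'(1-6) in simp_all)
qed

lemma iso_class_eq:
  assumes "a \<in> S" "b \<in> S" "isomorphic \<C> a b"
  shows "iso_class \<C> S a = iso_class \<C> S b"
  using assms isomorphic_sym isomorphic_trans unfolding iso_class_def iso_rel_def by blast

lemma iso_class_self: "a \<in> S \<Longrightarrow> a \<in> Ob \<C> \<Longrightarrow> a \<in> iso_class \<C> S a"
  using isomorphic_refl by (auto simp: iso_class_def iso_rel_def)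

lemma iso_class_mem: "b \<in> iso_class \<C> S a \<Longrightarrow> b \<in> S \<and> isomorphic \<C> a b"
  by (auto simp: iso_class_def iso_rel_def)

lemma iso_class_cases:
  assumes "s \<in> S // iso_rel \<C> S" obtains a where "a \<in> S" "s = iso_class \<C> S a"
  using assms by (auto simp: iso_class_def elim: quotientE)

end

section \<open>Operations on conflations\<close>

context abelian_category begin

lemma ses_zero_iso:
  assumes z: "is_zero_object \<C> z" and \<phi>: "arr \<phi>" and \<psi>: "arr \<psi>" "src \<psi> = tgt \<phi>" "tgt \<psi> = src \<phi>"
    "\<psi> \<cdot> \<phi> = ide (src \<phi>)" "\<phi> \<cdot> \<psi> = ide (tgt \<phi>)"
  shows "ses (zero z (src \<phi>)) \<phi>"
proof -
  have O: "src \<phi> \<in> Ob \<C>" "z \<in> Ob \<C>" using \<phi> z by (simp_all add: is_zero_object_def)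
  have s: "ses (zero z (src \<phi>)) (ide (src \<phi>))" by (rule ses_zero_idm[OF z O(1)])
  have "is_kernel \<C> (zero z (src \<phi>)) \<phi>"
  proof (rule kernelI[OF ses_arr(5)[OF s] \<phi>])
    fix h assume h: "arr h" "tgt h = src \<phi>" "\<phi> \<cdot> h = zero (src h) (tgt \<phi>)"
    have "\<psi> \<cdot> (\<phi> \<cdot> h) = h" using comp_cancel[OF \<psi>(4), of h] h(1,2) \<phi> \<psi>(1-3) by simp
    then have "h = zero (src h) (src \<phi>)" unfolding h(3) using h(1,2) \<phi> \<psi>(1-3) by simp
    then have "ide (src \<phi>) \<cdot> h = zero (src h) (tgt (ide (src \<phi>)))" using h(1,2) O by simp
    then obtain u where "arr u" "src u = src h" "tgt u = src (zero z (src \<phi>))" 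
      "zero z (src \<phi>) \<cdot> u = h"
      by (rule ses_lift[OF s h(1), rotated 1]) (use h(2) O in simp_all)
    then show "\<exists>u. arr u \<and> src u = src h \<and> tgt u = src (zero z (src \<phi>)) \<and> 
      zero z (src \<phi>) \<cdot> u = h" by blast
  qed (use O \<phi> in simp_all)
  moreover have "epi \<phi>" by (rule split_epi[of \<phi> \<psi>]) (use \<phi> \<psi> in simp_all)
  ultimately show ?thesis by (simp add: ses_def)
qed

lemma conf_zero_iso:
  assumes z: "is_zero_object \<C> z" and i: "isomorphic \<C> c c'"
  obtains f g where "conf \<X> f g" "src f = z" "src g = c" "tgt g = c'"
proof -
  obtain \<phi> \<psi> where \<phi>: "arr \<phi>" "src \<phi> = c" "tgt \<phi> = c'" "arr \<psi>" "src \<psi> = c'" "tgt \<psi> = c"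
    "\<psi> \<cdot> \<phi> = ide c" "\<phi> \<cdot> \<psi> = ide c'" using i by (rule isomorphicE)
  have O: "c \<in> Ob \<C>" "z \<in> Ob \<C>" using \<phi> z by (auto simp: is_zero_object_def)
  have "ses (zero z c) \<phi>" using ses_zero_iso[OF z \<phi>(1,4)] \<phi> by simp
  moreover have "\<exists>l \<in> Arr \<C>. src l = src x \<and> tgt l = src \<phi> \<and> \<phi> \<cdot> l = x"
    if x: "arr x" "tgt x = tgt \<phi>" for x
    using comp_cancel[OF \<phi>(8), of x] x \<phi>(1-6) by (intro bexI[of _ "\<psi> \<cdot> x"]) simp_all
  ultimately have "conf \<X> (zero z c) \<phi>" unfolding conf_def by blast
  then show thesis by (rule that) (use \<phi> O in simp_all)
qed

lemma conf_of_section: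
  assumes fg: "ses f g" and s: "arr s" "src s = tgt g" "tgt s = src g" "g \<cdot> s = ide (tgt g)"
  shows "conf \<X> f g"
  unfolding conf_def
proof (intro conjI ballI impI fg)
  note F = ses_arr[OF fg]
  fix x assume x: "arr x" "src x \<in> \<X> \<and> tgt x = tgt g"
  have "g \<cdot> (s \<cdot> x) = x" using comp_cancel[OF s(4), of x] x s(1-3) F by simp
  then show "\<exists>l \<in> Arr \<C>. src l = src x \<and> tgt l = src g \<and> g \<cdot> l = x"
    using x s by (intro bexI[of _ "s \<cdot> x"]) simp_all
qed

text \<open>
  The identity of an object of \<open>\<X>\<close> lifts, so the conflation has a section.
\<close>

lemma conf_split:
  assumes c: "conf \<X> f g" and x: "tgt g \<in> \<X>"
  shows "is_biproduct \<C> (src f) (tgt g) (src g)"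
proof -
  note cs = conf_ses[OF c]
  note F = ses_arr[OF cs]
  have O: "tgt g \<in> Ob \<C>" "src f \<in> Ob \<C>" "src g \<in> Ob \<C>" using F by simp_all
  obtain s where s: "arr s" "src s = tgt g" "tgt s = src g" "g \<cdot> s = ide (tgt g)"
    by (rule conf_lift[OF c, of "ide (tgt g)"]) (use x O in simp_all)
  define y where "y = ide (src g) \<boxplus> neg (s \<cdot> g)"
  have y: "arr y" "src y = src g" "tgt y = src g"
    unfolding y_def using s(1-3) F(1-3) O by simp_all
  have gsg: "g \<cdot> (s \<cdot> g) = g" using comp_cancel[OF s(4), of g] s(1-3) F(2) by simp
  have "g \<cdot> y = g \<cdot> ide (src g) \<boxplus> neg (g \<cdot> (s \<cdot> g))"
    unfolding y_def by (subst comp_add') (use s(1-3) F(1-3) O in simp_all)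
  then have "g \<cdot> y = zero (src y) (tgt g)" unfolding gsg using F(2) y by simp
  then obtain p where p: "arr p" "src p = src y" "tgt p = src f" "f \<cdot> p = y"
    by (rule ses_lift[OF cs y(1,3)])
  have "f \<cdot> (p \<cdot> f) = y \<cdot> f" by (rule comp_cancel[OF p(4)]) (use p(1-3) y F(1-3) in simp_all)
  also have "\<dots> = f \<cdot> ide (src f)" unfolding y_def using s(1-3) F O by simp
  finally have e1: "f \<cdot> (p \<cdot> f) = f \<cdot> ide (src f)" .
  have pf: "p \<cdot> f = ide (src f)"
    by (rule mono_cancel[OF F(5) _ _ _ _ e1]) (use p(1-3) y F(1-3) O in simp_all)
  have "f \<cdot> (p \<cdot> s) = y \<cdot> s" by (rule comp_cancel[OF p(4)]) (use p(1-3) y F(1-3) s(1-3) in simp_all)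
  also have "\<dots> = f \<cdot> zero (tgt g) (src f)" unfolding y_def using s F O by simp
  finally have e2: "f \<cdot> (p \<cdot> s) = f \<cdot> zero (tgt g) (src f)" .
  have ps: "p \<cdot> s = zero (tgt g) (src f)"
    by (rule mono_cancel[OF F(5) _ _ _ _ e2]) (use p(1-3) y F(1-3) s(1-3) O in simp_all)
  have "s \<cdot> g \<boxplus> y = ide (src g)" unfolding y_def by (rule add_diff_cancel) (use s(1-3) F(1-3) O in simp_all)
  then have "f \<cdot> p \<boxplus> s \<cdot> g = ide (src g)"
    unfolding p(4) using add_commute[of y "s \<cdot> g"] y s(1-3) F(2) by simp
  then have "biprod (src f) (tgt g) (src g) f s p g"
    unfolding biprod_def Hom_iff using O F s p y pf ps by simp
  then show ?thesis using is_biproduct_iff by blast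
qed

lemma biprod_conf:
  assumes b: "biprod a a' b i i' p p'" shows "conf \<X> i p'"
  by (rule conf_of_section[OF ses_biprod[OF b], of i']) (use biprod_arr[OF b] in simp_all)

lemma conf_add:
  assumes c: "conf \<X> f g" and b: "biprod (tgt g) x b i i' p p'" and b': "biprod (src g) x b' j j' q q'"
  shows "conf \<X> (j \<cdot> f) (i \<cdot> (g \<cdot> q) \<boxplus> i' \<cdot> q')"
proof -
  note cs = conf_ses[OF c]
  note F = ses_arr[OF cs] and B = biprod_arr[OF b] and R = biprod_reduce[OF b]
    and B' = biprod_arr[OF b'] and R' = biprod_reduce[OF b']
  define g' where "g' = i \<cdot> (g \<cdot> q) \<boxplus> i' \<cdot> q'"
  have g': "arr g'" "src g' = b'" "tgt g' = b" unfolding g'_def using F(1-3) B(1-15) B'(1-15) by simp_all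
  have gj: "g' \<cdot> j = i \<cdot> g" unfolding g'_def using F(1-3) B(1-15) B' by simp
  have gj': "g' \<cdot> j' = i'" unfolding g'_def using F(1-3) B(1-15) B' by simp
  have pg: "p \<cdot> g' = g \<cdot> q" unfolding g'_def using F(1-3) B R B'(1-15) by simp
  have p'g: "p' \<cdot> g' = q'" unfolding g'_def using F(1-3) B R B'(1-15) by simp
  have f': "arr (j \<cdot> f)" "src (j \<cdot> f) = src f" "tgt (j \<cdot> f) = b'" using F(1-3) B'(1-15) by simp_all
  have jm: "is_mono \<C> j" using ses_arr(5)[OF ses_biprod[OF b']] .
  have mono: "is_mono \<C> (j \<cdot> f)"
  proof (rule monoI[OF f'(1)])
    fix s assume s: "arr s" "tgt s = src (j \<cdot> f)" "(j \<cdot> f) \<cdot> s = zero (src s) (tgt (j \<cdot> f))"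
    have "j \<cdot> (f \<cdot> s) = zero (src (f \<cdot> s)) (tgt j)" using s F(1-3) B'(4-6) f' by simp
    then have "f \<cdot> s = zero (src s) (tgt f)" using mono_zero[OF jm, of "f \<cdot> s"] s(1,2) F(1-3) B'(4-6) f' by simp
    then show "s = zero (src s) (src (j \<cdot> f))" using mono_zero[OF F(5), of s] s(1,2) f' by simp
  qed
  have epi: "epi g'"
  proof (rule epiI[OF g'(1)])
    fix s assume s: "arr s" "src s = tgt g'" "s \<cdot> g' = zero (src g') (tgt s)"
    have sd: "src s = b" using s(2) g' by simp
    have "s \<cdot> (g' \<cdot> j) = zero (src g) (tgt s)"
      using comp_cancel[OF s(3), of j] s(1) sd g' B'(1-6) by simp
    then have "(s \<cdot> i) \<cdot> g = zero (src g) (tgt (s \<cdot> i))" unfolding gj using s(1) sd B(4-6) F(1-3) by simp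
    then have si: "s \<cdot> i = zero (tgt g) (tgt s)"
      using epi_zero[OF F(6), of "s \<cdot> i"] s(1) sd B(4-6) by simp
    have si': "s \<cdot> i' = zero x (tgt s)"
      using comp_cancel[OF s(3), of j'] unfolding gj' using s(1) sd g' B'(1-9) by simp
    have "s \<cdot> (i \<cdot> p \<boxplus> i' \<cdot> p') = s \<cdot> (i \<cdot> p) \<boxplus> s \<cdot> (i' \<cdot> p')" by (rule comp_add') (use s(1) sd B(4-15) in simp_all)
    also have "s \<cdot> (i \<cdot> p) = zero b (tgt s)"
      using comp_cancel[OF si, of p] s(1) sd B(1-15) by simp
    also have "s \<cdot> (i' \<cdot> p') = zero b (tgt s)"
      using comp_cancel[OF si', of p'] s(1) sd B(1-15) by simp
    finally show "s = zero (tgt g') (tgt s)" unfolding B(20) using s(1) sd g' B(3) by simp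
  qed
  have "is_kernel \<C> (j \<cdot> f) g'"
  proof (rule kernelI[OF mono g'(1)])
    have "g' \<cdot> (j \<cdot> f) = (i \<cdot> g) \<cdot> f" by (rule comp_cancel[OF gj]) (use g' F(1-3) B'(4-6) in simp_all)
    then show "g' \<cdot> (j \<cdot> f) = zero (src (j \<cdot> f)) (tgt g')" using F B(1-6) f' g' by simp
    fix h assume h: "arr h" "tgt h = src g'" "g' \<cdot> h = zero (src h) (tgt g')"
    have hb: "tgt h = b'" using h(2) g' by simp
    have "p \<cdot> (g' \<cdot> h) = (g \<cdot> q) \<cdot> h" by (rule comp_cancel[OF pg]) (use h(1) hb g' B(10-12) in simp_all)
    then have "g \<cdot> (q \<cdot> h) = zero (src (q \<cdot> h)) (tgt g)" unfolding h(3)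
      using h(1) hb g' B(1-15) B'(10-12) F(1-3) by simp
    then obtain u where u: "arr u" "src u = src (q \<cdot> h)" "tgt u = src f" "f \<cdot> u = q \<cdot> h"
      by (rule ses_lift[OF cs, rotated 2]) (use h(1) hb B'(10-12) F(1-3) in simp_all)
    have "p' \<cdot> (g' \<cdot> h) = q' \<cdot> h" by (rule comp_cancel[OF p'g]) (use h(1) hb g' B(13-15) in simp_all)
    then have q'h: "q' \<cdot> h = zero (src h) x" unfolding h(3) using h(1) g' B(1-15) by simp
    have "h = j \<cdot> (q \<cdot> h) \<boxplus> j' \<cdot> (q' \<cdot> h)" using R'(5)[OF h(1) hb] by simp
    also have "\<dots> = (j \<cdot> f) \<cdot> u" unfolding q'h u(4)[symmetric] using h(1) hb u(1-3) F(1-3) B'(1-15) by simp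
    finally have "(j \<cdot> f) \<cdot> u = h" by simp
    then show "\<exists>u. arr u \<and> src u = src h \<and> tgt u = src (j \<cdot> f) \<and> (j \<cdot> f) \<cdot> u = h"
      using u(1-3) h(1) hb B'(10-12) f' by (intro exI[of _ u]) simp
  qed (use f' g' in simp_all)
  then have s: "ses (j \<cdot> f) g'" using epi by (simp add: ses_def)
  have "conf \<X> (j \<cdot> f) g'"
    unfolding conf_def
  proof (intro conjI ballI impI s)
    fix y assume y: "arr y" "src y \<in> \<X> \<and> tgt y = tgt g'"
    have yb: "tgt y = b" using y g' by simp
    obtain l where l: "arr l" "src l = src (p \<cdot> y)" "tgt l = src g" "g \<cdot> l = p \<cdot> y"
      by (rule conf_lift[OF c, of "p \<cdot> y"]) (use y(1) conjunct1[OF y(2)] yb B(10-12) in simp_all)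
    have ld: "src l = src y" using l(2) y(1) yb B(10-12) by simp
    have "g' \<cdot> (j \<cdot> l) = (i \<cdot> g) \<cdot> l" by (rule comp_cancel[OF gj]) (use l(1,3) g' B'(4-6) in simp_all)
    also have "\<dots> = i \<cdot> (p \<cdot> y)" unfolding l(4)[symmetric] using l(1,3) F(2) B(4-6) by simp
    finally have 1: "g' \<cdot> (j \<cdot> l) = i \<cdot> (p \<cdot> y)" .
    have 2: "g' \<cdot> (j' \<cdot> (p' \<cdot> y)) = i' \<cdot> (p' \<cdot> y)" 
      by (rule comp_cancel[OF gj']) (use y(1) yb g' B(13-15) B'(7-9) in simp_all)
    have "g' \<cdot> (j \<cdot> l \<boxplus> j' \<cdot> (p' \<cdot> y)) = g' \<cdot> (j \<cdot> l) \<boxplus> g' \<cdot> (j' \<cdot> (p' \<cdot> y))"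
      by (rule comp_add') (use l(1,3) ld y(1) yb g' B(13-15) B'(4-9) in simp_all)
    also have "\<dots> = y" unfolding 1 2 by (rule R(5)[OF y(1) yb])
    finally show "\<exists>l \<in> Arr \<C>. src l = src y \<and> tgt l = src g' \<and> g' \<cdot> l = y"
      using l(1,3) ld y(1) yb g' B(13-15) B'(4-9) by (intro bexI[of _ "j \<cdot> l \<boxplus> j' \<cdot> (p' \<cdot> y)"]) simp_all
  qed
  then show ?thesis unfolding g'_def .
qed

text \<open>
  If \<open>l\<close> lifts \<open>g\<close> through \<open>h\<close>, then \<open>(f, l)\<close> maps the direct sum onto the middle term \<open>B\<close> of the first conflation. The
  second component identifies its kernel with that of \<open>g\<close>: if \<open>g\<close> vanishes on the second component, then \<open>l\<close> maps it
  into the image of the mono \<open>f\<close>, and there is exactly one matching first component. For the lifting property, an arrow into \<open>B\<close> is first lifted through \<open>g\<close> after composing with \<open>h\<close>; the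
  difference then factors through \<open>f\<close>.
\<close>

lemma conf_rotate:
  assumes c: "conf \<X> f h" and d: "conf \<X> k g" and e: "tgt g = tgt h" "src g \<in> \<X>"
    and b: "biprod (src f) (src g) b i i' p p'"
  obtains k' e where "conf \<X> k' e" "src k' = src k" "src e = b" "tgt e = src h"
proof -
  note cs = conf_ses[OF c] and ds = conf_ses[OF d]
  note F = ses_arr[OF cs] and K = ses_arr[OF ds] and B = biprod_arr[OF b] and R = biprod_reduce[OF b]
  obtain l where l: "arr l" "src l = src g" "tgt l = src h" "h \<cdot> l = g"
    by (rule conf_lift[OF c K(2)]) (use e in simp_all)
  define e where "e = f \<cdot> p \<boxplus> l \<cdot> p'"
  have et: "arr e" "src e = b" "tgt e = src h" unfolding e_def using F(1-3) l(1-3) B(1-15) by simp_all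
  have ei: "e \<cdot> i = f" "e \<cdot> i' = l" unfolding e_def using F(1-3) l(1-3) B by simp_all
  have edec: "e \<cdot> y = f \<cdot> (p \<cdot> y) \<boxplus> l \<cdot> (p' \<cdot> y)" if "arr y" "tgt y = b" for y
    unfolding e_def using that F(1-3) l(1-3) B(1-15) by simp
  have "h \<cdot> (l \<cdot> k) = g \<cdot> k" by (rule comp_cancel[OF l(4)]) (use l(1-3) F(2) K(1,3) in simp_all)
  then have "h \<cdot> (l \<cdot> k) = zero (src (l \<cdot> k)) (tgt h)" using K(1,3,4) l(1,2) assms(3) by simp
  then obtain t where t: "arr t" "src t = src (l \<cdot> k)" "tgt t = src f" "f \<cdot> t = l \<cdot> k"
    by (rule ses_lift[OF cs, rotated 2]) (use l(1-3) K(1,3) in simp_all)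
  have td: "src t = src k" using t(2) l(1,2) K(1,3) by simp
  define k' where "k' = i' \<cdot> k \<boxplus> neg (i \<cdot> t)"
  have k't: "arr k'" "src k' = src k" "tgt k' = b" unfolding k'_def using K(1,3) t(1,3) td B(4-9) by simp_all
  have p'k: "p' \<cdot> k' = k" and pk: "p \<cdot> k' = neg t" unfolding k'_def using K(1,3) t(1,3) td B R by simp_all
  have mono: "is_mono \<C> k'"
  proof (rule monoI[OF k't(1)])
    fix s assume s: "arr s" "tgt s = src k'" "k' \<cdot> s = zero (src s) (tgt k')"
    have "p' \<cdot> (k' \<cdot> s) = k \<cdot> s" by (rule comp_cancel[OF p'k]) (use s(1,2) k't B(13-15) in simp_all)
    then have "k \<cdot> s = zero (src s) (tgt k)" unfolding s(3) using s(1) k't B(13-15) K(1-3) by simp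
    then show "s = zero (src s) (src k')" using mono_zero[OF K(5), of s] s(1,2) k't by simp
  qed
  have epi: "epi e"
  proof (rule epiI[OF et(1)])
    fix s assume s: "arr s" "src s = tgt e" "s \<cdot> e = zero (src e) (tgt s)"
    have sd: "src s = src h" using s(2) et by simp
    have sf: "s \<cdot> f = zero (src f) (tgt s)"
      using comp_cancel[OF s(3), of i] unfolding ei using s(1) sd et B(1-6) by simp
    have sl: "s \<cdot> l = zero (src g) (tgt s)"
      using comp_cancel[OF s(3), of i'] unfolding ei using s(1) sd et B(1-9) by simp
    obtain s' where s': "arr s'" "src s' = tgt h" "tgt s' = tgt s" "s' \<cdot> h = s"
      by (rule ses_desc[OF cs s(1) sd sf])
    have "s' \<cdot> (h \<cdot> l) = s \<cdot> l" by (rule comp_cancel[OF s'(4)]) (use s'(1-3) F(2) l(1-3) in simp_all)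
    then have "s' \<cdot> g = zero (src g) (tgt s')" unfolding l(4) sl using s'(3) by simp
    then have "s' = zero (tgt g) (tgt s')" using epi_zero[OF K(6), of s'] s'(1,2) assms(3) by simp
    then have "s' \<cdot> h = zero (src h) (tgt s)" using s'(1-3) F(2) assms(3) by (metis zero_comp Cod_in_Ob)
    then show "s = zero (tgt e) (tgt s)" unfolding s'(4) et(3) .
  qed
  have "is_kernel \<C> k' e"
  proof (rule kernelI[OF mono et(1)])
    have "e \<cdot> k' = f \<cdot> neg t \<boxplus> l \<cdot> k" using edec[OF k't(1,3)] unfolding p'k pk .
    also have "\<dots> = zero (src k') (tgt e)" using t(1,3,4) td F(1-3) l(1-3) K(1,3) k't et add_neg(2)[of "l \<cdot> k"] by simp
    finally show "e \<cdot> k' = zero (src k') (tgt e)" .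
    fix y assume y: "arr y" "tgt y = src e" "e \<cdot> y = zero (src y) (tgt e)"
    have yb: "tgt y = b" using y(2) et by simp
    have yt: "arr (p \<cdot> y)" "src (p \<cdot> y) = src y" "tgt (p \<cdot> y) = src f"
      "arr (p' \<cdot> y)" "src (p' \<cdot> y) = src y" "tgt (p' \<cdot> y) = src g" using y(1) yb B(10-15) by simp_all
    have ey: "f \<cdot> (p \<cdot> y) \<boxplus> l \<cdot> (p' \<cdot> y) = zero (src y) (src h)"
      using edec[OF y(1) yb] y(3) et by simp
    have "h \<cdot> (f \<cdot> (p \<cdot> y) \<boxplus> l \<cdot> (p' \<cdot> y)) = h \<cdot> (f \<cdot> (p \<cdot> y)) \<boxplus> h \<cdot> (l \<cdot> (p' \<cdot> y))"
      by (rule comp_add') (use yt F(1-3) l(1-3) in simp_all)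
    also have "h \<cdot> (f \<cdot> (p \<cdot> y)) = zero (src y) (tgt h)"
      using comp_cancel[OF F(4), of "p \<cdot> y"] yt F(1-3) by simp
    also have "h \<cdot> (l \<cdot> (p' \<cdot> y)) = g \<cdot> (p' \<cdot> y)" by (rule comp_cancel[OF l(4)]) (use yt F(2) l(1-3) in simp_all)
    finally have "g \<cdot> (p' \<cdot> y) = zero (src (p' \<cdot> y)) (tgt g)"
      unfolding ey using yt K(2) F(2) y(1) assms(3) by simp
    then obtain w where w: "arr w" "src w = src (p' \<cdot> y)" "tgt w = src k" "k \<cdot> w = p' \<cdot> y"
      by (rule ses_lift[OF ds yt(4,6)])
    have "l \<cdot> (p' \<cdot> y) = (l \<cdot> k) \<cdot> w" unfolding w(4)[symmetric] using l(1,2) K(1,3) w(1,3) by simp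
    also have "\<dots> = f \<cdot> (t \<cdot> w)" unfolding t(4)[symmetric] using t(1,3) td w(1,3) F(1) by simp
    finally have lw: "l \<cdot> (p' \<cdot> y) = f \<cdot> (t \<cdot> w)" .
    have tw: "arr (t \<cdot> w)" "src (t \<cdot> w) = src y" "tgt (t \<cdot> w) = src f" using t(1,3) td w(1-3) yt by simp_all
    have "f \<cdot> (p \<cdot> y \<boxplus> t \<cdot> w) = zero (src (p \<cdot> y \<boxplus> t \<cdot> w)) (tgt f)"
      using ey[unfolded lw] yt tw F(1,3) by simp
    then have "p \<cdot> y \<boxplus> t \<cdot> w = zero (src y) (src f)"
      using mono_zero[OF F(5), of "p \<cdot> y \<boxplus> t \<cdot> w"] yt tw by simp
    then have py: "p \<cdot> y = neg (t \<cdot> w)" by (intro neg_unique) (use yt tw in simp_all)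
    have e1: "p \<cdot> (k' \<cdot> w) = p \<cdot> y"
      unfolding py using comp_cancel[OF pk, of w] w(1,3) k't B(10-12) t(1,3) td by simp
    have e2: "p' \<cdot> (k' \<cdot> w) = p' \<cdot> y"
      unfolding w(4)[symmetric] by (rule comp_cancel[OF p'k]) (use w(1,3) k't B(13-15) in simp_all)
    have "k' \<cdot> w = i \<cdot> (p \<cdot> (k' \<cdot> w)) \<boxplus> i' \<cdot> (p' \<cdot> (k' \<cdot> w))" by (rule R(5)[symmetric]) (use w(1,3) k't in simp_all)
    also have "\<dots> = y" unfolding e1 e2 by (rule R(5)[OF y(1) yb])
    finally show "\<exists>u. arr u \<and> src u = src y \<and> tgt u = src k' \<and> k' \<cdot> u = y"
      using w(1-3) yt k't by (intro exI[of _ w]) simp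
  qed (use k't et in simp_all)
  then have s: "ses k' e" using epi by (simp add: ses_def)
  have "conf \<X> k' e" unfolding conf_def
  proof (intro conjI ballI impI s)
    fix y assume y: "arr y" "src y \<in> \<X> \<and> tgt y = tgt e"
    have yd: "src y \<in> \<X>" "tgt y = src h" using y(2) et by simp_all
    obtain y' where y': "arr y'" "src y' = src (h \<cdot> y)" "tgt y' = src g" "g \<cdot> y' = h \<cdot> y"
      by (rule conf_lift[OF d, of "h \<cdot> y"]) (use y(1) yd F(2) assms(3) in simp_all)
    have y'd: "src y' = src y" using y'(2) y(1) yd F(2) by simp
    define \<delta> where "\<delta> = y \<boxplus> neg (l \<cdot> y')"
    have \<delta>: "arr \<delta>" "src \<delta> = src y" "tgt \<delta> = src h" unfolding \<delta>_def using y(1) yd y'(1,3) y'd l(1-3) by simp_all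
    have "h \<cdot> (l \<cdot> y') = h \<cdot> y" unfolding y'(4)[symmetric] by (rule comp_cancel[OF l(4)]) (use y'(1,3) l(1-3) F(2) in simp_all)
    moreover have "h \<cdot> \<delta> = h \<cdot> y \<boxplus> neg (h \<cdot> (l \<cdot> y'))" unfolding \<delta>_def
      by (subst comp_add') (use y(1) yd y'(1,3) y'd l(1-3) F(2) in simp_all)
    ultimately have "h \<cdot> \<delta> = zero (src \<delta>) (tgt h)" using y(1) yd F(2) \<delta> by simp
    then obtain a where a: "arr a" "src a = src \<delta>" "tgt a = src f" "f \<cdot> a = \<delta>"
      by (rule ses_lift[OF cs \<delta>(1,3)])
    have ad: "src a = src y" using a(2) \<delta> by simp
    have "e \<cdot> (i \<cdot> a \<boxplus> i' \<cdot> y') = e \<cdot> (i \<cdot> a) \<boxplus> e \<cdot> (i' \<cdot> y')"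
      by (rule comp_add') (use et a(1,3) ad y'(1,3) y'd B(4-9) in simp_all)
    also have "e \<cdot> (i \<cdot> a) = \<delta>" unfolding a(4)[symmetric] by (rule comp_cancel[OF ei(1)]) (use et a(1,3) B(4-6) in simp_all)
    also have "e \<cdot> (i' \<cdot> y') = l \<cdot> y'" by (rule comp_cancel[OF ei(2)]) (use et y'(1,3) B(7-9) in simp_all)
    also have "\<delta> \<boxplus> l \<cdot> y' = l \<cdot> y' \<boxplus> \<delta>" by (rule add_commute) (use \<delta> y'(1,3) y'd l(1-3) in simp_all)
    also have "\<dots> = y" unfolding \<delta>_def by (rule add_diff_cancel) (use y(1) yd y'(1,3) y'd l(1-3) in simp_all)
    finally show "\<exists>l \<in> Arr \<C>. src l = src y \<and> tgt l = src e \<and> e \<cdot> l = y"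
      using et a(1,3) ad y'(1,3) y'd B(4-9) by (intro bexI[of _ "i \<cdot> a \<boxplus> i' \<cdot> y'"]) simp_all
  qed
  then show thesis by (rule that) (use k't et in simp_all)
qed

end

text \<open>
  The relation between the classes of three objects, deduced from that between their syzygies.
\<close>

lemma (in comm_group) rotation_identity:
  assumes "\<alpha> \<in> carrier G" "\<beta> \<in> carrier G" "\<gamma> \<in> carrier G" "a \<in> carrier G" "b \<in> carrier G" "c \<in> carrier G"
    and eq: "\<beta> \<otimes> (a \<otimes> c) = \<alpha> \<otimes> (\<gamma> \<otimes> b)"
  shows "b \<otimes> inv \<beta> = (a \<otimes> inv \<alpha>) \<otimes> (c \<otimes> inv \<gamma>)"
proof -
  note A = assms(1-6)
  have 1: "(b \<otimes> x) \<otimes> (\<alpha> \<otimes> (\<beta> \<otimes> \<gamma>)) = (\<alpha> \<otimes> (\<gamma> \<otimes> b)) \<otimes> (\<beta> \<otimes> x)" if "x \<in> carrier G" for x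
    using A that by (simp add: m_ac)
  have 2: "(\<beta> \<otimes> (a \<otimes> c)) \<otimes> ((\<alpha> \<otimes> x) \<otimes> (\<gamma> \<otimes> y)) = ((a \<otimes> x) \<otimes> (c \<otimes> y)) \<otimes> (\<alpha> \<otimes> (\<beta> \<otimes> \<gamma>))"
    if "x \<in> carrier G" "y \<in> carrier G" for x y
    using A that by (simp add: m_ac)
  have "(b \<otimes> inv \<beta>) \<otimes> (\<alpha> \<otimes> (\<beta> \<otimes> \<gamma>)) = (\<alpha> \<otimes> (\<gamma> \<otimes> b)) \<otimes> (\<beta> \<otimes> inv \<beta>)"
    by (rule 1) (use A in simp)
  also have "\<dots> = \<beta> \<otimes> (a \<otimes> c)" unfolding eq[symmetric] using A by simp
  also have "\<dots> = (\<beta> \<otimes> (a \<otimes> c)) \<otimes> ((\<alpha> \<otimes> inv \<alpha>) \<otimes> (\<gamma> \<otimes> inv \<gamma>))" using A by simp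
  also have "\<dots> = ((a \<otimes> inv \<alpha>) \<otimes> (c \<otimes> inv \<gamma>)) \<otimes> (\<alpha> \<otimes> (\<beta> \<otimes> \<gamma>))"
    by (rule 2) (use A in simp_all)
  finally show ?thesis using A by simp
qed

lemma (in comm_group) finprod_inv:
  assumes "finite A" "f \<in> A \<rightarrow> carrier G"
  shows "finprod G (\<lambda>i. inv (f i)) A = inv (finprod G f A)"
proof -
  have i: "(\<lambda>i. inv (f i)) \<in> A \<rightarrow> carrier G" using assms(2) by auto
  have "finprod G (\<lambda>i. inv (f i)) A \<otimes> finprod G f A = finprod G (\<lambda>i. inv (f i) \<otimes> f i) A"
    using finprod_multf[OF i assms(2)] by simp
  also have "\<dots> = \<one>" using assms(2) by (intro finprod_one_eqI) (auto simp: Pi_iff)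
  finally show ?thesis using inv_equality[OF _ finprod_closed[OF assms(2)] finprod_closed[OF i]] by simp
qed

lemma (in comm_group) relator_identity:
  assumes "a \<in> carrier G" "c \<in> carrier G"
  shows "a \<otimes> inv (a \<otimes> c) \<otimes> c = \<one>"
proof -
  have "a \<otimes> x \<otimes> c = (a \<otimes> c) \<otimes> x" if "x \<in> carrier G" for x
    using assms that by (simp add: m_ac)
  from this[of "inv (a \<otimes> c)"]
  have "a \<otimes> inv (a \<otimes> c) \<otimes> c = (a \<otimes> c) \<otimes> inv (a \<otimes> c)" using assms by simp
  then show ?thesis using assms by simp
qed

section \<open>Euler characteristics of resolutions\<close>

locale additive_subcategory = abelian_category \<C>
  for \<C> :: "('o, 'm, 'e) preadditive_category_scheme" (structure) +
  fixes \<X> :: "'o set"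
  assumes sub: "\<X> \<subseteq> Ob \<C>"
    and biproduct_closed: "is_biproduct \<C> x x' b \<Longrightarrow> x \<in> \<X> \<Longrightarrow> x' \<in> \<X> \<Longrightarrow> b \<in> \<X>"
    and zero_closed: "\<exists>z \<in> \<X>. is_zero_object \<C> z"
begin

lemma K0_split_relators_carrier:
  "K0_split_relators \<C> \<X> \<subseteq> carrier (free_Abelian_group (\<X> // iso_rel \<C> \<X>))"
proof
  fix r assume "r \<in> K0_split_relators \<C> \<X>"
  then obtain x x' b where "x \<in> \<X>" "x' \<in> \<X>" "b \<in> \<X>"
    and "r = frag_of (iso_class \<C> \<X> b) - (frag_of (iso_class \<C> \<X> x) + frag_of (iso_class \<C> \<X> x'))"
    unfolding K0_split_relators_def by blast
  then show "r \<in> carrier (free_Abelian_group (\<X> // iso_rel \<C> \<X>))"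
    using keys_diff keys_add iso_class_in_quotient
    by (fastforce dest!: subsetD[OF keys_diff] subsetD[OF keys_add])
qed

lemma K0_rel_relators_carrier:
  "K0_rel_relators \<C> \<X> \<subseteq> carrier (free_Abelian_group (Ob \<C> // iso_rel \<C> (Ob \<C>)))"
proof
  fix r assume "r \<in> K0_rel_relators \<C> \<X>"
  then obtain f g where fg: "conf \<X> f g"
    and r: "r = frag_of (iso_class \<C> (Ob \<C>) (src f)) - frag_of (iso_class \<C> (Ob \<C>) (tgt f))
        + frag_of (iso_class \<C> (Ob \<C>) (tgt g))"
    unfolding K0_rel_relators_def rel_conflation_iff by blast
  from fg have "arr f" "arr g" using ses_arr[OF conf_ses] by blast+
  with r show "r \<in> carrier (free_Abelian_group (Ob \<C> // iso_rel \<C> (Ob \<C>)))"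
    using Dom_in_Ob Cod_in_Ob iso_class_in_quotient
    by (fastforce dest!: subsetD[OF keys_diff] subsetD[OF keys_add])
qed

abbreviation Ksp where "Ksp \<equiv> K0_split \<C> \<X>"
abbreviation Krel where "Krel \<equiv> K0_rel \<C> \<X>"
abbreviation spcls where "spcls \<equiv> K0_split_class \<C> \<X>"
abbreviation relcls where "relcls \<equiv> K0_rel_class \<C> \<X>"

interpretation G: comm_group Ksp by (rule comm_group_K0_split)
interpretation H: comm_group Krel by (rule comm_group_K0_rel)

lemma spcls_closed: "x \<in> \<X> \<Longrightarrow> spcls x \<in> carrier Ksp"
  unfolding K0_split_class_def K0_split_def
  by (rule presented_class_closed[OF K0_split_relators_carrier iso_class_in_quotient])

lemma relcls_closed: "c \<in> Ob \<C> \<Longrightarrow> relcls c \<in> carrier Krel"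
  unfolding K0_rel_class_def K0_rel_def
  by (rule presented_class_closed[OF K0_rel_relators_carrier iso_class_in_quotient])

lemma spcls_biproduct:
  assumes "is_biproduct \<C> x x' b" "x \<in> \<X>" "x' \<in> \<X>"
  shows "spcls b = spcls x \<otimes>\<^bsub>Ksp\<^esub> spcls x'"
proof -
  let ?S = "\<X> // iso_rel \<C> \<X>" and ?R = "K0_split_relators \<C> \<X>"
  let ?c = "\<lambda>x. generate (free_Abelian_group ?S) ?R #>\<^bsub>free_Abelian_group ?S\<^esub> x"
  have b: "b \<in> \<X>" using biproduct_closed assms by blast
  let ?b = "frag_of (iso_class \<C> \<X> b)" and ?x = "frag_of (iso_class \<C> \<X> x)" and ?x' = "frag_of (iso_class \<C> \<X> x')"
  have h: "?c \<in> hom (free_Abelian_group ?S) Ksp"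
    unfolding K0_split_def by (rule presented_hom_coset[OF K0_split_relators_carrier])
  have k: "Poly_Mapping.keys ?b \<subseteq> ?S" "Poly_Mapping.keys ?x \<subseteq> ?S" "Poly_Mapping.keys ?x' \<subseteq> ?S"
    using iso_class_in_quotient assms b by simp_all
  have k2: "Poly_Mapping.keys (?x + ?x') \<subseteq> ?S" using keys_add[of ?x ?x'] k by blast
  have "?b - (?x + ?x') \<in> ?R" unfolding K0_split_relators_def using assms b by blast
  then have "?c (?b - (?x + ?x')) = \<one>\<^bsub>Ksp\<^esub>"
    unfolding K0_split_def by (rule presented_relator[OF K0_split_relators_carrier])
  then have "?c ?b \<otimes>\<^bsub>Ksp\<^esub> inv\<^bsub>Ksp\<^esub> (?c ?x \<otimes>\<^bsub>Ksp\<^esub> ?c ?x') = \<one>\<^bsub>Ksp\<^esub>"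
    using free_hom_diff[OF h G.is_group k(1) k2] free_hom_add[OF h k(2,3)] by simp
  then have "spcls b \<otimes>\<^bsub>Ksp\<^esub> inv\<^bsub>Ksp\<^esub> (spcls x \<otimes>\<^bsub>Ksp\<^esub> spcls x') = \<one>\<^bsub>Ksp\<^esub>"
    by (simp add: K0_split_class_def presented_class_def)
  then show ?thesis using spcls_closed assms b G.inv_equality[of "spcls b" "inv\<^bsub>Ksp\<^esub> (spcls x \<otimes>\<^bsub>Ksp\<^esub> spcls x')"] by simp
qed

lemma relcls_conf:
  assumes "conf \<X> f g"
  shows "relcls (src g) = relcls (src f) \<otimes>\<^bsub>Krel\<^esub> relcls (tgt g)"
proof -
  let ?S = "Ob \<C> // iso_rel \<C> (Ob \<C>)" and ?R = "K0_rel_relators \<C> \<X>"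
  let ?c = "\<lambda>x. generate (free_Abelian_group ?S) ?R #>\<^bsub>free_Abelian_group ?S\<^esub> x"
  note F = ses_arr[OF conf_ses[OF assms]]
  let ?a = "frag_of (iso_class \<C> (Ob \<C>) (src f))" and ?b = "frag_of (iso_class \<C> (Ob \<C>) (src g))"
    and ?d = "frag_of (iso_class \<C> (Ob \<C>) (tgt g))"
  have h: "?c \<in> hom (free_Abelian_group ?S) Krel"
    unfolding K0_rel_def by (rule presented_hom_coset[OF K0_rel_relators_carrier])
  have k: "Poly_Mapping.keys ?a \<subseteq> ?S" "Poly_Mapping.keys ?b \<subseteq> ?S" "Poly_Mapping.keys ?d \<subseteq> ?S"
    using iso_class_in_quotient F by simp_all
  have k2: "Poly_Mapping.keys (?a - ?b) \<subseteq> ?S" using keys_diff[of ?a ?b] k by blast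
  have "?a - ?b + ?d \<in> ?R" unfolding K0_rel_relators_def rel_conflation_iff using assms F(3) by force
  then have "?c (?a - ?b + ?d) = \<one>\<^bsub>Krel\<^esub>"
    unfolding K0_rel_def by (rule presented_relator[OF K0_rel_relators_carrier])
  then have "(?c ?a \<otimes>\<^bsub>Krel\<^esub> inv\<^bsub>Krel\<^esub> ?c ?b) \<otimes>\<^bsub>Krel\<^esub> ?c ?d = \<one>\<^bsub>Krel\<^esub>"
    using free_hom_diff[OF h H.is_group k(1,2)] free_hom_add[OF h k2 k(3)] by simp
  then have eq: "(relcls (src f) \<otimes>\<^bsub>Krel\<^esub> inv\<^bsub>Krel\<^esub> relcls (src g)) \<otimes>\<^bsub>Krel\<^esub> relcls (tgt g) = \<one>\<^bsub>Krel\<^esub>"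
    by (simp add: K0_rel_class_def presented_class_def)
  have cl: "relcls (src f) \<in> carrier Krel" "relcls (src g) \<in> carrier Krel" "relcls (tgt g) \<in> carrier Krel"
    using relcls_closed F by simp_all
  have "(relcls (src f) \<otimes>\<^bsub>Krel\<^esub> relcls (tgt g)) \<otimes>\<^bsub>Krel\<^esub> inv\<^bsub>Krel\<^esub> relcls (src g) = \<one>\<^bsub>Krel\<^esub>"
    using eq cl by (simp add: H.m_ac)
  then show ?thesis using cl H.inv_equality[of "relcls (src f) \<otimes>\<^bsub>Krel\<^esub> relcls (tgt g)" "inv\<^bsub>Krel\<^esub> relcls (src g)"] by simp
qed

lemma spcls_zero:
  assumes z: "is_zero_object \<C> z" "z \<in> \<X>"
  shows "spcls z = \<one>\<^bsub>Ksp\<^esub>"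
proof -
  have zO: "z \<in> Ob \<C>" using z sub by blast
  have "zero z z = ide z"
  proof -
    have "zero z z \<in> Hom \<C> z z" "ide z \<in> Hom \<C> z z" using zO by (simp_all add: Hom_iff)
    then show ?thesis using z zO unfolding is_zero_object_def by blast
  qed
  then have "biprod z z z (ide z) (ide z) (ide z) (ide z)"
    unfolding biprod_def Hom_iff using zO add_zero(1)[of "ide z" z z] by simp
  then have "spcls z = spcls z \<otimes>\<^bsub>Ksp\<^esub> spcls z" using spcls_biproduct is_biproduct_iff z by blast
  then show ?thesis using spcls_closed[OF z(2)] G.l_cancel_one' by metis
qed

text \<open>
  \<open>euler m c v\<close> means that \<open>v\<close> is the alternating sum of the classes in some resolution of \<open>c\<close> of length
  \<open>m\<close>, defined by peeling off one syzygy at a time. It is a relation, as independence of the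
  resolution is only known after additivity (\<open>euler_isomorphic\<close>).
\<close>

primrec euler :: "nat \<Rightarrow> 'o \<Rightarrow> ('o set \<Rightarrow>\<^sub>0 int) set \<Rightarrow> bool" where
  "euler 0 c v \<longleftrightarrow> c \<in> \<X> \<and> v = spcls c"
| "euler (Suc m) c v \<longleftrightarrow> (\<exists>f g v'. conf \<X> f g \<and> src g \<in> \<X> \<and> tgt g = c \<and> euler m (src f) v' \<and>
     v = spcls (src g) \<otimes>\<^bsub>Ksp\<^esub> inv\<^bsub>Ksp\<^esub> v')"

lemma euler_closed: "euler m c v \<Longrightarrow> v \<in> carrier Ksp"
  by (induction m arbitrary: c v) (auto simp: spcls_closed)

lemma euler_zero:
  assumes "is_zero_object \<C> z" "z \<in> \<X>" shows "euler m z \<one>\<^bsub>Ksp\<^esub>"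
proof (induction m)
  case 0
  then show ?case using assms spcls_zero by simp
next
  case (Suc m)
  have "z \<in> Ob \<C>" using assms sub by blast
  then have "conf \<X> (zero z z) (ide z)" "src (zero z z) = z" "src (ide z) = z" "tgt (ide z) = z"
    using conf_zero_idm[OF assms(1)] by simp_all
  moreover have "\<one>\<^bsub>Ksp\<^esub> = spcls z \<otimes>\<^bsub>Ksp\<^esub> inv\<^bsub>Ksp\<^esub> \<one>\<^bsub>Ksp\<^esub>" using spcls_zero[OF assms] by simp
  ultimately show ?case using Suc assms(2) unfolding euler.simps by metis
qed

lemma euler_object:
  assumes x: "x \<in> \<X>" shows "euler m x (spcls x)"
proof (cases m)
  case 0
  then show ?thesis using x by simp
next
  case (Suc k)
  obtain z where z: "z \<in> \<X>" "is_zero_object \<C> z" using zero_closed by blast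
  have O: "z \<in> Ob \<C>" "x \<in> Ob \<C>" using sub z x by blast+
  then have "conf \<X> (zero z x) (ide x)" "src (zero z x) = z" "src (ide x) = x" "tgt (ide x) = x"
    using conf_zero_idm[OF z(2)] by simp_all
  moreover have "spcls x = spcls x \<otimes>\<^bsub>Ksp\<^esub> inv\<^bsub>Ksp\<^esub> \<one>\<^bsub>Ksp\<^esub>" using spcls_closed[OF x] by simp
  ultimately show ?thesis using Suc x euler_zero[OF z(2,1), of k] unfolding Suc euler.simps by metis
qed

text \<open>
  Adding \<open>x\<close> to the first term of the resolution as well leaves the syzygy unchanged.
\<close>

lemma euler_add_object:
  assumes "euler m c v" "x \<in> \<X>" "biprod c x b i i' p p'"
  shows "euler m b (v \<otimes>\<^bsub>Ksp\<^esub> spcls x)"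
  using assms
proof (cases m)
  case 0
  have "is_biproduct \<C> c x b" using assms(3) is_biproduct_iff by blast
  then show ?thesis using 0 assms spcls_biproduct biproduct_closed by auto
next
  case (Suc k)
  obtain f g v' where c: "conf \<X> f g" "src g \<in> \<X>" "tgt g = c" "euler k (src f) v'"
    "v = spcls (src g) \<otimes>\<^bsub>Ksp\<^esub> inv\<^bsub>Ksp\<^esub> v'"
    using assms(1) Suc by auto
  have O: "src g \<in> Ob \<C>" "x \<in> Ob \<C>" using c(2) assms(2) sub by blast+
  note F = ses_arr[OF conf_ses[OF c(1)]]
  obtain b' j j' q q' where b': "biprod (src g) x b' j j' q q'" using biprod_exists[OF O] by blast
  note B' = biprod_arr[OF b'] and B = biprod_arr[OF assms(3)]
  have ib: "is_biproduct \<C> (src g) x b'" using b' is_biproduct_iff by blast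
  have c': "conf \<X> (j \<cdot> f) (i \<cdot> (g \<cdot> q) \<boxplus> i' \<cdot> q')" by (rule conf_add[OF c(1) _ b']) (use assms(3) c(3) in simp)
  have d: "src (j \<cdot> f) = src f" "src (i \<cdot> (g \<cdot> q) \<boxplus> i' \<cdot> q') = b'" "tgt (i \<cdot> (g \<cdot> q) \<boxplus> i' \<cdot> q') = b"
    using F(1-3) B(1-15) B'(1-15) c(3) by simp_all
  have "v \<otimes>\<^bsub>Ksp\<^esub> spcls x = spcls b' \<otimes>\<^bsub>Ksp\<^esub> inv\<^bsub>Ksp\<^esub> v'"
    unfolding c(5) spcls_biproduct[OF ib c(2) assms(2)]
    using spcls_closed[OF c(2)] spcls_closed[OF assms(2)] euler_closed[OF c(4)] by (simp add: G.m_ac)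
  then show ?thesis unfolding Suc euler.simps
    using c' d biproduct_closed[OF ib c(2) assms(2)] c(4) by metis
qed

text \<open>
  Write \<open>K\<^sub>A \<rightarrow> X\<^sub>A \<rightarrow> A\<close> and so on for the first steps of the resolutions. Rotation successively
  gives conflations
  \<open>K\<^sub>C \<rightarrow> A \<oplus> X\<^sub>C \<rightarrow> B\<close>, \<open>K\<^sub>B \<rightarrow> K\<^sub>C \<oplus> X\<^sub>B \<rightarrow> A \<oplus> X\<^sub>C\<close> and \<open>K\<^sub>A \<rightarrow> K\<^sub>B \<oplus> X\<^sub>A \<oplus> X\<^sub>C \<rightarrow> K\<^sub>C \<oplus> X\<^sub>B\<close>. The objects in the
  last one have shorter resolutions, so the induction hypothesis applies to it.
\<close>

theorem euler_additive:
  assumes "conf \<X> f h" "euler m (src f) \<alpha>" "euler m (src h) \<beta>" "euler m (tgt h) \<gamma>"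
  shows "\<beta> = \<alpha> \<otimes>\<^bsub>Ksp\<^esub> \<gamma>"
  using assms
proof (induction m arbitrary: f h \<alpha> \<beta> \<gamma>)
  case 0
  then have "is_biproduct \<C> (src f) (tgt h) (src h)" using conf_split by simp
  then show ?case using spcls_biproduct 0 by simp
next
  case (Suc m)
  note F = ses_arr[OF conf_ses[OF Suc.prems(1)]]
  obtain fA gA \<alpha>' where A: "conf \<X> fA gA" "src gA \<in> \<X>" "tgt gA = src f" "euler m (src fA) \<alpha>'"
    "\<alpha> = spcls (src gA) \<otimes>\<^bsub>Ksp\<^esub> inv\<^bsub>Ksp\<^esub> \<alpha>'"
    using Suc.prems(2) by auto
  obtain fB gB \<beta>' where B: "conf \<X> fB gB" "src gB \<in> \<X>" "tgt gB = src h" "euler m (src fB) \<beta>'"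
    "\<beta> = spcls (src gB) \<otimes>\<^bsub>Ksp\<^esub> inv\<^bsub>Ksp\<^esub> \<beta>'"
    using Suc.prems(3) by auto
  obtain fC gC \<gamma>' where C: "conf \<X> fC gC" "src gC \<in> \<X>" "tgt gC = tgt h" "euler m (src fC) \<gamma>'"
    "\<gamma> = spcls (src gC) \<otimes>\<^bsub>Ksp\<^esub> inv\<^bsub>Ksp\<^esub> \<gamma>'"
    using Suc.prems(4) by auto
  note FA = ses_arr[OF conf_ses[OF A(1)]] and FB = ses_arr[OF conf_ses[OF B(1)]] and FC = ses_arr[OF conf_ses[OF C(1)]]
  have O: "src gA \<in> Ob \<C>" "src gB \<in> Ob \<C>" "src gC \<in> Ob \<C>" "src f \<in> Ob \<C>"
    "src fA \<in> Ob \<C>" "src fB \<in> Ob \<C>" "src fC \<in> Ob \<C>"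
    using FA FB FC F by simp_all
  obtain d1 i1 i1' p1 p1' where D1: "biprod (src f) (src gC) d1 i1 i1' p1 p1'" using biprod_exists[OF O(4,3)] by blast
  obtain k1 e1 where R1: "conf \<X> k1 e1" "src k1 = src fC" "src e1 = d1" "tgt e1 = src h"
    using conf_rotate[OF Suc.prems(1) C(1,3,2) D1] by blast
  obtain d2 i2 i2' p2 p2' where D2: "biprod (src fC) (src gB) d2 i2 i2' p2 p2'" using biprod_exists[OF O(7,2)] by blast
  have R1': "tgt gB = tgt e1" using R1 B by simp
  obtain k2 e2 where R2: "conf \<X> k2 e2" "src k2 = src fB" "src e2 = d2" "tgt e2 = d1"
    using conf_rotate[OF R1(1) B(1) R1' B(2)] D2 R1(2,3) by metis
  obtain y j j' q q' where Y: "biprod (src gA) (src gC) y j j' q q'" using biprod_exists[OF O(1,3)] by blast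
  have yb: "is_biproduct \<C> (src gA) (src gC) y" using Y is_biproduct_iff by blast
  have yX: "y \<in> \<X>" using biproduct_closed[OF yb A(2) C(2)] .
  let ?g = "i1 \<cdot> (gA \<cdot> q) \<boxplus> i1' \<cdot> q'"
  have Z: "conf \<X> (j \<cdot> fA) ?g" by (rule conf_add[OF A(1) _ Y]) (use D1 A(3) in simp)
  note BD1 = biprod_arr[OF D1] and BY = biprod_arr[OF Y]
  have Zd: "src (j \<cdot> fA) = src fA" "src ?g = y" "tgt ?g = d1"
    using FA(1-3) BD1(1-15) BY(1-15) A(3) by simp_all
  have yO: "y \<in> Ob \<C>" using BY by simp
  obtain d3 i3 i3' p3 p3' where D3: "biprod (src fB) y d3 i3 i3' p3 p3'" using biprod_exists[OF O(6) yO] by blast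
  have R2': "tgt ?g = tgt e2" "src ?g \<in> \<X>" using Zd R2 yX by simp_all
  have D3': "biprod (src k2) (src ?g) d3 i3 i3' p3 p3'" using D3 R2(2) Zd(2) by simp
  obtain k3 e3 where R3: "conf \<X> k3 e3" "src k3 = src (j \<cdot> fA)" "src e3 = d3" "tgt e3 = src e2"
    using conf_rotate[OF R2(1) Z R2' D3'] by blast
  have "euler m d3 (\<beta>' \<otimes>\<^bsub>Ksp\<^esub> spcls y)" by (rule euler_add_object[OF B(4) yX D3])
  moreover have "euler m d2 (\<gamma>' \<otimes>\<^bsub>Ksp\<^esub> spcls (src gB))" by (rule euler_add_object[OF C(4) B(2) D2])
  ultimately have "\<beta>' \<otimes>\<^bsub>Ksp\<^esub> spcls y = \<alpha>' \<otimes>\<^bsub>Ksp\<^esub> (\<gamma>' \<otimes>\<^bsub>Ksp\<^esub> spcls (src gB))"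
    using Suc.IH[OF R3(1)] R3 R2 Zd A(4) by simp
  then show ?case unfolding A(5) B(5) C(5) spcls_biproduct[OF yb A(2) C(2)]
    by (intro G.rotation_identity)
      (use euler_closed A(4) B(4) C(4) spcls_closed A(2) B(2) C(2) in auto)
qed

text \<open>
  Additivity for the conflation \<open>0 \<rightarrow> c \<rightarrow> c'\<close>.
\<close>

lemma euler_isomorphic:
  assumes "euler m c v" "euler m c' v'" "isomorphic \<C> c c'"
  shows "v = v'"
proof -
  obtain z where z: "z \<in> \<X>" "is_zero_object \<C> z" using zero_closed by blast
  obtain f g where fg: "conf \<X> f g" "src f = z" "src g = c" "tgt g = c'"
    using conf_zero_iso[OF z(2) assms(3)] by metis
  have "v = \<one>\<^bsub>Ksp\<^esub> \<otimes>\<^bsub>Ksp\<^esub> v'"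
    by (rule euler_additive[OF fg(1), of m]) (use fg euler_zero[OF z(2,1)] assms in simp_all)
  then show ?thesis using euler_closed[OF assms(2)] by simp
qed

text \<open>
  Removing the first term of a resolution shifts the exponents by one, which inverts the product.
\<close>

lemma euler_of_resolution:
  assumes "rel_resolution \<C> \<X> m c X d"
  shows "euler m c (finprod Ksp (\<lambda>i. spcls (X i) [^]\<^bsub>Ksp\<^esub> ((-1) ^ i :: int)) {..m})"
  using assms
proof (induction m arbitrary: c X d)
  case 0
  then have x: "X 0 = c" "c \<in> \<X>" using rel_resolution_0 by blast+
  have "finprod Ksp (\<lambda>i. spcls (X i) [^]\<^bsub>Ksp\<^esub> ((-1) ^ i :: int)) {..0} = spcls c"
    using x spcls_closed by (subst G.finprod_0) (auto simp: G.int_pow_1)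
  then show ?case using x by simp
next
  case (Suc m)
  let ?f = "\<lambda>X i. spcls (X i) [^]\<^bsub>Ksp\<^esub> ((-1) ^ i :: int)"
  obtain f g d' where fg: "conf \<X> f g" "src g = X 0" "tgt g = c" "X 0 \<in> \<X>"
    "rel_resolution \<C> \<X> m (src f) (\<lambda>i. X (Suc i)) d'"
    using rel_resolution_SucD[OF Suc.prems] by blast
  have X: "X i \<in> \<X>" if "i \<le> Suc m" for i using Suc.prems that by (simp add: rel_resolution_def)
  let ?v = "finprod Ksp (?f (\<lambda>i. X (Suc i))) {..m}"
  have e: "euler m (src f) ?v" by (rule Suc.IH[OF fg(5)])
  have cl: "?f X \<in> {..Suc m} \<rightarrow> carrier Ksp" "?f (\<lambda>i. X (Suc i)) \<in> {..m} \<rightarrow> carrier Ksp"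
    using X spcls_closed by auto
  have "finprod Ksp (?f X) {..Suc m} = finprod Ksp (\<lambda>i. ?f X (Suc i)) {..m} \<otimes>\<^bsub>Ksp\<^esub> ?f X 0"
    by (rule G.finprod_Suc2) (use cl(1) in \<open>auto simp: Pi_iff\<close>)
  also have "finprod Ksp (\<lambda>i. ?f X (Suc i)) {..m} = finprod Ksp (\<lambda>i. inv\<^bsub>Ksp\<^esub> ?f (\<lambda>i. X (Suc i)) i) {..m}"
    by (rule G.finprod_cong') (use cl(2) X spcls_closed in \<open>auto simp: G.int_pow_neg Pi_iff\<close>)
  also have "\<dots> = inv\<^bsub>Ksp\<^esub> ?v" by (rule G.finprod_inv) (use cl(2) in auto)
  also have "inv\<^bsub>Ksp\<^esub> ?v \<otimes>\<^bsub>Ksp\<^esub> ?f X 0 = spcls (X 0) \<otimes>\<^bsub>Ksp\<^esub> inv\<^bsub>Ksp\<^esub> ?v"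
    using euler_closed[OF e] spcls_closed[OF fg(4)] by (simp add: G.int_pow_1 G.m_comm)
  finally have "finprod Ksp (?f X) {..Suc m} = spcls (src g) \<otimes>\<^bsub>Ksp\<^esub> inv\<^bsub>Ksp\<^esub> ?v"
    unfolding fg(2) .
  then show ?case unfolding euler.simps
    by (intro exI[of _ f] exI[of _ g] exI[of _ ?v] conjI) (use fg(1-4) e in simp_all)
qed

text \<open>
  By additivity the Euler characteristic respects the relators of the relative Grothendieck group, and
  split conflations give the relators of the split one. The value of the Euler characteristic on an
  object of \<open>\<X>\<close> is its own class, and conversely the classes of a resolution of \<open>c\<close> sum up to the class of \<open>c\<close>
  because the conflations telescope.
\<close>

theorem K0_resolution:
  assumes res: "\<And>c. c \<in> Ob \<C> \<Longrightarrow> \<exists>X d. rel_resolution \<C> \<X> m c X d"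
  shows "\<exists>\<phi> \<psi>. group_isomorphisms Krel Ksp \<phi> \<psi> \<and>
    (\<forall>c \<in> Ob \<C>. \<forall>X d. rel_resolution \<C> \<X> m c X d \<longrightarrow>
       \<phi> (relcls c) = finprod Ksp (\<lambda>i. spcls (X i) [^]\<^bsub>Ksp\<^esub> ((-1) ^ i :: int)) {..m}) \<and>
    (\<forall>x \<in> \<X>. \<psi> (spcls x) = relcls x)"
proof -
  let ?S = "Ob \<C> // iso_rel \<C> (Ob \<C>)" and ?T = "\<X> // iso_rel \<C> \<X>"
  have ex: "\<exists>v. euler m c v" if "c \<in> Ob \<C>" for c using res[OF that] euler_of_resolution by blast
  define e where "e = (\<lambda>c. SOME v. euler m c v)"
  have e: "euler m c (e c)" if "c \<in> Ob \<C>" for c unfolding e_def using someI_ex[OF ex[OF that]] .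
  have e_eq: "e c = v" if "euler m c v" "c \<in> Ob \<C>" for c v
    using euler_isomorphic[OF e[OF that(2)] that(1)] isomorphic_refl that by blast
  define h where "h = (\<lambda>s. e (SOME c. c \<in> s))"
  have h: "h (iso_class \<C> (Ob \<C>) c) = e c" if c: "c \<in> Ob \<C>" for c
  proof -
    have "(SOME b. b \<in> iso_class \<C> (Ob \<C>) c) \<in> iso_class \<C> (Ob \<C>) c"
      using someI_ex[of "\<lambda>b. b \<in> iso_class \<C> (Ob \<C>) c"] iso_class_self[OF c c] by blast
    then have "(SOME b. b \<in> iso_class \<C> (Ob \<C>) c) \<in> Ob \<C>" "isomorphic \<C> c (SOME b. b \<in> iso_class \<C> (Ob \<C>) c)"
      using iso_class_mem by blast+
    then show ?thesis unfolding h_def using euler_isomorphic[OF e[OF c] e] by metis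
  qed
  obtain \<phi> where \<phi>: "\<phi> \<in> hom Krel Ksp" "\<And>s. s \<in> ?S \<Longrightarrow> \<phi> (presented_class ?S (K0_rel_relators \<C> \<X>) s) = h s"
    unfolding K0_rel_def
  proof (rule presented_universal[OF comm_group_K0_split K0_rel_relators_carrier])
    show "h ` ?S \<subseteq> carrier Ksp"
    proof (rule image_subsetI)
      fix s assume "s \<in> ?S"
      then obtain c where c: "c \<in> Ob \<C>" "s = iso_class \<C> (Ob \<C>) c" by (rule iso_class_cases)
      show "h s \<in> carrier Ksp" unfolding c(2) h[OF c(1)] by (rule euler_closed[OF e[OF c(1)]])
    qed
    fix k r assume k: "k \<in> hom (free_Abelian_group ?S) Ksp" "\<And>s. s \<in> ?S \<Longrightarrow> k (frag_of s) = h s"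
      and "r \<in> K0_rel_relators \<C> \<X>"
    then obtain f g where fg: "conf \<X> f g" and r: "r = frag_of (iso_class \<C> (Ob \<C>) (src f)) 
       - frag_of (iso_class \<C> (Ob \<C>) (tgt f)) + frag_of (iso_class \<C> (Ob \<C>) (tgt g))"
      unfolding K0_rel_relators_def rel_conflation_iff by blast
    note F = ses_arr[OF conf_ses[OF fg]]
    have O: "src f \<in> Ob \<C>" "tgt f \<in> Ob \<C>" "tgt g \<in> Ob \<C>" using F by simp_all
    let ?a = "frag_of (iso_class \<C> (Ob \<C>) (src f))" and ?b = "frag_of (iso_class \<C> (Ob \<C>) (tgt f))"
      and ?d = "frag_of (iso_class \<C> (Ob \<C>) (tgt g))"
    have ks: "Poly_Mapping.keys ?a \<subseteq> ?S" "Poly_Mapping.keys ?b \<subseteq> ?S" "Poly_Mapping.keys ?d \<subseteq> ?S"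
      using iso_class_in_quotient O by simp_all
    have ks2: "Poly_Mapping.keys (?a - ?b) \<subseteq> ?S" using keys_diff[of ?a ?b] ks by blast
    have kv: "k ?a = e (src f)" "k ?b = e (tgt f)" "k ?d = e (tgt g)"
      using k(2) h O iso_class_in_quotient by simp_all
    have cl: "e (src f) \<in> carrier Ksp" "e (tgt g) \<in> carrier Ksp" using e O euler_closed by blast+
    have eq: "e (tgt f) = e (src f) \<otimes>\<^bsub>Ksp\<^esub> e (tgt g)"
      by (rule euler_additive[OF fg]) (use e O F(3) in auto)
    show "k r = \<one>\<^bsub>Ksp\<^esub>"
      unfolding r free_hom_add[OF k(1) ks2 ks(3)] free_hom_diff[OF k(1) G.is_group ks(1,2)] kv eq
      by (rule G.relator_identity[OF cl])
  qed blast
  have \<phi>c: "\<phi> (relcls c) = e c" if "c \<in> Ob \<C>" for c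
    unfolding K0_rel_class_def using \<phi>(2) h[OF that] iso_class_in_quotient[OF that] by simp
  define k where "k = (\<lambda>s. relcls (SOME x. x \<in> s))"
  have rel_iso: "relcls c = relcls c'" if "isomorphic \<C> c c'" "c \<in> Ob \<C>" "c' \<in> Ob \<C>" for c c'
    unfolding K0_rel_class_def using iso_class_eq[OF that(2,3,1)] by simp
  have k: "k (iso_class \<C> \<X> x) = relcls x" if x: "x \<in> \<X>" for x
  proof -
    have xO: "x \<in> Ob \<C>" using x sub by blast
    have "(SOME b. b \<in> iso_class \<C> \<X> x) \<in> iso_class \<C> \<X> x"
      using someI_ex[of "\<lambda>b. b \<in> iso_class \<C> \<X> x"] iso_class_self[OF x xO] by blast
    then have "(SOME b. b \<in> iso_class \<C> \<X> x) \<in> \<X>" "isomorphic \<C> x (SOME b. b \<in> iso_class \<C> \<X> x)"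
      using iso_class_mem by blast+
    then show ?thesis unfolding k_def using rel_iso[OF _ xO] sub by (metis subsetD)
  qed
  obtain \<psi> where \<psi>: "\<psi> \<in> hom Ksp Krel" "\<And>s. s \<in> ?T \<Longrightarrow> \<psi> (presented_class ?T (K0_split_relators \<C> \<X>) s) = k s"
    unfolding K0_split_def
  proof (rule presented_universal[OF comm_group_K0_rel K0_split_relators_carrier])
    show "k ` ?T \<subseteq> carrier Krel"
    proof (rule image_subsetI)
      fix s assume "s \<in> ?T"
      then obtain x where "x \<in> \<X>" "s = iso_class \<C> \<X> x" by (rule iso_class_cases)
      then show "k s \<in> carrier Krel" using k relcls_closed sub by auto
    qed
    fix l r assume l: "l \<in> hom (free_Abelian_group ?T) Krel" "\<And>s. s \<in> ?T \<Longrightarrow> l (frag_of s) = k s"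
      and "r \<in> K0_split_relators \<C> \<X>"
    then obtain x x' b where x: "x \<in> \<X>" "x' \<in> \<X>" "b \<in> \<X>" "is_biproduct \<C> x x' b"
      and r: "r = frag_of (iso_class \<C> \<X> b) - (frag_of (iso_class \<C> \<X> x) + frag_of (iso_class \<C> \<X> x'))"
      unfolding K0_split_relators_def by blast
    let ?b = "frag_of (iso_class \<C> \<X> b)" and ?x = "frag_of (iso_class \<C> \<X> x)" and ?x' = "frag_of (iso_class \<C> \<X> x')"
    have ks: "Poly_Mapping.keys ?b \<subseteq> ?T" "Poly_Mapping.keys ?x \<subseteq> ?T" "Poly_Mapping.keys ?x' \<subseteq> ?T"
      using iso_class_in_quotient x by simp_all
    have ks2: "Poly_Mapping.keys (?x + ?x') \<subseteq> ?T" using keys_add[of ?x ?x'] ks by blast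
    have lv: "l ?b = relcls b" "l ?x = relcls x" "l ?x' = relcls x'"
      using l(2) k x iso_class_in_quotient by simp_all
    obtain i i' p p' where bp: "biprod x x' b i i' p p'" using x(4) is_biproduct_iff by blast
    have eq: "relcls b = relcls x \<otimes>\<^bsub>Krel\<^esub> relcls x'"
      using relcls_conf[OF biprod_conf[OF bp]] biprod_arr[OF bp] by simp
    have cl: "relcls x \<in> carrier Krel" "relcls x' \<in> carrier Krel" using relcls_closed x sub by blast+
    show "l r = \<one>\<^bsub>Krel\<^esub>"
      unfolding r free_hom_diff[OF l(1) H.is_group ks(1) ks2] free_hom_add[OF l(1) ks(2,3)] lv eq
      using cl by simp
  qed blast
  have \<psi>x: "\<psi> (spcls x) = relcls x" if "x \<in> \<X>" for x
    unfolding K0_split_class_def using \<psi>(2) k[OF that] iso_class_in_quotient[OF that] by simp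
  interpret \<psi>: group_hom Ksp Krel \<psi>
    using \<psi>(1) by (simp add: group_hom_def group_hom_axioms_def)
  have tel: "\<psi> v = relcls c" if "euler j c v" for j c v
    using that
  proof (induction j arbitrary: c v)
    case 0
    then show ?case using \<psi>x by simp
  next
    case (Suc j)
    obtain f g v' where fg: "conf \<X> f g" "src g \<in> \<X>" "tgt g = c" "euler j (src f) v'"
      "v = spcls (src g) \<otimes>\<^bsub>Ksp\<^esub> inv\<^bsub>Ksp\<^esub> v'"
      using Suc.prems by auto
    note F = ses_arr[OF conf_ses[OF fg(1)]]
    have cl: "relcls (src f) \<in> carrier Krel" "relcls c \<in> carrier Krel" using relcls_closed F fg(3) by auto
    have "\<psi> v = relcls (src g) \<otimes>\<^bsub>Krel\<^esub> inv\<^bsub>Krel\<^esub> relcls (src f)"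
      unfolding fg(5) using spcls_closed[OF fg(2)] euler_closed[OF fg(4)] \<psi>x[OF fg(2)] Suc.IH[OF fg(4)] by simp
    also have "\<dots> = relcls c" unfolding relcls_conf[OF fg(1)] fg(3) H.m_comm[OF cl] using cl by (simp add: H.m_assoc)
    finally show ?case .
  qed
  have "\<psi> (\<phi> y) = y" if y: "y \<in> carrier Krel" for y
  proof -
    have "(\<psi> \<circ> \<phi>) y = id y"
      using y unfolding K0_rel_def
    proof (rule presented_hom_unique[OF K0_rel_relators_carrier, rotated -1])
      show "group (presented_ab_group ?S (K0_rel_relators \<C> \<X>))" using H.is_group by (simp add: K0_rel_def)
      show "\<psi> \<circ> \<phi> \<in> hom (presented_ab_group ?S (K0_rel_relators \<C> \<X>)) (presented_ab_group ?S (K0_rel_relators \<C> \<X>))"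
        using hom_compose[OF \<phi>(1) \<psi>(1)] by (simp add: K0_rel_def)
      show "id \<in> hom (presented_ab_group ?S (K0_rel_relators \<C> \<X>)) (presented_ab_group ?S (K0_rel_relators \<C> \<X>))"
        by (simp add: hom_def)
      fix s assume "s \<in> ?S"
      then obtain c where c: "c \<in> Ob \<C>" "s = iso_class \<C> (Ob \<C>) c" by (rule iso_class_cases)
      have "\<psi> (\<phi> (relcls c)) = relcls c" using \<phi>c[OF c(1)] tel[OF e[OF c(1)]] by simp
      then show "(\<psi> \<circ> \<phi>) (presented_class ?S (K0_rel_relators \<C> \<X>) s) = id (presented_class ?S (K0_rel_relators \<C> \<X>) s)"
        unfolding c(2) K0_rel_class_def by simp
    qed
    then show ?thesis by simp
  qed
  moreover have "\<phi> (\<psi> y) = y" if y: "y \<in> carrier Ksp" for y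
  proof -
    have "(\<phi> \<circ> \<psi>) y = id y"
      using y unfolding K0_split_def
    proof (rule presented_hom_unique[OF K0_split_relators_carrier, rotated -1])
      show "group (presented_ab_group ?T (K0_split_relators \<C> \<X>))" using G.is_group by (simp add: K0_split_def)
      show "\<phi> \<circ> \<psi> \<in> hom (presented_ab_group ?T (K0_split_relators \<C> \<X>)) (presented_ab_group ?T (K0_split_relators \<C> \<X>))"
        using hom_compose[OF \<psi>(1) \<phi>(1)] by (simp add: K0_split_def)
      show "id \<in> hom (presented_ab_group ?T (K0_split_relators \<C> \<X>)) (presented_ab_group ?T (K0_split_relators \<C> \<X>))"
        by (simp add: hom_def)
      fix s assume "s \<in> ?T"
      then obtain x where x: "x \<in> \<X>" "s = iso_class \<C> \<X> x" by (rule iso_class_cases)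
      have "x \<in> Ob \<C>" using x sub by blast
      then have "\<phi> (\<psi> (spcls x)) = spcls x" using \<psi>x[OF x(1)] \<phi>c e_eq[OF euler_object[OF x(1)]] by simp
      then show "(\<phi> \<circ> \<psi>) (presented_class ?T (K0_split_relators \<C> \<X>) s) = id (presented_class ?T (K0_split_relators \<C> \<X>) s)"
        unfolding x(2) K0_split_class_def by simp
    qed
    then show ?thesis by simp
  qed
  ultimately have "group_isomorphisms Krel Ksp \<phi> \<psi>"
    using \<phi>(1) \<psi>(1) by (simp add: group_isomorphisms_def)
  moreover have "\<phi> (relcls c) = finprod Ksp (\<lambda>i. spcls (X i) [^]\<^bsub>Ksp\<^esub> ((-1) ^ i :: int)) {..m}"
    if "c \<in> Ob \<C>" "rel_resolution \<C> \<X> m c X d" for c X d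
    unfolding \<phi>c[OF that(1)] by (rule e_eq[OF euler_of_resolution[OF that(2)] that(1)])
  ultimately show ?thesis using \<psi>x by blast
qed

end

theorem theorem6p5:
  fixes \<C> :: "('o, 'm, 'e) preadditive_category_scheme"
    and \<X> :: "'o set"
    and n :: nat
  assumes "abelian_category \<C>"
    and "n \<ge> 1"
    and "n_cluster_tilting \<C> n \<X>"
  shows "(\<forall>c \<in> Ob \<C>. \<exists>X d. rel_resolution \<C> \<X> (n - 1) c X d) \<and>
    (\<exists>\<phi> \<psi>. group_isomorphisms (K0_rel \<C> \<X>) (K0_split \<C> \<X>) \<phi> \<psi> \<and>
       (\<forall>c \<in> Ob \<C>. \<forall>X d. rel_resolution \<C> \<X> (n - 1) c X d \<longrightarrow>
          \<phi> (K0_rel_class \<C> \<X> c) =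
            (\<Otimes>\<^bsub>K0_split \<C> \<X>\<^esub> i \<in> {..<n}.
               K0_split_class \<C> \<X> (X i) [^]\<^bsub>K0_split \<C> \<X>\<^esub> ((-1) ^ i :: int))) \<and>
       (\<forall>x \<in> \<X>. \<psi> (K0_split_class \<C> \<X> x) = K0_rel_class \<C> \<X> x))"
proof -
  interpret abelian_category \<C> by fact
  note ct = assms(3)
  have "\<X> \<subseteq> Ob \<C>" using ct unfolding n_cluster_tilting_def by blast
  moreover have "\<exists>z \<in> \<X>. is_zero_object \<C> z" using has_zero_object cluster_tilting_zero[OF ct] by blast
  ultimately interpret additive_subcategory \<C> \<X>
    by unfold_locales (use cluster_tilting_biproduct[OF ct] in blast)+
  have res: "\<exists>X d. rel_resolution \<C> \<X> (n - 1) c X d" if "c \<in> Ob \<C>" for c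
    by (rule resolution_exists[OF ct that]) (simp_all add: Ext_orthogonal_def)
  have "{..n - 1} = {..<n}" using assms(2) by auto
  then show ?thesis using K0_resolution[OF res] res by simp
qed

end
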